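(* Let $f_t:M\hookrightarrow V$ ($0\le t<T$) be the regularized mean curvature flow starting from a $G$-invariant hypersurface immersion $f$ with $(\phi\circ f)(M)$ compact. Then the horizontal part $g_{\mathcal H}$ of the induced metrics satisfies $$\frac{\partial g_{\mathcal H}}{\partial t}=-2\|H\|\,h_{\mathcal H}.$$
   Context: \textbf{Regularizable immersions.} $V$ is a separable infinite-dimensional Hilbert space with inner product $\langle\,,\rangle$. An immersion of a Hilbert manifold $M$ into $V$ is \emph{regularizable} if it has finite codimension, for every normal vector $v$ the shape operator $A_v$ is compact, and both $\mathrm{Tr}_r A_v:=\sum_{i=1}^\infty(\mu_i^++\mu_i^-)$ (where $\mu_1^-\le\mu_2^-\le\cdots\le0\le\cdots\le\mu_2^+\le\mu_1^+$ is the spectrum of $A_v$) and $\mathrm{Tr}\,A_v^2$ exist. Its \emph{regularized mean curvature vector} $H$ is the normal field with $\langle H,v\rangle=\mathrm{Tr}_rA_v$; it is \emph{minimal} if $H=0$. A family $f_t$ ($0\le t<T$) of regularizable immersions is a \emph{regularized mean curvature flow} if $\frac{\partial F}{\partial t}=H_t$, where $F(u,t)=f_t(u)$ and $H_t$ is the regularized mean curvature vector of $f_t$. \textbf{Setting.} $G$ is a Hilbert Lie group acting on $V$ isometrically and almost freely (finite stabilizers), all of whose orbits are minimal regularizable submanifolds; $\phi:V\to V/G$ is the orbit map onto the finite-dimensional orbifold $V/G$, with the Riemannian orbimetric making $\phi$ a Riemannian orbisubmersion. $\widetilde{\mathcal V}$ is the distribution tangent to the orbits and $\widetilde{\mathcal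 H}$ its orthogonal complement. $f:M\hookrightarrow V$ is a $G$-invariant immersion of codimension one with $(\phi\circ f)(M)$ compact; the flow $f_t$ is the family obtained by moving each point $f(u)$ along the horizontal lift (with initial velocity the regularized mean curvature vector of $f$ at $u$) of the trajectory of its projection under the mean curvature flow in $V/G$ of the hypersurface induced by $f$. \textbf{Notation.} $g_t,h_t,A_t,\xi_t$ are the induced metric, (scalar) second fundamental form, shape operator and unit normal field of $f_t$, with $H_t=\|H_t\|\xi_t$, $A_tX=-\widetilde\nabla_X\xi_t$ ($\widetilde\nabla$ the flat connection of $V$), $h_t(X,Y)=g_t(A_tX,Y)$. $\|H\|=\sqrt{\langle H,H\rangle}$. Let $\pi_M:M\times[0,T)\to M$ be the projection; $g,h,A,H,\xi$ denote the corresponding objects on $M\times[0,T)$, e.g. $g_{(u,t)}=(g_t)_u$ is a section of $\pi_M^*T^{(0,2)}M$. The subbundles $\mathcal V,\mathcal H\subset\pi_M^*TM$ are given by $f_{t*}(\mathcal V_{(u,t)})=\widetilde{\mathcal V}_{f_t(u)}$ and $f_{t*}(\mathcal H_{(u,t)})=f_{t*}(T_uM)\cap\widetilde{\mathcal H}_{f_t(u)}$; $X_{\mathcal H}$ is the orthogonal projection of $X$ to $\mathcal H$. For a $(0,2)$-tensor $B$, $B_{\mathcal H}(X,Y)=B(X_{\mathcal H},Y_{\mathcal H})$. For a section $B$ of $\pi_M^*T^{(r,s)}M$, $\frac{\partial B}{\partial t}$ at $(u,t)$ is the derivative of $t\mapsto B_{(u,t)}\in T^{(r,s)}_uM$. The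 equation is an identity of sections of $\pi_M^*T^{(0,2)}M$. *)

theory Defs
  imports "HOL-Analysis.Analysis" "HOL-Algebra.Group_Action"
begin

section \<open>Smooth maps and Hilbert manifolds\<close>

text \<open>
  \<open>D [v1, ..., vn] x\<close> is the \<open>n\<close>-th derivative of \<open>f\<close> at \<open>x\<close> applied to \<open>(vn, ..., v1)\<close>; the last clause
  says that the \<open>(n+1)\<close>-st derivative is the Frechet derivative (relative to \<open>S\<close>) of the
  \<open>n\<close>-th one in the norm of bounded \<open>n\<close>-linear maps. Non-open \<open>S\<close> occur only in the form
  (open set) \<open>\<times>\<close> (half-open interval), where derivatives relative to \<open>S\<close> are unique.
\<close>

definition smooth_on :: "'a::real_normed_vector set \<Rightarrow> ('a \<Rightarrow> 'b::real_normed_vector) \<Rightarrow> bool"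
  where "smooth_on S f \<longleftrightarrow> (\<exists>D :: 'a list \<Rightarrow> 'a \<Rightarrow> 'b.
    (\<forall>x\<in>S. D [] x = f x) \<and>
    (\<forall>x\<in>S. \<forall>vs. linear (\<lambda>v. D (v # vs) x)) \<and>
    (\<forall>x\<in>S. \<forall>n. \<exists>C. \<forall>vs. length vs = n \<longrightarrow> norm (D vs x) \<le> C * (\<Prod>v\<leftarrow>vs. norm v)) \<and>
    (\<forall>x\<in>S. \<forall>n. \<forall>\<epsilon>>0. \<exists>\<delta>>0. \<forall>y\<in>S. norm (y - x) < \<delta> \<longrightarrow>
      (\<forall>vs. length vs = n \<longrightarrow>
        norm (D vs y - D vs x - D ((y - x) # vs) x) \<le> \<epsilon> * norm (y - x) * (\<Prod>v\<leftarrow>vs. norm v))))"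

definition diffeomorphic_on ::
    "'a::real_normed_vector set \<Rightarrow> 'b::real_normed_vector set \<Rightarrow> ('a \<Rightarrow> 'b) \<Rightarrow> bool"
  where "diffeomorphic_on U W h \<longleftrightarrow>
    open U \<and> open W \<and> bij_betw h U W \<and> smooth_on U h \<and> smooth_on W (the_inv_into U h)"

type_synonym ('m, 'e) chart = "'m set \<times> ('m \<Rightarrow> 'e)"

abbreviation chart_inv :: "('m, 'e) chart \<Rightarrow> 'e \<Rightarrow> 'm"
  where "chart_inv \<kappa> \<equiv> the_inv_into (fst \<kappa>) (snd \<kappa>)"

definition hilbert_manifold ::
    "('m::t2_space, 'e::{real_inner, complete_space}) chart set \<Rightarrow> bool"
  where "hilbert_manifold A \<longleftrightarrow>
    (\<Union>\<kappa>\<in>A. fst \<kappa>) = UNIV \<and>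
    (\<forall>\<kappa>\<in>A. open (fst \<kappa>) \<and> open (snd \<kappa> ` fst \<kappa>) \<and> inj_on (snd \<kappa>) (fst \<kappa>) \<and>
      homeomorphism (fst \<kappa>) (snd \<kappa> ` fst \<kappa>) (snd \<kappa>) (chart_inv \<kappa>)) \<and>
    (\<forall>\<kappa>\<in>A. \<forall>\<mu>\<in>A. smooth_on (snd \<kappa> ` (fst \<kappa> \<inter> fst \<mu>)) (snd \<mu> \<circ> chart_inv \<kappa>))"

definition vector_atlas :: "('v, 'v) chart set"
  where "vector_atlas = {(UNIV, id)}"

definition prod_atlas ::
    "('m, 'e) chart set \<Rightarrow> ('n, 'f) chart set \<Rightarrow> ('m \<times> 'n, 'e \<times> 'f) chart set"
  where "prod_atlas A B = {(fst \<kappa> \<times> fst \<mu>, map_prod (snd \<kappa>) (snd \<mu>)) | \<kappa> \<mu>. \<kappa> \<in> A \<and> \<mu> \<in> B}"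

definition smooth_map_on :: "'m::topological_space set \<Rightarrow>
    ('m, 'e::real_normed_vector) chart set \<Rightarrow> ('n::topological_space, 'f::real_normed_vector) chart set \<Rightarrow>
    ('m \<Rightarrow> 'n) \<Rightarrow> bool"
  where "smooth_map_on S A B f \<longleftrightarrow> continuous_on S f \<and>
    (\<forall>\<kappa>\<in>A. \<forall>\<mu>\<in>B. smooth_on (snd \<kappa> ` {x \<in> fst \<kappa> \<inter> S. f x \<in> fst \<mu>}) (snd \<mu> \<circ> f \<circ> chart_inv \<kappa>))"

text \<open>
  Tangent vectors at \<open>u\<close> are represented by their components \<open>X :: 'e\<close> in a chart \<open>\<kappa>\<close> around \<open>u\<close>,
  and so are tensors. \<open>tmap \<kappa> f u\<close> is the differential \<open>f\<^sub>*\<close> at \<open>u\<close> in the chart \<open>\<kappa>\<close>.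
\<close>

definition tmap :: "('m, 'e::real_normed_vector) chart \<Rightarrow> ('m \<Rightarrow> 'v::real_normed_vector) \<Rightarrow> 'm \<Rightarrow> 'e \<Rightarrow> 'v"
  where "tmap \<kappa> f u = frechet_derivative (f \<circ> chart_inv \<kappa>) (at (snd \<kappa> u))"

definition tangent_image ::
    "('m, 'e::real_normed_vector) chart set \<Rightarrow> ('m \<Rightarrow> 'v::real_normed_vector) \<Rightarrow> 'm \<Rightarrow> 'v set"
  where "tangent_image A f u = {tmap \<kappa> f u X | \<kappa> X. \<kappa> \<in> A \<and> u \<in> fst \<kappa>}"

definition immersion ::
    "('m::topological_space, 'e::real_normed_vector) chart set \<Rightarrow> ('m \<Rightarrow> 'v::real_normed_vector) \<Rightarrow> bool"
  where "immersion A f \<longleftrightarrow> smooth_map_on UNIV A vector_atlas f \<and>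
    (\<forall>\<kappa>\<in>A. \<forall>u\<in>fst \<kappa>. inj (tmap \<kappa> f u) \<and> closed (range (tmap \<kappa> f u)))"

definition normal_space_at ::
    "('m, 'e::real_normed_vector) chart set \<Rightarrow> ('m \<Rightarrow> 'v::real_inner) \<Rightarrow> 'm \<Rightarrow> 'v set"
  where "normal_space_at A f u = orthogonal_comp (tangent_image A f u)"

definition hypersurface_immersion ::
    "('m::topological_space, 'e::real_normed_vector) chart set \<Rightarrow> ('m \<Rightarrow> 'v::real_inner) \<Rightarrow> bool"
  where "hypersurface_immersion A f \<longleftrightarrow> immersion A f \<and> (\<forall>u. dim (normal_space_at A f u) = 1)"


section \<open>Regularizable immersions\<close>

text \<open>
  Weingarten formula: if \<open>\<nu>\<close> is a local normal field with \<open>\<nu> u = v\<close>, then \<open>f\<^sub>* (A\<^sub>v X)\<close> is the tangential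
  part of minus the flat derivative of \<open>\<nu>\<close> along \<open>X\<close>.
\<close>

definition shape_operator :: "('m::topological_space, 'e::real_normed_vector) chart set \<Rightarrow>
    ('m, 'e) chart \<Rightarrow> ('m \<Rightarrow> 'v::real_inner) \<Rightarrow> 'm \<Rightarrow> 'v \<Rightarrow> 'e \<Rightarrow> 'e"
  where "shape_operator A \<kappa> f u v X = (THE Y. \<exists>W \<nu>. open W \<and> u \<in> W \<and>
      smooth_map_on W A vector_atlas \<nu> \<and> (\<forall>w\<in>W. \<nu> w \<in> normal_space_at A f w) \<and> \<nu> u = v \<and>
      - tmap \<kappa> \<nu> u X - tmap \<kappa> f u Y \<in> normal_space_at A f u)"

definition compact_operator :: "('a::real_normed_vector \<Rightarrow> 'b::real_normed_vector) \<Rightarrow> bool"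
  where "compact_operator S \<longleftrightarrow> bounded_linear S \<and> compact (closure (S ` cball 0 1))"

text \<open>
  \<open>p\<close> and \<open>m\<close> list the positive and the negative eigenvalues of a compact self-adjoint operator with
  multiplicity, by decreasing absolute value; a finite list is continued by zeros.
\<close>

definition spectral_sequences :: "('e::real_vector \<Rightarrow> 'e) \<Rightarrow> (nat \<Rightarrow> real) \<Rightarrow> (nat \<Rightarrow> real) \<Rightarrow> bool"
  where "spectral_sequences S p m \<longleftrightarrow>
    decseq p \<and> (\<forall>i. 0 \<le> p i) \<and> incseq m \<and> (\<forall>i. m i \<le> 0) \<and>
    (\<forall>c>0. finite {i. p i = c} \<and> card {i. p i = c} = dim {X. S X = c *\<^sub>R X}) \<and>
    (\<forall>c<0. finite {i. m i = c} \<and> card {i. m i = c} = dim {X. S X = c *\<^sub>R X})"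

definition has_regularized_trace :: "('e::real_vector \<Rightarrow> 'e) \<Rightarrow> real \<Rightarrow> bool"
  where "has_regularized_trace S r \<longleftrightarrow>
    (\<exists>p m. spectral_sequences S p m \<and> (\<lambda>i. p i + m i) sums r)"

definition has_square_trace :: "('e::real_vector \<Rightarrow> 'e) \<Rightarrow> real \<Rightarrow> bool"
  where "has_square_trace S r \<longleftrightarrow>
    (\<exists>p m. spectral_sequences S p m \<and> (\<lambda>i. (p i)\<^sup>2 + (m i)\<^sup>2) sums r)"

definition regularizable :: "('m::topological_space, 'e::real_normed_vector) chart set \<Rightarrow>
    ('m \<Rightarrow> 'v::real_inner) \<Rightarrow> bool"
  where "regularizable A f \<longleftrightarrow> immersion A f \<and>
    (\<forall>u. \<exists>B. finite B \<and> span B = normal_space_at A f u) \<and>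
    (\<forall>\<kappa>\<in>A. \<forall>u\<in>fst \<kappa>. \<forall>v\<in>normal_space_at A f u.
      compact_operator (shape_operator A \<kappa> f u v) \<and>
      (\<exists>r. has_regularized_trace (shape_operator A \<kappa> f u v) r) \<and>
      (\<exists>r. has_square_trace (shape_operator A \<kappa> f u v) r))"

definition regularized_mean_curvature :: "('m::topological_space, 'e::real_normed_vector) chart set \<Rightarrow>
    ('m \<Rightarrow> 'v::real_inner) \<Rightarrow> 'm \<Rightarrow> 'v \<Rightarrow> bool"
  where "regularized_mean_curvature A f u \<eta> \<longleftrightarrow> \<eta> \<in> normal_space_at A f u \<and>
    (\<forall>\<kappa>\<in>A. u \<in> fst \<kappa> \<longrightarrow> (\<forall>v\<in>normal_space_at A f u.
      has_regularized_trace (shape_operator A \<kappa> f u v) (\<eta> \<bullet> v)))"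

definition minimal_immersion :: "('m::topological_space, 'e::real_normed_vector) chart set \<Rightarrow>
    ('m \<Rightarrow> 'v::real_inner) \<Rightarrow> bool"
  where "minimal_immersion A f \<longleftrightarrow> regularizable A f \<and> (\<forall>u. regularized_mean_curvature A f u 0)"

definition regularized_mcf :: "('m::topological_space, 'e::real_normed_vector) chart set \<Rightarrow>
    real set \<Rightarrow> ('m \<Rightarrow> real \<Rightarrow> 'v::real_inner) \<Rightarrow> bool"
  where "regularized_mcf A I F \<longleftrightarrow>
    smooth_map_on (UNIV \<times> I) (prod_atlas A vector_atlas) vector_atlas (\<lambda>(u, t). F u t) \<and>
    (\<forall>t\<in>I. regularizable A (\<lambda>u. F u t)) \<and>
    (\<forall>u. \<forall>t\<in>I. \<exists>\<eta>. regularized_mean_curvature A (\<lambda>u. F u t) u \<eta> \<and>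
      (F u has_vector_derivative \<eta>) (at t within I))"


section \<open>Hilbert Lie groups and their actions\<close>

definition hilbert_lie_group ::
    "('g::t2_space) monoid \<Rightarrow> ('g, 'l::{real_inner, complete_space}) chart set \<Rightarrow> bool"
  where "hilbert_lie_group G AG \<longleftrightarrow> group G \<and> carrier G = UNIV \<and> hilbert_manifold AG \<and>
    smooth_map_on UNIV (prod_atlas AG AG) AG (\<lambda>(a, b). a \<otimes>\<^bsub>G\<^esub> b) \<and>
    smooth_map_on UNIV AG AG (\<lambda>a. inv\<^bsub>G\<^esub> a)"

definition smooth_action ::
    "'g::t2_space monoid \<Rightarrow> ('g, 'l::{real_inner, complete_space}) chart set \<Rightarrow>
     ('m::t2_space, 'e::{real_inner, complete_space}) chart set \<Rightarrow> ('g \<Rightarrow> 'm \<Rightarrow> 'm) \<Rightarrow> bool"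
  where "smooth_action G AG A \<rho> \<longleftrightarrow> group_action G UNIV \<rho> \<and>
    smooth_map_on UNIV (prod_atlas AG A) A (\<lambda>(a, x). \<rho> a x)"

definition isometric_action :: "('g \<Rightarrow> 'v::metric_space \<Rightarrow> 'v) \<Rightarrow> bool"
  where "isometric_action \<rho> \<longleftrightarrow> (\<forall>a x y. dist (\<rho> a x) (\<rho> a y) = dist x y)"

definition almost_free :: "'g monoid \<Rightarrow> ('g \<Rightarrow> 'v \<Rightarrow> 'v) \<Rightarrow> bool"
  where "almost_free G \<rho> \<longleftrightarrow> (\<forall>x. finite (stabilizer G \<rho> x))"

text \<open>
  The orbit of \<open>x\<close> is a submanifold: it is homeomorphic to \<open>G / G\<^sub>x\<close> via \<open>a \<mapsto> \<rho> a x\<close>. As \<open>G\<^sub>x\<close> is finite,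
  \<open>G \<rightarrow> G / G\<^sub>x\<close> is a covering, so that the local geometry of the orbit is that of the immersion
  \<open>a \<mapsto> \<rho> a x\<close> of \<open>G\<close>.
\<close>

definition minimal_orbits :: "'g monoid \<Rightarrow>
    ('g::topological_space, 'l::real_normed_vector) chart set \<Rightarrow> ('g \<Rightarrow> 'v::real_inner \<Rightarrow> 'v) \<Rightarrow> bool"
  where "minimal_orbits G AG \<rho> \<longleftrightarrow> (\<forall>x. minimal_immersion AG (\<lambda>a. \<rho> a x) \<and>
    quotient_map euclidean (top_of_set (orbit G \<rho> x)) (\<lambda>a. \<rho> a x))"

definition vertical_distribution ::
    "'g monoid \<Rightarrow> ('g, 'l::real_normed_vector) chart set \<Rightarrow> ('g \<Rightarrow> 'v::real_inner \<Rightarrow> 'v) \<Rightarrow> 'v \<Rightarrow> 'v set"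
  where "vertical_distribution G AG \<rho> x = tangent_image AG (\<lambda>a. \<rho> a x) \<one>\<^bsub>G\<^esub>"

definition horizontal_distribution ::
    "'g monoid \<Rightarrow> ('g, 'l::real_normed_vector) chart set \<Rightarrow> ('g \<Rightarrow> 'v::real_inner \<Rightarrow> 'v) \<Rightarrow> 'v \<Rightarrow> 'v set"
  where "horizontal_distribution G AG \<rho> x = orthogonal_comp (vertical_distribution G AG \<rho> x)"


section \<open>Orbifolds\<close>

text \<open>
  An orbifold chart \<open>(U, \<Gamma>, \<psi>)\<close>: \<open>\<Gamma>\<close> is a finite group of diffeomorphisms of the open set \<open>U\<close> and \<open>\<psi>\<close>
  induces a homeomorphism from \<open>U / \<Gamma>\<close> onto an open subset of the underlying space \<open>X\<close>.
\<close>

type_synonym ('k, 'q) orbichart = "'k set \<times> ('k \<Rightarrow> 'k) set \<times> ('k \<Rightarrow> 'q)"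

abbreviation ocdom :: "('k, 'q) orbichart \<Rightarrow> 'k set"
  where "ocdom ch \<equiv> fst ch"

abbreviation ocgrp :: "('k, 'q) orbichart \<Rightarrow> ('k \<Rightarrow> 'k) set"
  where "ocgrp ch \<equiv> fst (snd ch)"

abbreviation ocmap :: "('k, 'q) orbichart \<Rightarrow> 'k \<Rightarrow> 'q"
  where "ocmap ch \<equiv> snd (snd ch)"

definition orbifold_chart :: "'q topology \<Rightarrow> ('k::real_normed_vector, 'q) orbichart \<Rightarrow> bool"
  where "orbifold_chart X ch \<longleftrightarrow> open (ocdom ch) \<and>
    finite (ocgrp ch) \<and> subgroup (ocgrp ch) (BijGroup (ocdom ch)) \<and>
    (\<forall>\<gamma>\<in>ocgrp ch. smooth_on (ocdom ch) \<gamma>) \<and>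
    continuous_map (top_of_set (ocdom ch)) X (ocmap ch) \<and>
    open_map (top_of_set (ocdom ch)) X (ocmap ch) \<and>
    (\<forall>x\<in>ocdom ch. \<forall>y\<in>ocdom ch. ocmap ch x = ocmap ch y \<longleftrightarrow> (\<exists>\<gamma>\<in>ocgrp ch. \<gamma> x = y))"

definition transition :: "('k::real_normed_vector, 'q) orbichart \<Rightarrow> ('k, 'q) orbichart \<Rightarrow>
    'k set \<Rightarrow> 'k set \<Rightarrow> ('k \<Rightarrow> 'k) \<Rightarrow> bool"
  where "transition ch1 ch2 W1 W2 h \<longleftrightarrow> W1 \<subseteq> ocdom ch1 \<and> W2 \<subseteq> ocdom ch2 \<and>
    diffeomorphic_on W1 W2 h \<and> (\<forall>x\<in>W1. ocmap ch2 (h x) = ocmap ch1 x)"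

definition orbifold :: "'q topology \<Rightarrow> ('k::real_normed_vector, 'q) orbichart set \<Rightarrow> bool"
  where "orbifold X Q \<longleftrightarrow> Hausdorff_space X \<and> (\<forall>ch\<in>Q. orbifold_chart X ch) \<and>
    (\<Union>ch\<in>Q. ocmap ch ` ocdom ch) = topspace X \<and>
    (\<forall>ch1\<in>Q. \<forall>ch2\<in>Q. \<forall>x\<in>ocdom ch1. \<forall>y\<in>ocdom ch2. ocmap ch1 x = ocmap ch2 y \<longrightarrow>
      (\<exists>W1 W2 h. transition ch1 ch2 W1 W2 h \<and> x \<in> W1 \<and> h x = y))"

text \<open>A metric on an open set \<open>U\<close>: \<open>g x a b\<close> is the inner product of \<open>a\<close> and \<open>b\<close> at \<open>x\<close>.\<close>

definition riemannian_metric_on ::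
    "'n::euclidean_space set \<Rightarrow> ('n \<Rightarrow> 'n \<Rightarrow> 'n \<Rightarrow> real) \<Rightarrow> bool"
  where "riemannian_metric_on U g \<longleftrightarrow>
    (\<forall>x\<in>U. bilinear (g x) \<and> (\<forall>a b. g x a b = g x b a) \<and> (\<forall>a. a \<noteq> 0 \<longrightarrow> 0 < g x a a)) \<and>
    (\<forall>a b. smooth_on U (\<lambda>x. g x a b))"

definition riemannian_orbimetric :: "('n::euclidean_space, 'q) orbichart set \<Rightarrow>
    (('n, 'q) orbichart \<Rightarrow> 'n \<Rightarrow> 'n \<Rightarrow> 'n \<Rightarrow> real) \<Rightarrow> bool"
  where "riemannian_orbimetric Q g \<longleftrightarrow>
    (\<forall>ch\<in>Q. riemannian_metric_on (ocdom ch) (g ch)) \<and>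
    (\<forall>ch1\<in>Q. \<forall>ch2\<in>Q. \<forall>W1 W2 h. transition ch1 ch2 W1 W2 h \<longrightarrow>
      (\<forall>x\<in>W1. \<forall>a b. g ch2 (h x) (frechet_derivative h (at x) a) (frechet_derivative h (at x) b)
        = g ch1 x a b))"

definition local_lift :: "('m::topological_space, 'e::real_normed_vector) chart set \<Rightarrow> ('m \<Rightarrow> 'q) \<Rightarrow>
    ('k::real_normed_vector, 'q) orbichart \<Rightarrow> 'm set \<Rightarrow> ('m \<Rightarrow> 'k) \<Rightarrow> bool"
  where "local_lift A \<phi> ch W h \<longleftrightarrow> open W \<and> h ` W \<subseteq> ocdom ch \<and>
    smooth_map_on W A vector_atlas h \<and> (\<forall>w\<in>W. ocmap ch (h w) = \<phi> w)"

definition orbisubmersion :: "('m::topological_space, 'e::real_normed_vector) chart set \<Rightarrow>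
    ('k::real_normed_vector, 'q) orbichart set \<Rightarrow> ('m \<Rightarrow> 'q) \<Rightarrow> bool"
  where "orbisubmersion A Q \<phi> \<longleftrightarrow>
    (\<forall>ch\<in>Q. \<forall>x. \<forall>y\<in>ocdom ch. ocmap ch y = \<phi> x \<longrightarrow>
      (\<exists>W h. local_lift A \<phi> ch W h \<and> x \<in> W \<and> h x = y \<and>
        (\<forall>\<kappa>\<in>A. \<forall>w\<in>W \<inter> fst \<kappa>. surj (tmap \<kappa> h w))))"

definition riemannian_orbisubmersion :: "('n::euclidean_space, 'q) orbichart set \<Rightarrow>
    (('n, 'q) orbichart \<Rightarrow> 'n \<Rightarrow> 'n \<Rightarrow> 'n \<Rightarrow> real) \<Rightarrow> ('v::real_inner \<Rightarrow> 'q) \<Rightarrow> bool"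
  where "riemannian_orbisubmersion Q g \<phi> \<longleftrightarrow>
    (\<forall>ch\<in>Q. \<forall>x. \<forall>y\<in>ocdom ch. ocmap ch y = \<phi> x \<longrightarrow>
      (\<exists>W h. local_lift vector_atlas \<phi> ch W h \<and> x \<in> W \<and> h x = y \<and>
        (\<forall>w\<in>W. let dh = frechet_derivative h (at w); K = orthogonal_comp {a. dh a = 0} in
          surj dh \<and> (\<forall>a\<in>K. \<forall>b\<in>K. g ch (h w) (dh a) (dh b) = a \<bullet> b))))"


section \<open>Mean curvature flow in a Riemannian orbifold\<close>

text \<open>
  The Levi-Civita connection of \<open>g\<close> in the coordinates of \<open>'n\<close> (Koszul formula for constant fields).
\<close>

definition christoffel :: "('n::euclidean_space \<Rightarrow> 'n \<Rightarrow> 'n \<Rightarrow> real) \<Rightarrow> 'n \<Rightarrow> 'n \<Rightarrow> 'n \<Rightarrow> 'n"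
  where "christoffel g x a b = (THE z. \<forall>c. 2 * g x z c =
      frechet_derivative (\<lambda>y. g y b c) (at x) a +
      frechet_derivative (\<lambda>y. g y a c) (at x) b -
      frechet_derivative (\<lambda>y. g y a b) (at x) c)"

text \<open>
  The mean curvature vector of the immersion \<open>F\<close> into \<open>('n, g)\<close> at \<open>x\<close> is the unnormalized trace of the
  second fundamental form, i.e. the normal part of the sum below over an orthonormal basis \<open>B\<close> of the
  tangent space with respect to the induced metric.
\<close>

definition mean_curvature_vector :: "('n::euclidean_space \<Rightarrow> 'n \<Rightarrow> 'n \<Rightarrow> real) \<Rightarrow>
    ('k::real_normed_vector \<Rightarrow> 'n) \<Rightarrow> 'k \<Rightarrow> 'n \<Rightarrow> bool"
  where "mean_curvature_vector g F x \<eta> \<longleftrightarrow>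
    (let dF = (\<lambda>y. frechet_derivative F (at y)) in
      (\<forall>a. g (F x) \<eta> (dF x a) = 0) \<and>
      (\<exists>B. finite B \<and> span B = UNIV \<and>
        (\<forall>a\<in>B. \<forall>b\<in>B. g (F x) (dF x a) (dF x b) = (if a = b then 1 else 0)) \<and>
        (\<Sum>b\<in>B. frechet_derivative (\<lambda>y. dF y b) (at x) b +
                christoffel g (F x) (dF x b) (dF x b)) - \<eta> \<in> range (dF x)))"

text \<open>
  Mean curvature flow of hypersurfaces: every point of the source orbifold and every time admit a local
  lift to orbifold charts which is a family of hypersurface immersions evolving by its mean curvature.
\<close>

definition orbifold_mcf :: "('k::real_normed_vector, 'p) orbichart set \<Rightarrow>
    ('n::euclidean_space, 'q) orbichart set \<Rightarrow> (('n, 'q) orbichart \<Rightarrow> 'n \<Rightarrow> 'n \<Rightarrow> 'n \<Rightarrow> real) \<Rightarrow>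
    real set \<Rightarrow> ('p \<Rightarrow> real \<Rightarrow> 'q) \<Rightarrow> bool"
  where "orbifold_mcf P Q g I F \<longleftrightarrow>
    (\<forall>ch1\<in>P. \<forall>ch2\<in>Q. \<forall>x0\<in>ocdom ch1. \<forall>t0\<in>I. \<forall>y0\<in>ocdom ch2. ocmap ch2 y0 = F (ocmap ch1 x0) t0 \<longrightarrow>
      (\<exists>W J h. open W \<and> x0 \<in> W \<and> W \<subseteq> ocdom ch1 \<and> open J \<and> t0 \<in> J \<and> h x0 t0 = y0 \<and>
        smooth_on (W \<times> (J \<inter> I)) (\<lambda>(x, t). h x t) \<and>
        (\<forall>x\<in>W. \<forall>t\<in>J \<inter> I.
          h x t \<in> ocdom ch2 \<and> ocmap ch2 (h x t) = F (ocmap ch1 x) t \<and>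
          (let d = frechet_derivative (\<lambda>y. h y t) (at x) in
            inj d \<and> dim (range d) + 1 = DIM('n)) \<and>
          (\<exists>\<eta>. mean_curvature_vector (g ch2) (\<lambda>y. h y t) x \<eta> \<and>
            (h x has_vector_derivative \<eta>) (at t within J \<inter> I)))))"

text \<open>
  \<open>\<gamma>\<close> is the horizontal lift, with initial velocity \<open>v\<close>, of the curve \<open>c\<close> in the orbit space. The
  initial velocity is prescribed since a curve in an orbifold can have several lifts through a point.
\<close>

definition horizontal_lift :: "real set \<Rightarrow> ('v::real_normed_vector \<Rightarrow> 'q) \<Rightarrow> ('v \<Rightarrow> 'v set) \<Rightarrow>
    (real \<Rightarrow> 'q) \<Rightarrow> 'v \<Rightarrow> (real \<Rightarrow> 'v) \<Rightarrow> bool"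
  where "horizontal_lift I \<phi> \<D> c v \<gamma> \<longleftrightarrow>
    (\<forall>t\<in>I. \<phi> (\<gamma> t) = c t \<and> (\<exists>w\<in>\<D> (\<gamma> t). (\<gamma> has_vector_derivative w) (at t within I))) \<and>
    (\<gamma> has_vector_derivative v) (at 0 within I)"


section \<open>Tensors of a hypersurface and their horizontal parts\<close>

definition induced_metric :: "('m, 'e::real_normed_vector) chart \<Rightarrow> ('m \<Rightarrow> 'v::real_inner) \<Rightarrow>
    'm \<Rightarrow> 'e \<Rightarrow> 'e \<Rightarrow> real"
  where "induced_metric \<kappa> f u X Y = tmap \<kappa> f u X \<bullet> tmap \<kappa> f u Y"

definition second_fundamental_form :: "('m::topological_space, 'e::real_normed_vector) chart set \<Rightarrow>
    ('m, 'e) chart \<Rightarrow> ('m \<Rightarrow> 'v::real_inner) \<Rightarrow> 'm \<Rightarrow> 'v \<Rightarrow> 'e \<Rightarrow> 'e \<Rightarrow> real"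
  where "second_fundamental_form A \<kappa> f u \<xi> X Y =
    induced_metric \<kappa> f u (shape_operator A \<kappa> f u \<xi> X) Y"

text \<open>\<open>horizontal_space \<kappa> f \<D> u\<close> is the subspace \<open>\<H>\<close> of \<open>T\<^sub>uM\<close> with \<open>f\<^sub>* \<H> = f\<^sub>* (T\<^sub>uM) \<inter> \<D> (f u)\<close>.\<close>

definition horizontal_space :: "('m, 'e::real_normed_vector) chart \<Rightarrow>
    ('m \<Rightarrow> 'v::real_inner) \<Rightarrow> ('v \<Rightarrow> 'v set) \<Rightarrow> 'm \<Rightarrow> 'e set"
  where "horizontal_space \<kappa> f \<D> u = {X. tmap \<kappa> f u X \<in> \<D> (f u)}"

definition horizontal_projection :: "('m, 'e::real_normed_vector) chart \<Rightarrow>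
    ('m \<Rightarrow> 'v::real_inner) \<Rightarrow> ('v \<Rightarrow> 'v set) \<Rightarrow> 'm \<Rightarrow> 'e \<Rightarrow> 'e"
  where "horizontal_projection \<kappa> f \<D> u X = (THE Z. Z \<in> horizontal_space \<kappa> f \<D> u \<and>
    (\<forall>Y\<in>horizontal_space \<kappa> f \<D> u. induced_metric \<kappa> f u (X - Z) Y = 0))"

text \<open>
  The horizontal part of a (0,2)-tensor, as an element of the Banach space of bounded bilinear forms
  on \<open>T\<^sub>uM\<close>.
\<close>

definition horizontal_part :: "('m, 'e::real_normed_vector) chart \<Rightarrow>
    ('m \<Rightarrow> 'v::real_inner) \<Rightarrow> ('v \<Rightarrow> 'v set) \<Rightarrow> 'm \<Rightarrow> ('e \<Rightarrow> 'e \<Rightarrow> real) \<Rightarrow> 'e \<Rightarrow>\<^sub>L 'e \<Rightarrow>\<^sub>L real"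
  where "horizontal_part \<kappa> f \<D> u B = Blinfun (\<lambda>X. Blinfun (\<lambda>Y.
    B (horizontal_projection \<kappa> f \<D> u X) (horizontal_projection \<kappa> f \<D> u Y)))"

end

theory Submission
  imports Defs
begin

text \<open>
  Fix a point \<open>u\<close> of \<open>M\<close> and a chart around it, and write \<open>d\<^sub>t\<close> for the differential of \<open>f\<^sub>t\<close> at \<open>u\<close>. The
  induced metric changes by the usual first variation: the derivative of \<open>d\<^sub>t\<close> is the differential of the
  velocity \<open>H\<^sub>t\<close>, and differentiating \<open>\<langle>H\<^sub>t, d\<^sub>t Y\<rangle> = 0\<close> shows that
  \<open>\<langle>d\<^sub>t' X, d\<^sub>t Y\<rangle> = - \<langle>H\<^sub>t, D\<^sup>2 f\<^sub>t (X, Y)\<rangle> = - \<parallel>H\<parallel> h (X, Y)\<close>.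

  The question is how the horizontal projections \<open>P\<^sub>t\<close> contribute. They do not, because the vertical
  subspace \<open>\<V>\<close> of \<open>T\<^sub>uM\<close> is the same for all \<open>t\<close>, namely the tangent space \<open>W\<close> of the orbit of \<open>u\<close> in \<open>M\<close>.
  The flow projects to a flow in \<open>V/G\<close>, hence \<open>f\<^sub>t\<close> maps the orbit of \<open>u\<close> into a single orbit in \<open>V\<close>, and
  \<open>d\<^sub>t W\<close> is contained in the tangent space of this orbit (\<open>velocity_in_orbit\<close>). At \<open>t = 0\<close> equality holds since
  \<open>f\<close> is equivariant. Both \<open>d\<^sub>t W\<close> and the tangent spaces of the orbits are ranges of norm continuous
  families of operators which are bounded below, so that their codimensions do not change along a connected
  parameter space (\<open>codim_range_constant\<close>); the codimension is finite since the orbits are regularizable. So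
  equality holds for all \<open>t\<close> (\<open>vertical_directions_of_flow\<close>).

  The projections \<open>P\<^sub>s\<close> therefore differ by vectors of the common kernel \<open>W\<close>, and Pythagoras' theorem shows that
  \<open>g\<^sub>\<H>\<close> at time \<open>s\<close> differs from \<open>g\<^sub>s (P\<^sub>t X, P\<^sub>t Y)\<close> by a term of order \<open>(s - t)\<^sup>2\<close>
  (\<open>projected_metric_has_derivative\<close>). No differentiability of the projections has to be established.

  The shape operator refers to smooth normal extensions of \<open>\<xi>\<close>. Where \<open>H \<noteq> 0\<close>, a multiple of the velocity field
  is such an extension (\<open>second_fundamental_form_eq\<close>); where \<open>H = 0\<close>, both sides of the equation vanish. That
  the velocity of the flow is the field \<open>H\<close> rests on the uniqueness of the regularized trace.
\<close>

section \<open>Subspaces of finite codimension in a Hilbert space\<close>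

text \<open>
  By the parallelogram law, a sequence in \<open>R\<close> that minimizes the distance to \<open>v\<close> is Cauchy.
\<close>

lemma orthogonal_projection_exists:
  fixes R :: "'a::{real_inner, complete_space} set"
  assumes "closed R" "subspace R"
  obtains r where "r \<in> R" "v - r \<in> orthogonal_comp R"
proof -
  define d where "d = infdist v R"
  have ne: "R \<noteq> {}" using assms(2) subspace_0 by blast
  have dle: "d \<le> norm (v - y)" if "y \<in> R" for y
    using infdist_le[OF that, of v] by (simp add: d_def dist_norm)
  have d0: "0 \<le> d" by (simp add: d_def infdist_nonneg)
  have "\<exists>r. r \<in> R \<and> norm (v - r) < d + 1 / (real n + 1)" for n
  proof -
    have "infdist v R < d + 1 / (real n + 1)" by (simp add: d_def add_pos_nonneg)
    then have "\<exists>y\<in>R. dist v y < d + 1 / (real n + 1)"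
      using cINF_less_iff[of R "dist v"] ne by (simp add: infdist_def)
    then show ?thesis by (auto simp: dist_norm)
  qed
  then obtain r where r: "\<And>n. r n \<in> R" "\<And>n. norm (v - r n) < d + 1 / (real n + 1)" by metis
  have par: "(norm (x - y))\<^sup>2 + (2 * d)\<^sup>2 \<le> 2 * (norm (v - x))\<^sup>2 + 2 * (norm (v - y))\<^sup>2" if "x \<in> R" "y \<in> R" for x y
  proof -
    have "(1/2) *\<^sub>R (x + y) \<in> R" using that assms(2) by (simp add: subspace_add subspace_scale)
    then have "d \<le> norm (v - (1/2) *\<^sub>R (x + y))" by (rule dle)
    also have "\<dots> = norm ((1/2) *\<^sub>R ((v - x) + (v - y)))"
      by (simp add: algebra_simps flip: scaleR_add_left)
    finally have "2 * d \<le> norm ((v - x) + (v - y))" by simp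
    then have "(2 * d)\<^sup>2 \<le> (norm ((v - x) + (v - y)))\<^sup>2" using d0 by (intro power_mono) auto
    moreover have "(norm (x - y))\<^sup>2 = (norm ((v - x) - (v - y)))\<^sup>2"
      by (simp add: norm_minus_commute)
    ultimately show ?thesis
      by (simp add: power2_norm_eq_inner inner_add_left inner_add_right inner_diff_left inner_diff_right)
  qed
  have rle: "norm (v - r n) \<le> d + 1 / (real N + 1)" if "n \<ge> N" for n N
  proof -
    have "1 / (real n + 1) \<le> 1 / (real N + 1)" using that by (simp add: frac_le)
    then show ?thesis using r(2)[of n] by linarith
  qed
  have inv0: "(\<lambda>n. 1 / (real n + 1)) \<longlonglongrightarrow> 0"
    using LIMSEQ_inverse_real_of_nat by (simp add: inverse_eq_divide add.commute)
  have lim0: "(\<lambda>N. 2 * (d + 1 / (real N + 1))\<^sup>2 + 2 * (d + 1 / (real N + 1))\<^sup>2 - (2 * d)\<^sup>2) \<longlonglongrightarrow>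
      2 * (d + 0)\<^sup>2 + 2 * (d + 0)\<^sup>2 - (2 * d)\<^sup>2"
    by (intro tendsto_intros inv0)
  have "Cauchy r"
  proof (rule metric_CauchyI)
    fix e :: real assume e: "0 < e"
    then have "0 < e\<^sup>2" by simp
    with lim0 have "\<forall>\<^sub>F N in sequentially.
        2 * (d + 1 / (real N + 1))\<^sup>2 + 2 * (d + 1 / (real N + 1))\<^sup>2 - (2 * d)\<^sup>2 < e\<^sup>2"
      by (intro order_tendstoD) (auto simp: power2_eq_square)
    then obtain N where N: "2 * (d + 1 / (real N + 1))\<^sup>2 + 2 * (d + 1 / (real N + 1))\<^sup>2 - (2 * d)\<^sup>2 < e\<^sup>2"
      by (meson eventually_sequentially order_refl)
    have "dist (r m) (r n) < e" if "m \<ge> N" "n \<ge> N" for m n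
    proof -
      have "(norm (v - r m))\<^sup>2 \<le> (d + 1 / (real N + 1))\<^sup>2" "(norm (v - r n))\<^sup>2 \<le> (d + 1 / (real N + 1))\<^sup>2"
        using rle that by (auto intro!: power_mono)
      then have "(norm (r m - r n))\<^sup>2 < e\<^sup>2" using par[OF r(1)[of m] r(1)[of n]] N by linarith
      then show ?thesis using e by (simp add: dist_norm power2_less_imp_less)
    qed
    then show "\<exists>M. \<forall>m\<ge>M. \<forall>n\<ge>M. dist (r m) (r n) < e" by blast
  qed
  then obtain l where l: "r \<longlonglongrightarrow> l" by (meson Cauchy_convergent convergent_def)
  have lR: "l \<in> R" using assms(1) r(1) l closed_sequentially by blast
  have "norm (v - l) \<le> d"
  proof (rule LIMSEQ_le)
    show "(\<lambda>n. norm (v - r n)) \<longlonglongrightarrow> norm (v - l)" by (intro tendsto_intros l)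
    have "(\<lambda>n. d + 1 / (real n + 1)) \<longlonglongrightarrow> d + 0"
      by (intro tendsto_intros inv0)
    then show "(\<lambda>n. d + 1 / (real n + 1)) \<longlonglongrightarrow> d" by simp
  qed (use r(2) in \<open>auto intro: less_imp_le\<close>)
  moreover have "orthogonal y (v - l)" if "y \<in> R" for y
  proof (cases "y = 0")
    case False
    define t where "t = (y \<bullet> (v - l)) / (y \<bullet> y)"
    have "l + t *\<^sub>R y \<in> R" using lR that assms(2) by (simp add: subspace_add subspace_scale)
    then have "norm (v - l) \<le> norm (v - (l + t *\<^sub>R y))" using dle \<open>norm (v - l) \<le> d\<close> by force
    then have "(norm (v - l))\<^sup>2 \<le> (norm ((v - l) - t *\<^sub>R y))\<^sup>2" by (simp add: algebra_simps)
    also have "\<dots> = (norm (v - l))\<^sup>2 - 2 * t * (y \<bullet> (v - l)) + t * t * (y \<bullet> y)"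
      unfolding power2_norm_eq_inner by (simp add: inner_diff_left inner_diff_right algebra_simps inner_commute)
    also have "\<dots> = (norm (v - l))\<^sup>2 - (y \<bullet> (v - l))\<^sup>2 / (y \<bullet> y)"
      using False by (simp add: t_def field_simps power2_eq_square)
    finally have "(y \<bullet> (v - l))\<^sup>2 / (y \<bullet> y) \<le> 0" by simp
    moreover have "y \<bullet> y > 0" using False by simp
    ultimately have "(y \<bullet> (v - l))\<^sup>2 \<le> 0" by (simp add: field_simps)
    then show ?thesis by (simp add: orthogonal_def)
  qed (simp add: orthogonal_def)
  ultimately show ?thesis using that lR by (auto simp: orthogonal_comp_def)
qed

text \<open>
  A consequence of the open mapping theorem. By Baire's theorem the closure of the image of some ball
  has interior points relative to the (complete) range, so that every \<open>z\<close> in the range is approximated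
  up to \<open>norm z / 2\<close> by the image of a vector of norm at most \<open>K * norm z\<close>. Iterating on the error
  produces a preimage of norm at most \<open>2 * K * norm z\<close>, which by injectivity is the only one.
\<close>

lemma bounded_below_if_inj_closed_range:
  fixes T :: "'a::{real_normed_vector, complete_space} \<Rightarrow> 'b::{real_normed_vector, complete_space}"
  assumes T: "bounded_linear T" and inj: "inj T" and cl: "closed (range T)"
  obtains c where "c > 0" "\<And>x. c * norm x \<le> norm (T x)"
proof -
  interpret T: bounded_linear T by (rule T)
  let ?R = "range T"
  define C where "C n = closure (T ` cball 0 (real n))" for n
  have subR: "subspace ?R" using T.linear_axioms subspace_UNIV linear_subspace_image by blast
  have CR: "C n \<subseteq> ?R" for n unfolding C_def using cl by (intro closure_minimal) auto
  have cover: "\<Union> (range C) = ?R"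
  proof
    show "?R \<subseteq> \<Union> (range C)"
    proof
      fix y assume "y \<in> ?R"
      then obtain x where x: "y = T x" by blast
      obtain n where "norm x \<le> real n" using real_arch_simple by blast
      then have "y \<in> C n" unfolding C_def x using closure_subset by fastforce
      then show "y \<in> \<Union> (range C)" by blast
    qed
  qed (use CR in blast)
  have "\<exists>n. top_of_set ?R interior_of C n \<noteq> {}"
  proof (rule ccontr)
    assume empty: "\<not> ?thesis"
    have "top_of_set ?R interior_of \<Union> (range C) = {}"
    proof (intro Baire_category_alt disjI1)
      show "completely_metrizable_space (top_of_set ?R)"
        using cl by (simp add: completely_metrizable_space_euclidean completely_metrizable_space_closedin)
      fix T' assume "T' \<in> range C"
      then obtain n where n: "T' = C n" by blast
      have "closedin (top_of_set ?R) (C n)"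
        unfolding closedin_closed_eq[OF cl] using CR[of n] by (simp add: C_def)
      then show "closedin (top_of_set ?R) T' \<and> top_of_set ?R interior_of T' = {}"
        using empty n by blast
    qed simp
    moreover have "top_of_set ?R interior_of ?R = ?R"
      by (metis interior_of_topspace topspace_euclidean_subtopology)
    ultimately show False using cover by auto
  qed
  then obtain n y where y: "y \<in> top_of_set ?R interior_of C n" by blast
  then obtain S where S: "openin (top_of_set ?R) S" "y \<in> S" "S \<subseteq> C n" by (auto simp: interior_of_def)
  then obtain r where r: "r > 0" "ball y r \<inter> ?R \<subseteq> C n"
    by (metis (no_types, lifting) openin_contains_ball order_trans)
  have yR: "y \<in> ?R" using S openin_imp_subset by blast
  have approx: "\<exists>x. norm x \<le> 2 * real n \<and> norm (z - T x) < e" if z: "z \<in> ?R" "norm z < r" and e: "e > 0" for z e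
  proof -
    have "y + z \<in> ball y r \<inter> ?R" "y \<in> ball y r \<inter> ?R"
      using z r yR subspace_add[OF subR] by (auto simp: dist_norm)
    then have "y + z \<in> C n" "y \<in> C n" using r by auto
    then have "\<And>d. d > 0 \<Longrightarrow> \<exists>a\<in>cball 0 (real n). dist (T a) (y + z) < d"
      "\<And>d. d > 0 \<Longrightarrow> \<exists>b\<in>cball 0 (real n). dist (T b) y < d"
      by (auto simp: C_def closure_approachable)
    from this[OF half_gt_zero[OF e]] obtain a b where
      ab: "norm a \<le> real n" "dist (T a) (y + z) < e / 2" "norm b \<le> real n" "dist (T b) y < e / 2"
      by auto
    have "norm (a - b) \<le> 2 * real n" using ab norm_triangle_ineq4[of a b] by linarith
    moreover have "norm (z - T (a - b)) = norm ((y + z - T a) - (y - T b))" by (simp add: T.diff algebra_simps)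
    then have "norm (z - T (a - b)) < e"
      using norm_triangle_ineq4[of "y + z - T a" "y - T b"] ab by (simp add: dist_norm norm_minus_commute)
    ultimately show ?thesis by blast
  qed
  \<comment> \<open>Rescaling by \<open>s\<close> moves \<open>z\<close> into the ball of radius \<open>r\<close>; \<open>r / 2\<close> leaves room for strictness.\<close>
  define K where "K = 4 * real n / r"
  have K0: "K \<ge> 0" using r by (simp add: K_def)
  have half: "\<exists>x. norm x \<le> K * norm z \<and> norm (z - T x) \<le> norm z / 2" if z: "z \<in> ?R" for z
  proof (cases "z = 0")
    case True then show ?thesis by (intro exI[of _ 0]) (simp add: T.zero)
  next
    case False
    define s where "s = r / (2 * norm z)"
    have s: "s > 0" "s * norm z < r" using False r by (auto simp: s_def)
    obtain x where x: "norm x \<le> 2 * real n" "norm (s *\<^sub>R z - T x) < s * norm z / 2"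
      using approx[of "s *\<^sub>R z" "s * norm z / 2"] z s False subspace_scale[OF subR] by auto
    have "norm ((1/s) *\<^sub>R x) \<le> K * norm z" using x(1) s r False by (simp add: K_def s_def field_simps)
    moreover have "norm (z - T ((1/s) *\<^sub>R x)) = (1/s) * norm (s *\<^sub>R z - T x)"
    proof -
      have "z - T ((1/s) *\<^sub>R x) = (1/s) *\<^sub>R (s *\<^sub>R z - T x)" using s by (simp add: T.scaleR algebra_simps)
      then show ?thesis using s by simp
    qed
    then have "s * norm (z - T ((1/s) *\<^sub>R x)) \<le> s * (norm z / 2)" using x(2) s by simp
    then have "norm (z - T ((1/s) *\<^sub>R x)) \<le> norm z / 2" using s(1) by (simp only: mult_le_cancel_left_pos)
    ultimately show ?thesis by blast
  qed
  then obtain p where p: "\<And>z. z \<in> ?R \<Longrightarrow> norm (p z) \<le> K * norm z"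
     "\<And>z. z \<in> ?R \<Longrightarrow> norm (z - T (p z)) \<le> norm z / 2" by metis
  have main: "norm x0 \<le> 2 * K * norm (T x0)" for x0
  proof -
    define z where "z = T x0"
    define s where "s = rec_nat 0 (\<lambda>_ x. x + p (z - T x))"
    have s0: "s 0 = 0" and sS: "s (Suc k) = s k + p (z - T (s k))" for k by (auto simp: s_def)
    have inR: "z - T (s k) \<in> ?R" for k unfolding z_def by (metis T.diff rangeI)
    have zk: "norm (z - T (s k)) \<le> norm z / 2 ^ k" for k
    proof (induction k)
      case (Suc k)
      have eq: "z - T (s (Suc k)) = (z - T (s k)) - T (p (z - T (s k)))" by (simp add: sS T.add)
      show ?case unfolding eq using p(2)[OF inR[of k]] Suc by simp
    qed (simp add: s0 T.zero)
    have step: "norm (s (Suc k) - s k) \<le> K * (norm z / 2 ^ k)" for k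
    proof -
      have "norm (s (Suc k) - s k) \<le> K * norm (z - T (s k))" using p(1)[OF inR[of k]] by (simp add: sS)
      also have "\<dots> \<le> K * (norm z / 2 ^ k)" by (rule mult_left_mono[OF zk K0])
      finally show ?thesis .
    qed
    have tail: "norm (s (k + j) - s k) \<le> 2 * K * norm z * (1 / 2 ^ k - 1 / 2 ^ (k + j))" for k j
    proof (induction j)
      case (Suc j)
      have "norm (s (k + Suc j) - s k) \<le> norm (s (Suc (k + j)) - s (k + j)) + norm (s (k + j) - s k)"
        using norm_triangle_ineq[of "s (Suc (k+j)) - s (k+j)" "s (k+j) - s k"] by simp
      also have "\<dots> \<le> K * (norm z / 2 ^ (k + j)) + 2 * K * norm z * (1 / 2 ^ k - 1 / 2 ^ (k + j))"
        using Suc step[of "k+j"] by linarith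
      also have "\<dots> = 2 * K * norm z * (1 / 2 ^ k - 1 / 2 ^ (k + Suc j))"
      proof -
        have half: "1 / 2 ^ (k + Suc j) = (1 / 2 ^ (k + j)) / (2::real)" by simp
        have "K * (a * u) + 2 * K * a * (w - u) = 2 * K * a * (w - u / 2)" for a u w :: real
          by (simp add: algebra_simps)
        from this[of "norm z" "1 / 2 ^ (k + j)" "1 / 2 ^ k"] show ?thesis
          unfolding half times_divide_eq_right mult_1_right .
      qed
      finally show ?case .
    qed simp
    have tail': "norm (s m - s k) \<le> 2 * K * norm z / 2 ^ k" if mk: "m \<ge> k" for m k
    proof -
      obtain j where j: "m = k + j" using mk nat_le_iff_add by auto
      have "2 * K * norm z * (1 / 2 ^ k - 1 / 2 ^ (k + j)) \<le> 2 * K * norm z * (1 / 2 ^ k)"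
        using K0 by (intro mult_left_mono) auto
      then show ?thesis using tail[of k j] by (simp add: j)
    qed
    have lim: "(\<lambda>k. a / 2 ^ k) \<longlonglongrightarrow> 0" for a :: real
      using LIMSEQ_divide_realpow_zero[of 2 a] by simp
    have "Cauchy s"
    proof (rule metric_CauchyI)
      fix e :: real assume "0 < e"
      then have "\<forall>\<^sub>F k in sequentially. 2 * K * norm z / 2 ^ k < e / 2"
        using lim by (intro order_tendstoD) auto
      then obtain k where k: "2 * K * norm z / 2 ^ k < e / 2" by (meson eventually_sequentially order_refl)
      have "dist (s m) (s n) < e" if "m \<ge> k" "n \<ge> k" for m n
        using tail'[OF that(1)] tail'[OF that(2)] k norm_triangle_ineq4[of "s m - s k" "s n - s k"]
        by (simp add: dist_norm)
      then show "\<exists>M. \<forall>m\<ge>M. \<forall>n\<ge>M. dist (s m) (s n) < e" by blast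
    qed
    then obtain l where l: "s \<longlonglongrightarrow> l" by (meson Cauchy_convergent convergent_def)
    have "(\<lambda>k. norm (z - T (s k))) \<longlonglongrightarrow> norm (z - T l)" by (intro tendsto_intros T.tendsto l)
    moreover have "(\<lambda>k. norm (z - T (s k))) \<longlonglongrightarrow> 0"
      by (rule tendsto_sandwich[OF _ _ tendsto_const lim[of "norm z"]]) (use zk in auto)
    ultimately have "z = T l" using LIMSEQ_unique by fastforce
    then have "l = x0" using inj by (simp add: z_def inj_eq)
    have "(\<lambda>k. norm (s k)) \<longlonglongrightarrow> norm l" by (intro tendsto_intros l)
    moreover have "norm (s k) \<le> 2 * K * norm z" for k using tail'[of 0 k] by (simp add: s0)
    ultimately have "norm l \<le> 2 * K * norm z" by (meson LIMSEQ_le_const2)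
    then show ?thesis using \<open>l = x0\<close> by (simp add: z_def)
  qed
  show ?thesis
  proof
    \<comment> \<open>The constant \<open>K\<close> may be 0, for a trivial domain.\<close>
    show "1 / (2 * K + 1) > 0" using K0 by simp
    fix x
    have "norm x \<le> (2 * K + 1) * norm (T x)" unfolding distrib_right using main[of x] by (simp add: add_increasing2)
    then show "1 / (2 * K + 1) * norm x \<le> norm (T x)" using K0 by (simp add: field_simps)
  qed
qed

lemma closed_range_if_bounded_below:
  fixes T :: "'a::{real_normed_vector, complete_space} \<Rightarrow> 'b::real_normed_vector"
  assumes "bounded_linear T" "c > 0" "\<And>x. c * norm x \<le> norm (T x)"
  shows "closed (range T)"
proof -
  have "complete (range T)"
    by (rule complete_isometric_image[OF assms(2) subspace_UNIV assms(1)]) (use assms(3) complete_UNIV in auto)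
  then show ?thesis by (rule complete_imp_closed)
qed

text \<open>
  On infinite-dimensional spaces \<open>dim\<close> has the default value 0; the predicate tells these apart from the
  trivial space.
\<close>

definition fin_dim :: "'a::real_vector set \<Rightarrow> nat \<Rightarrow> bool"
  where "fin_dim X d \<longleftrightarrow> (\<exists>B. finite B \<and> independent B \<and> span B = X \<and> card B = d)"

lemma fin_dim_unique: "fin_dim X d \<Longrightarrow> fin_dim X e \<Longrightarrow> d = e"
  unfolding fin_dim_def by (metis dim_eq_card_independent dim_span)

lemma fin_dim_span:
  assumes "finite B"
  obtains d where "fin_dim (span B) d"
proof -
  obtain C where "C \<subseteq> B" "independent C" "B \<subseteq> span C" by (meson maximal_independent_subset)
  then show ?thesis using that assms unfolding fin_dim_def
    by (metis finite_subset span_eq span_superset subset_trans)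
qed

lemma fin_dim_subspace_eq:
  assumes "fin_dim X d" "fin_dim Y d" "X \<subseteq> Y"
  shows "X = Y"
proof -
  obtain B where B: "finite B" "independent B" "span B = X" "card B = d" using assms(1) by (auto simp: fin_dim_def)
  obtain C where C: "finite C" "span C = Y" "card C = d" using assms(2) by (auto simp: fin_dim_def)
  have "y \<in> X" if "y \<in> Y" for y
  proof (rule ccontr)
    assume y: "y \<notin> X"
    then have "independent (insert y B)" using B by (simp add: independent_insert)
    moreover have "insert y B \<subseteq> span C" using that C B(3) assms(3) span_superset by blast
    ultimately have "card (insert y B) \<le> d" using independent_span_bound[OF C(1)] C by blast
    moreover have "y \<notin> B" using y B(3) span_superset by blast
    ultimately show False using B by simp
  qed
  with assms(3) show ?thesis by blast
qed

lemma fin_dim_inj_on_le: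
  assumes X: "subspace X" and Y: "fin_dim Y d" and g: "linear g" "g ` X \<subseteq> Y" "inj_on g X"
  obtains e where "e \<le> d" "fin_dim X e"
proof -
  obtain C where C: "finite C" "span C = Y" "card C = d" using Y by (auto simp: fin_dim_def)
  obtain B where B: "B \<subseteq> X" "independent B" "X \<subseteq> span B" by (meson maximal_independent_subset)
  have sB: "span B = X" using B X by (meson span_minimal subset_antisym)
  have "independent (g ` B)"
    using linear_independent_injective_image[OF g(1) B(2)] g(3) sB by simp
  moreover have "g ` B \<subseteq> span C" using B g C by auto
  ultimately have "finite (g ` B) \<and> card (g ` B) \<le> d" using independent_span_bound[OF C(1)] C by blast
  moreover have "inj_on g B" using g(3) B(1) inj_on_subset by blast
  ultimately have "finite B" "card B \<le> d" by (auto simp: card_image finite_image_iff)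
  then show ?thesis using that B(2) sB by (auto simp: fin_dim_def)
qed

text \<open>
  If \<open>L\<close> is closer to \<open>K\<close> than the lower bound \<open>c\<close> of \<open>K\<close>, then no vector \<open>n \<noteq> 0\<close> is orthogonal to
  the range of \<open>L\<close> and contained in the range of \<open>K\<close>: with \<open>n = K z\<close> one would have
  \<open>n \<bullet> n = (K z - L z) \<bullet> n < norm n * norm n\<close>. So the projection along the range of \<open>K\<close> embeds the one
  orthogonal complement into the other.
\<close>

lemma codim_range_le:
  fixes K L :: "'a::{real_normed_vector, complete_space} \<Rightarrow> 'b::{real_inner, complete_space}"
  assumes K: "bounded_linear K" "c > 0" "\<And>z. c * norm z \<le> norm (K z)"
    and L: "e < c" "\<And>z. norm (K z - L z) \<le> e * norm z"
    and d: "fin_dim (orthogonal_comp (range K)) d"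
  obtains d' where "d' \<le> d" "fin_dim (orthogonal_comp (range L)) d'"
proof -
  have cl: "closed (range K)" using K by (rule closed_range_if_bounded_below)
  have sub: "subspace (range K)"
    using K(1) bounded_linear.linear linear_subspace_image subspace_UNIV by blast
  define Q where "Q v = (SOME r. r \<in> range K \<and> v - r \<in> orthogonal_comp (range K))" for v
  have Q: "Q v \<in> range K" "v - Q v \<in> orthogonal_comp (range K)" for v
    using orthogonal_projection_exists[OF cl sub, of v] someI_ex[of "\<lambda>r. r \<in> range K \<and> v - r \<in> orthogonal_comp (range K)"]
    unfolding Q_def by blast+
  have Quniq: "q = Q v" if "q \<in> range K" "v - q \<in> orthogonal_comp (range K)" for q v
  proof -
    have "q - Q v \<in> range K" using that(1) Q(1) sub by (simp add: subspace_diff)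
    moreover have "(v - Q v) - (v - q) \<in> orthogonal_comp (range K)"
      using that(2) Q(2) subspace_orthogonal_comp subspace_diff by blast
    then have "q - Q v \<in> orthogonal_comp (range K)" by simp
    ultimately have "(q - Q v) \<bullet> (q - Q v) = 0" unfolding orthogonal_comp_def orthogonal_def by blast
    then show ?thesis by simp
  qed
  have lin: "linear (\<lambda>v. v - Q v)"
  proof (rule linearI)
    fix a b :: 'b and s :: real
    have "Q a + Q b = Q (a + b)"
    proof (rule Quniq)
      show "Q a + Q b \<in> range K" using Q(1) sub subspace_add by blast
      have "(a - Q a) + (b - Q b) \<in> orthogonal_comp (range K)"
        using Q(2) subspace_orthogonal_comp subspace_add by blast
      then show "a + b - (Q a + Q b) \<in> orthogonal_comp (range K)" by (simp add: algebra_simps)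
    qed
    then show "a + b - Q (a + b) = a - Q a + (b - Q b)" by (simp add: algebra_simps)
    have "s *\<^sub>R Q a = Q (s *\<^sub>R a)"
    proof (rule Quniq)
      show "s *\<^sub>R Q a \<in> range K" using Q(1) sub subspace_scale by blast
      have "s *\<^sub>R (a - Q a) \<in> orthogonal_comp (range K)"
        using Q(2) subspace_orthogonal_comp subspace_scale by blast
      then show "s *\<^sub>R a - s *\<^sub>R Q a \<in> orthogonal_comp (range K)" by (simp add: algebra_simps)
    qed
    then show "s *\<^sub>R a - Q (s *\<^sub>R a) = s *\<^sub>R (a - Q a)" by (simp add: algebra_simps)
  qed
  have zero: "n = 0" if n: "n \<in> orthogonal_comp (range L)" "n - Q n = 0" for n
  proof (rule ccontr)
    assume "n \<noteq> 0"
    obtain z where z: "n = K z" using n(2) Q(1)[of n] by auto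
    have "n \<bullet> n = (K z - L z) \<bullet> n" using n(1) z by (simp add: inner_diff_left orthogonal_comp_def orthogonal_def)
    also have "\<dots> \<le> norm (K z - L z) * norm n" by (rule norm_cauchy_schwarz)
    also have "\<dots> \<le> e * norm z * norm n" using L(2) by (intro mult_right_mono) auto
    also have "\<dots> < c * norm z * norm n"
      using L(1) \<open>n \<noteq> 0\<close> z linear_0[OF bounded_linear.linear[OF K(1)]] by (intro mult_strict_right_mono) auto
    also have "\<dots> \<le> norm n * norm n" using K(3)[of z] z by (intro mult_right_mono) auto
    finally show False by (simp add: norm_eq_sqrt_inner)
  qed
  have "inj_on (\<lambda>v. v - Q v) (orthogonal_comp (range L))"
    by (simp add: linear_inj_on_iff_eq_0[OF lin subspace_orthogonal_comp] zero)
  with fin_dim_inj_on_le[OF subspace_orthogonal_comp d lin] Q(2) show ?thesis using that by blast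
qed

text \<open>
  Stability of the index of semi-Fredholm operators. Near \<open>t\<close> the lower bound of \<open>K t\<close> is almost
  inherited, so the comparison of codimensions applies in both directions.
\<close>

lemma codim_range_constant:
  fixes K :: "'t::metric_space \<Rightarrow> 'a::{real_normed_vector, complete_space} \<Rightarrow> 'b::{real_inner, complete_space}"
  assumes S: "connected S" "a \<in> S" "b \<in> S"
    and K: "\<And>t. t \<in> S \<Longrightarrow> bounded_linear (K t)"
    and below: "\<And>t. t \<in> S \<Longrightarrow> \<exists>c>0. \<forall>z. c * norm z \<le> norm (K t z)"
    and cont: "\<And>t e. t \<in> S \<Longrightarrow> e > 0 \<Longrightarrow> \<exists>r>0. \<forall>s\<in>S. dist s t < r \<longrightarrow> (\<forall>z. norm (K s z - K t z) \<le> e * norm z)"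
    and d: "fin_dim (orthogonal_comp (range (K a))) d"
  shows "fin_dim (orthogonal_comp (range (K b))) d"
proof -
  let ?N = "\<lambda>t. orthogonal_comp (range (K t))"
  have "\<forall>d. fin_dim (?N a) d \<longleftrightarrow> fin_dim (?N b) d"
  proof (rule connected_equivalence_relation[OF S, where R = "\<lambda>s t. \<forall>d. fin_dim (?N s) d \<longleftrightarrow> fin_dim (?N t) d"])
    fix t assume t: "t \<in> S"
    obtain c where c: "c > 0" "\<And>z. c * norm z \<le> norm (K t z)" using below[OF t] by blast
    \<comment> \<open>At distance \<open>c / 3\<close> the lower bound \<open>2 * c / 3\<close> of \<open>K s\<close> still exceeds the distance.\<close>
    obtain r where r: "r > 0" "\<And>s z. s \<in> S \<Longrightarrow> dist s t < r \<Longrightarrow> norm (K s z - K t z) \<le> c / 3 * norm z"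
      using cont[OF t, of "c / 3"] c(1) by auto
    have "fin_dim (?N t) d \<longleftrightarrow> fin_dim (?N s) d" if s: "s \<in> S" "dist s t < r" for s d
    proof -
      have cs: "2 * c / 3 * norm z \<le> norm (K s z)" for z
        using c(2)[of z] r(2)[OF s, of z] norm_triangle_ineq2[of "K t z" "K s z"] norm_minus_commute[of "K s z" "K t z"]
        by linarith
      have 1: "\<exists>d'\<le>d. fin_dim (?N s) d'" if "fin_dim (?N t) d" for d
        by (rule codim_range_le[OF K[OF t] c _ _ that, of "c / 3" "K s"])
          (use c(1) r(2)[OF s] in \<open>auto simp: norm_minus_commute\<close>)
      have 2: "\<exists>d'\<le>d. fin_dim (?N t) d'" if "fin_dim (?N s) d" for d
        by (rule codim_range_le[OF K[OF s(1)] _ cs _ _ that, of "c / 3" "K t"])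
          (use c(1) r(2)[OF s] in auto)
      show ?thesis
      proof
        assume t: "fin_dim (?N t) d"
        then obtain d' d'' where *: "d' \<le> d" "fin_dim (?N s) d'" "d'' \<le> d'" "fin_dim (?N t) d''"
          using 1 2 by meson
        then have "d' = d" using fin_dim_unique[OF t *(4)] by simp
        then show "fin_dim (?N s) d" using * by simp
      next
        assume s: "fin_dim (?N s) d"
        then obtain d' d'' where *: "d' \<le> d" "fin_dim (?N t) d'" "d'' \<le> d'" "fin_dim (?N s) d''"
          using 1 2 by meson
        then have "d' = d" using fin_dim_unique[OF s *(4)] by simp
        then show "fin_dim (?N t) d" using * by simp
      qed
    qed
    then show "\<exists>T. openin (top_of_set S) T \<and> t \<in> T \<and> (\<forall>x\<in>T. \<forall>d. fin_dim (?N t) d \<longleftrightarrow> fin_dim (?N x) d)"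
    proof (intro exI[of _ "S \<inter> ball t r"] conjI ballI)
      show "openin (top_of_set S) (S \<inter> ball t r)" by (simp add: openin_open_Int)
      show "t \<in> S \<inter> ball t r" using t r(1) by simp
    qed (simp add: dist_commute)
  qed (blast+)
  with d show ?thesis by blast
qed

section \<open>Towers of derivatives\<close>

text \<open>
  The system of all derivatives of a smooth map, detached from the map itself, which is recovered as
  \<open>D []\<close>. This makes it possible to pass to slices and to partial derivatives of the map.
\<close>

definition derivative_tower ::
    "'a::real_normed_vector set \<Rightarrow> ('a list \<Rightarrow> 'a \<Rightarrow> 'b::real_normed_vector) \<Rightarrow> bool"
  where "derivative_tower S D \<longleftrightarrow>
    (\<forall>x\<in>S. \<forall>vs. linear (\<lambda>v. D (v # vs) x)) \<and>
    (\<forall>x\<in>S. \<forall>n. \<exists>C. \<forall>vs. length vs = n \<longrightarrow> norm (D vs x) \<le> C * (\<Prod>v\<leftarrow>vs. norm v)) \<and>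
    (\<forall>x\<in>S. \<forall>n. \<forall>\<epsilon>>0. \<exists>\<delta>>0. \<forall>y\<in>S. norm (y - x) < \<delta> \<longrightarrow>
      (\<forall>vs. length vs = n \<longrightarrow>
        norm (D vs y - D vs x - D ((y - x) # vs) x) \<le> \<epsilon> * norm (y - x) * (\<Prod>v\<leftarrow>vs. norm v)))"

lemma smooth_on_iff_tower: "smooth_on S f \<longleftrightarrow> (\<exists>D. derivative_tower S D \<and> (\<forall>x\<in>S. D [] x = f x))"
  unfolding smooth_on_def derivative_tower_def by (intro ex_cong1) blast

lemma tower_bound:
  assumes "derivative_tower S D" "x \<in> S"
  obtains C where "C \<ge> 0" "\<And>vs. length vs = n \<Longrightarrow> norm (D vs x) \<le> C * (\<Prod>v\<leftarrow>vs. norm v)"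
proof -
  have "\<exists>C. \<forall>vs. length vs = n \<longrightarrow> norm (D vs x) \<le> C * (\<Prod>v\<leftarrow>vs. norm v)"
    using assms by (simp add: derivative_tower_def)
  then obtain C where C: "\<And>vs. length vs = n \<Longrightarrow> norm (D vs x) \<le> C * (\<Prod>v\<leftarrow>vs. norm v)"
    by blast
  have "norm (D vs x) \<le> \<bar>C\<bar> * (\<Prod>v\<leftarrow>vs. norm v)" if "length vs = n" for vs
  proof -
    have "0 \<le> (\<Prod>v\<leftarrow>vs. norm v)" by (induction vs) auto
    then show ?thesis using C[OF that] by (meson abs_ge_self mult_right_mono order_trans)
  qed
  then show ?thesis using that[of "\<bar>C\<bar>"] by simp
qed

lemma tower_expansion:
  assumes "derivative_tower S D" "x \<in> S" "e > 0"
  obtains r where "r > 0" "\<And>y vs. y \<in> S \<Longrightarrow> norm (y - x) < r \<Longrightarrow> length vs = n \<Longrightarrow>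
    norm (D vs y - D vs x - D ((y - x) # vs) x) \<le> e * norm (y - x) * (\<Prod>v\<leftarrow>vs. norm v)"
proof -
  have "\<exists>r>0. \<forall>y\<in>S. norm (y - x) < r \<longrightarrow> (\<forall>vs. length vs = n \<longrightarrow>
      norm (D vs y - D vs x - D ((y - x) # vs) x) \<le> e * norm (y - x) * (\<Prod>v\<leftarrow>vs. norm v))"
    using assms by (simp add: derivative_tower_def)
  then show ?thesis using that by blast
qed

lemma tower_linear: "derivative_tower S D \<Longrightarrow> x \<in> S \<Longrightarrow> linear (\<lambda>v. D (v # vs) x)"
  by (simp add: derivative_tower_def)

lemma tower_bounded_linear:
  assumes "derivative_tower S D" "x \<in> S"
  shows "bounded_linear (\<lambda>v. D (v # vs) x)"
proof -
  obtain C where C: "\<And>ws. length ws = Suc (length vs) \<Longrightarrow> norm (D ws x) \<le> C * (\<Prod>v\<leftarrow>ws. norm v)"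
    by (rule tower_bound[OF assms, of "Suc (length vs)"]) blast
  show ?thesis
  proof (rule bounded_linear_intro[where K = "C * (\<Prod>v\<leftarrow>vs. norm v)"])
    show "D ((v + w) # vs) x = D (v # vs) x + D (w # vs) x" for v w
      by (rule linear_add[OF tower_linear[OF assms]])
    show "D ((s *\<^sub>R v) # vs) x = s *\<^sub>R D (v # vs) x" for s v
      by (rule linear_scale[OF tower_linear[OF assms]])
    show "norm (D (v # vs) x) \<le> norm v * (C * (\<Prod>v\<leftarrow>vs. norm v))" for v
      using C[of "v # vs"] by (simp add: ac_simps)
  qed
qed

lemma tower_has_derivative:
  assumes D: "derivative_tower S D" "x \<in> S"
  shows "(D vs has_derivative (\<lambda>v. D (v # vs) x)) (at x within S)"
  unfolding has_derivative_within_alt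
proof (intro conjI allI impI)
  show "bounded_linear (\<lambda>v. D (v # vs) x)" using D by (rule tower_bounded_linear)
  fix e :: real assume e: "e > 0"
  define p where "p = (\<Prod>v\<leftarrow>vs. norm v)"
  have p: "p \<ge> 0" unfolding p_def by (induction vs) auto
  obtain r where r: "r > 0" "\<And>y ws. y \<in> S \<Longrightarrow> norm (y - x) < r \<Longrightarrow> length ws = length vs \<Longrightarrow>
      norm (D ws y - D ws x - D ((y - x) # ws) x) \<le> e / (p + 1) * norm (y - x) * (\<Prod>v\<leftarrow>ws. norm v)"
    by (rule tower_expansion[OF D, of "e / (p + 1)" "length vs"]) (use e p in auto)
  show "\<exists>d>0. \<forall>y\<in>S. norm (y - x) < d \<longrightarrow> norm (D vs y - D vs x - D ((y - x) # vs) x) \<le> e * norm (y - x)"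
  proof (intro exI[of _ r] conjI ballI impI r(1))
    fix y assume y: "y \<in> S" "norm (y - x) < r"
    have "norm (D vs y - D vs x - D ((y - x) # vs) x) \<le> e / (p + 1) * norm (y - x) * p"
      using r(2)[OF y, of vs] by (simp add: p_def)
    also have "\<dots> = e * norm (y - x) * (p / (p + 1))" by simp
    also have "\<dots> \<le> e * norm (y - x) * 1" using p e by (intro mult_left_mono) auto
    finally show "norm (D vs y - D vs x - D ((y - x) # vs) x) \<le> e * norm (y - x)" by simp
  qed
qed

lemma tower_norm_continuous:
  assumes D: "derivative_tower S D" "x \<in> S" and e: "e > 0"
  obtains r where "r > 0" "\<And>y v. y \<in> S \<Longrightarrow> norm (y - x) < r \<Longrightarrow> norm (D [v] y - D [v] x) \<le> e * norm v"
proof -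
  obtain C where C: "C \<ge> 0" "\<And>ws. length ws = 2 \<Longrightarrow> norm (D ws x) \<le> C * (\<Prod>v\<leftarrow>ws. norm v)"
    by (rule tower_bound[OF D, of 2]) blast
  obtain r where r: "r > 0" "\<And>y ws. y \<in> S \<Longrightarrow> norm (y - x) < r \<Longrightarrow> length ws = 1 \<Longrightarrow>
      norm (D ws y - D ws x - D ((y - x) # ws) x) \<le> 1 * norm (y - x) * (\<Prod>v\<leftarrow>ws. norm v)"
    by (rule tower_expansion[OF D zero_less_one, of 1]) blast
  show ?thesis
  proof (rule that[of "min r (e / (C + 1))"])
    show "0 < min r (e / (C + 1))" using r(1) e C(1) by simp
    fix y v assume y: "y \<in> S" "norm (y - x) < min r (e / (C + 1))"
    have "norm (D [v] y - D [v] x) \<le> norm (D [v] y - D [v] x - D [y - x, v] x) + norm (D [y - x, v] x)"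
      using norm_triangle_ineq[of "D [v] y - D [v] x - D [y - x, v] x" "D [y - x, v] x"] by simp
    also have "\<dots> \<le> norm (y - x) * norm v + C * (norm (y - x) * norm v)"
      using r(2)[of y "[v]"] C(2)[of "[y - x, v]"] y by (intro add_mono) auto
    also have "\<dots> = ((C + 1) * norm (y - x)) * norm v" by (simp add: algebra_simps)
    also have "\<dots> \<le> e * norm v"
      using y C(1) by (intro mult_right_mono) (auto simp: field_simps)
    finally show "norm (D [v] y - D [v] x) \<le> e * norm v" .
  qed
qed

text \<open>
  The second difference of \<open>D []\<close> over a parallelogram with sides \<open>h *\<^sub>R i\<close> and \<open>h *\<^sub>R j\<close> is
  \<open>h\<^sup>2 *\<^sub>R D [j, i] a + o(h\<^sup>2)\<close>, by the mean value inequality along the side \<open>i\<close>. Only small nonnegative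
  multiples of \<open>i\<close> and \<open>j\<close> are used, so that the initial time of the flow is covered.
\<close>

lemma tower_symmetric_aux:
  assumes D: "derivative_tower S D" "a \<in> S" and r: "r > 0"
    and S: "\<And>s t. 0 \<le> s \<Longrightarrow> s \<le> r \<Longrightarrow> 0 \<le> t \<Longrightarrow> t \<le> r \<Longrightarrow> a + s *\<^sub>R i + t *\<^sub>R j \<in> S"
    and e: "e > 0"
  shows "\<exists>q>0. \<forall>h. 0 < h \<and> h < q \<longrightarrow>
    norm (D [] (a + h *\<^sub>R i + h *\<^sub>R j) - D [] (a + h *\<^sub>R i) - D [] (a + h *\<^sub>R j) + D [] a - h\<^sup>2 *\<^sub>R D [j, i] a)
      \<le> e * h\<^sup>2"
proof -
  define M where "M = norm i + norm j + 1"
  have M: "M > 0" "norm i \<le> M" "norm j \<le> M" by (auto simp: M_def add_nonneg_pos)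
  define e' where "e' = e / (4 * M * M)"
  have e': "e' > 0" using e M by (simp add: e'_def)
  obtain q where q: "q > 0" "\<And>y vs. y \<in> S \<Longrightarrow> norm (y - a) < q \<Longrightarrow> length vs = 1 \<Longrightarrow>
      norm (D vs y - D vs a - D ((y - a) # vs) a) \<le> e' * norm (y - a) * (\<Prod>v\<leftarrow>vs. norm v)"
    by (rule tower_expansion[OF D e', of 1]) blast
  define q' where "q' = min r (q / (2 * M))"
  show ?thesis
  proof (intro exI[of _ q'] conjI allI impI)
    show "q' > 0" using q r M by (simp add: q'_def)
    fix h :: real assume h: "0 < h \<and> h < q'"
    then have hr: "h \<le> r" and hq: "h * (2 * M) < q" using M by (auto simp: q'_def field_simps)
    define c where "c = D [j, i] a"
    define k where "k s = D [] (a + s *\<^sub>R i + h *\<^sub>R j) - D [] (a + s *\<^sub>R i) - s *\<^sub>R h *\<^sub>R c" for s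
    have inS: "a + s *\<^sub>R i + t *\<^sub>R j \<in> S" if "s \<in> {0..h}" "t \<in> {0..h}" for s t
      using S[of s t] that hr by auto
    have der: "((\<lambda>s. D [] (a + s *\<^sub>R i + t *\<^sub>R j)) has_derivative (\<lambda>x. D [x *\<^sub>R i] (a + s *\<^sub>R i + t *\<^sub>R j))) (at s within {0..h})"
      if "s \<in> {0..h}" "t \<in> {0..h}" for s t
    proof -
      have "((\<lambda>s. a + s *\<^sub>R i + t *\<^sub>R j) has_derivative (\<lambda>x. x *\<^sub>R i)) (at s within {0..h})"
        by (auto intro!: derivative_eq_intros)
      moreover have "(D [] has_derivative (\<lambda>v. D [v] (a + s *\<^sub>R i + t *\<^sub>R j)))
          (at (a + s *\<^sub>R i + t *\<^sub>R j) within (\<lambda>s. a + s *\<^sub>R i + t *\<^sub>R j) ` {0..h})"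
        by (rule has_derivative_subset[OF tower_has_derivative[OF D(1) inS[OF that]]]) (use inS that(2) in blast)
      ultimately show ?thesis by (rule has_derivative_in_compose)
    qed
    have kder: "(k has_derivative (\<lambda>x. x *\<^sub>R (D [i] (a + s *\<^sub>R i + h *\<^sub>R j) - D [i] (a + s *\<^sub>R i) - h *\<^sub>R c))) (at s within {0..h})"
      if s: "s \<in> {0..h}" for s
    proof -
      have h0: "h \<in> {0..h}" "0 \<in> {0..h}" using h by auto
      have lin: "D [x *\<^sub>R i] y = x *\<^sub>R D [i] y" if "y \<in> S" for x y
        by (rule linear_scale[OF tower_linear[OF D(1) that]])
      have "(k has_derivative (\<lambda>x. D [x *\<^sub>R i] (a + s *\<^sub>R i + h *\<^sub>R j) - D [x *\<^sub>R i] (a + s *\<^sub>R i + 0 *\<^sub>R j) - x *\<^sub>R h *\<^sub>R c)) (at s within {0..h})"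
        unfolding k_def using der[OF s h0(1)] der[OF s h0(2)]
        by (auto intro!: derivative_eq_intros)
      then show ?thesis using lin[OF inS[OF s h0(1)]] lin[OF inS[OF s h0(2)]]
        by (simp add: algebra_simps)
    qed
    have "norm (k h - k 0) \<le> (e * h) * norm (h - 0)"
    proof (rule differentiable_bound[OF _ kder])
      fix s :: real assume s: "s \<in> {0..h}"
      have est: "norm (D [i] (a + z) - D [i] a - D [z, i] a) \<le> e * h / 2"
        if "a + z \<in> S" "norm z \<le> h * (2 * M)" for z
      proof -
        have "norm (D [i] (a + z) - D [i] a - D [z, i] a) \<le> e' * norm z * norm i"
          using q(2)[of "a + z" "[i]"] that hq by simp
        also have "\<dots> \<le> e' * (h * (2 * M)) * M"
          using e' M that h by (intro mult_mono) auto
        also have "\<dots> = e * h / 2" using M by (simp add: e'_def field_simps)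
        finally show ?thesis .
      qed
      have z: "norm (s *\<^sub>R i + t *\<^sub>R j) \<le> h * (2 * M)" if "t \<in> {0..h}" for t
      proof -
        have "norm (s *\<^sub>R i + t *\<^sub>R j) \<le> s * norm i + t * norm j"
          using norm_triangle_ineq[of "s *\<^sub>R i" "t *\<^sub>R j"] s that by simp
        also have "\<dots> \<le> h * M + h * M" using s that M by (intro add_mono mult_mono) auto
        finally show ?thesis by (simp add: mult.commute mult.left_commute)
      qed
      have "D [s *\<^sub>R i + h *\<^sub>R j, i] a = D [s *\<^sub>R i, i] a + h *\<^sub>R c"
        unfolding c_def linear_add[OF tower_linear[OF D]] linear_scale[OF tower_linear[OF D], of h] by simp
      then have split: "D [i] (a + s *\<^sub>R i + h *\<^sub>R j) - D [i] (a + s *\<^sub>R i) - h *\<^sub>R c =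
          (D [i] (a + (s *\<^sub>R i + h *\<^sub>R j)) - D [i] a - D [s *\<^sub>R i + h *\<^sub>R j, i] a) -
          (D [i] (a + s *\<^sub>R i) - D [i] a - D [s *\<^sub>R i, i] a)"
        by (simp add: algebra_simps)
      have "norm (D [i] (a + (s *\<^sub>R i + h *\<^sub>R j)) - D [i] a - D [s *\<^sub>R i + h *\<^sub>R j, i] a) +
          norm (D [i] (a + s *\<^sub>R i) - D [i] a - D [s *\<^sub>R i, i] a) \<le> e * h / 2 + e * h / 2"
        using z[of h] z[of 0] inS[OF s, of h] inS[OF s, of 0] h
        by (intro add_mono est) (auto simp: add.assoc)
      then have *: "norm (D [i] (a + s *\<^sub>R i + h *\<^sub>R j) - D [i] (a + s *\<^sub>R i) - h *\<^sub>R c) \<le> e * h"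
        unfolding split by (intro order_trans[OF norm_triangle_ineq4]) simp
      show "onorm (\<lambda>x. x *\<^sub>R (D [i] (a + s *\<^sub>R i + h *\<^sub>R j) - D [i] (a + s *\<^sub>R i) - h *\<^sub>R c)) \<le> e * h"
        by (rule onorm_bound) (use * e h in \<open>auto simp: mult.commute mult_left_mono\<close>)
    qed (use h in auto)
    moreover have "k h - k 0 = D [] (a + h *\<^sub>R i + h *\<^sub>R j) - D [] (a + h *\<^sub>R i) - D [] (a + h *\<^sub>R j) + D [] a - h\<^sup>2 *\<^sub>R c"
      by (simp add: k_def power2_eq_square)
    ultimately show "norm (D [] (a + h *\<^sub>R i + h *\<^sub>R j) - D [] (a + h *\<^sub>R i) - D [] (a + h *\<^sub>R j) + D [] a - h\<^sup>2 *\<^sub>R D [j, i] a)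
      \<le> e * h\<^sup>2" using h by (simp add: c_def power2_eq_square)
  qed
qed

text \<open>
  The second difference is symmetric in \<open>i\<close> and \<open>j\<close>.
\<close>

lemma tower_symmetric:
  assumes D: "derivative_tower S D" "a \<in> S" and r: "r > 0"
    and S: "\<And>s t. 0 \<le> s \<Longrightarrow> s \<le> r \<Longrightarrow> 0 \<le> t \<Longrightarrow> t \<le> r \<Longrightarrow> a + s *\<^sub>R i + t *\<^sub>R j \<in> S"
  shows "D [i, j] a = D [j, i] a"
proof -
  have "norm (D [i, j] a - D [j, i] a) \<le> e" if e: "e > 0" for e
  proof -
    have e2: "e / 2 > 0" using e by simp
    have S': "a + s *\<^sub>R j + t *\<^sub>R i \<in> S" if "0 \<le> s" "s \<le> r" "0 \<le> t" "t \<le> r" for s t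
      using S[of t s] that by (simp add: algebra_simps)
    let ?d = "\<lambda>h. D [] (a + h *\<^sub>R i + h *\<^sub>R j) - D [] (a + h *\<^sub>R i) - D [] (a + h *\<^sub>R j) + D [] a"
    obtain q where q: "q > 0" "\<And>h. 0 < h \<Longrightarrow> h < q \<Longrightarrow> norm (?d h - h\<^sup>2 *\<^sub>R D [j, i] a) \<le> e / 2 * h\<^sup>2"
      using tower_symmetric_aux[OF D r S e2] by blast
    obtain q' where q': "q' > 0" "\<And>h. 0 < h \<Longrightarrow> h < q' \<Longrightarrow>
        norm (D [] (a + h *\<^sub>R j + h *\<^sub>R i) - D [] (a + h *\<^sub>R j) - D [] (a + h *\<^sub>R i) + D [] a - h\<^sup>2 *\<^sub>R D [i, j] a) \<le> e / 2 * h\<^sup>2"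
      using tower_symmetric_aux[OF D r S' e2] by blast
    define h where "h = min q q' / 2"
    have h: "0 < h" "h < q" "h < q'" using q(1) q'(1) by (auto simp: h_def)
    have 2: "norm (?d h - h\<^sup>2 *\<^sub>R D [i, j] a) \<le> e / 2 * h\<^sup>2"
      using q'(2)[OF h(1,3)] by (simp add: algebra_simps)
    have "norm (h\<^sup>2 *\<^sub>R (D [i, j] a - D [j, i] a)) = norm ((?d h - h\<^sup>2 *\<^sub>R D [j, i] a) - (?d h - h\<^sup>2 *\<^sub>R D [i, j] a))"
      by (simp add: algebra_simps)
    also have "\<dots> \<le> norm (?d h - h\<^sup>2 *\<^sub>R D [j, i] a) + norm (?d h - h\<^sup>2 *\<^sub>R D [i, j] a)"
      by (rule norm_triangle_ineq4)
    also have "\<dots> \<le> e / 2 * h\<^sup>2 + e / 2 * h\<^sup>2"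
      by (rule add_mono[OF q(2)[OF h(1,2)] 2])
    finally have "h\<^sup>2 * norm (D [i, j] a - D [j, i] a) \<le> h\<^sup>2 * e" unfolding norm_scaleR by (simp add: mult.commute)
    then show ?thesis using h(1) by simp
  qed
  then show ?thesis by (metis field_le_epsilon add_0 norm_le_zero_iff right_minus_eq)
qed

lemma smooth_on_has_derivative:
  assumes "smooth_on S f" "x \<in> S"
  obtains f' where "(f has_derivative f') (at x within S)"
proof -
  obtain D where D: "derivative_tower S D" "\<And>x. x \<in> S \<Longrightarrow> D [] x = f x"
    using assms(1) by (auto simp: smooth_on_iff_tower)
  have "(f has_derivative (\<lambda>v. D [v] x)) (at x within S)"
    by (rule has_derivative_transform[OF assms(2) _ tower_has_derivative[OF D(1) assms(2)]]) (simp add: D(2))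
  then show ?thesis by (rule that)
qed

text \<open>
  The list \<open>ws\<close> freezes some directions of differentiation. With \<open>ws = [(0, k)]\<close> and time as the
  second coordinate, the slice is the tower of \<open>k\<close> times the velocity at a fixed time.
\<close>

lemma tower_slice:
  assumes D: "derivative_tower S D" and T: "\<And>y. y \<in> T \<Longrightarrow> (y, p) \<in> S"
  shows "derivative_tower T (\<lambda>vs y. D (map (\<lambda>v. (v, 0)) vs @ ws) (y, p))"
  unfolding derivative_tower_def
proof (intro conjI ballI allI impI)
  fix x assume x: "x \<in> T"
  have pn: "(\<Prod>v\<leftarrow>map (\<lambda>v. (v, 0)) vs @ ws. norm v) = (\<Prod>v\<leftarrow>vs. norm v) * (\<Prod>v\<leftarrow>ws. norm v)" for vs :: "'a list"
    by (simp add: o_def norm_Pair)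
  {
    fix vs
    show "linear (\<lambda>v. D (map (\<lambda>v. (v, 0)) (v # vs) @ ws) (x, p))"
    proof -
      have "linear ((\<lambda>v. D (v # (map (\<lambda>v. (v, 0)) vs @ ws)) (x, p)) \<circ> (\<lambda>v. (v, 0)))"
        by (rule linear_compose[OF _ tower_linear[OF D T[OF x]]]) (auto intro!: linearI)
      then show ?thesis by (simp add: o_def)
    qed
  next
    fix n
    obtain C where C: "\<And>us. length us = n + length ws \<Longrightarrow> norm (D us (x, p)) \<le> C * (\<Prod>v\<leftarrow>us. norm v)"
      by (rule tower_bound[OF D T[OF x], of "n + length ws"]) blast
    show "\<exists>C. \<forall>vs. length vs = n \<longrightarrow> norm (D (map (\<lambda>v. (v, 0)) vs @ ws) (x, p)) \<le> C * (\<Prod>v\<leftarrow>vs. norm v)"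
    proof (intro exI[of _ "C * (\<Prod>v\<leftarrow>ws. norm v)"] allI impI)
      fix vs :: "'a list" assume "length vs = n"
      then show "norm (D (map (\<lambda>v. (v, 0)) vs @ ws) (x, p)) \<le> C * (\<Prod>v\<leftarrow>ws. norm v) * (\<Prod>v\<leftarrow>vs. norm v)"
        using C[of "map (\<lambda>v. (v, 0)) vs @ ws"] unfolding pn by (simp add: ac_simps)
    qed
  next
    fix n and e :: real assume e: "e > 0"
    define m where "m = (\<Prod>v\<leftarrow>ws. norm v)"
    have m: "m \<ge> 0" unfolding m_def by (induction ws) auto
    obtain r where r: "r > 0" "\<And>y us. y \<in> S \<Longrightarrow> norm (y - (x, p)) < r \<Longrightarrow> length us = n + length ws \<Longrightarrow>
        norm (D us y - D us (x, p) - D ((y - (x, p)) # us) (x, p)) \<le> e / (m + 1) * norm (y - (x, p)) * (\<Prod>v\<leftarrow>us. norm v)"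
      by (rule tower_expansion[OF D T[OF x], of "e / (m + 1)" "n + length ws"]) (use e m in auto)
    show "\<exists>r>0. \<forall>y\<in>T. norm (y - x) < r \<longrightarrow> (\<forall>vs. length vs = n \<longrightarrow>
        norm (D (map (\<lambda>v. (v, 0)) vs @ ws) (y, p) - D (map (\<lambda>v. (v, 0)) vs @ ws) (x, p) -
          D (map (\<lambda>v. (v, 0)) ((y - x) # vs) @ ws) (x, p)) \<le> e * norm (y - x) * (\<Prod>v\<leftarrow>vs. norm v))"
    proof (intro exI[of _ r] conjI ballI allI impI r(1))
      fix y and vs :: "'a list" assume y: "y \<in> T" "norm (y - x) < r" "length vs = n"
      define k where "k = (\<Prod>v\<leftarrow>vs. norm v)"
      have k: "k \<ge> 0" unfolding k_def by (induction vs) auto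
      have "norm (D (map (\<lambda>v. (v, 0)) vs @ ws) (y, p) - D (map (\<lambda>v. (v, 0)) vs @ ws) (x, p) -
          D (map (\<lambda>v. (v, 0)) ((y - x) # vs) @ ws) (x, p)) \<le> e / (m + 1) * norm (y - x) * (k * m)"
        using r(2)[OF T[OF y(1)], of "map (\<lambda>v. (v, 0)) vs @ ws"] y unfolding pn m_def k_def
        by (simp add: norm_Pair)
      also have "\<dots> = e * norm (y - x) * k * (m / (m + 1))" by simp
      also have "\<dots> \<le> e * norm (y - x) * k * 1" using m e k by (intro mult_left_mono) auto
      finally show "norm (D (map (\<lambda>v. (v, 0)) vs @ ws) (y, p) - D (map (\<lambda>v. (v, 0)) vs @ ws) (x, p) -
          D (map (\<lambda>v. (v, 0)) ((y - x) # vs) @ ws) (x, p)) \<le> e * norm (y - x) * (\<Prod>v\<leftarrow>vs. norm v)"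
        by (simp add: k_def)
    qed
  }
qed

section \<open>Differentials in charts\<close>

lemma chart_inv_snd: "hilbert_manifold A \<Longrightarrow> \<kappa> \<in> A \<Longrightarrow> u \<in> fst \<kappa> \<Longrightarrow> chart_inv \<kappa> (snd \<kappa> u) = u"
  by (auto simp: hilbert_manifold_def the_inv_into_f_f)

lemma chart_domain_open: "hilbert_manifold A \<Longrightarrow> \<kappa> \<in> A \<Longrightarrow> open (fst \<kappa>)"
  by (auto simp: hilbert_manifold_def)

lemma chart_image_open:
  assumes A: "hilbert_manifold A" "\<kappa> \<in> A" and W: "open W"
  shows "open (snd \<kappa> ` (fst \<kappa> \<inter> W))"
proof -
  have op: "open (snd \<kappa> ` fst \<kappa>)" and hom: "homeomorphism (fst \<kappa>) (snd \<kappa> ` fst \<kappa>) (snd \<kappa>) (chart_inv \<kappa>)"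
    using A by (auto simp: hilbert_manifold_def)
  have "open (snd \<kappa> ` fst \<kappa> \<inter> chart_inv \<kappa> -` W)"
    using hom op W by (intro continuous_open_preimage) (auto simp: homeomorphism_def)
  also have "snd \<kappa> ` fst \<kappa> \<inter> chart_inv \<kappa> -` W = snd \<kappa> ` (fst \<kappa> \<inter> W)"
    using chart_inv_snd[OF A] by auto
  finally show ?thesis .
qed

lemma chart_image_nhd:
  assumes A: "hilbert_manifold A" "\<kappa> \<in> A" and W: "open W" and u: "u \<in> fst \<kappa>" "u \<in> W"
  shows "\<forall>\<^sub>F x in nhds (snd \<kappa> u). \<exists>w \<in> fst \<kappa> \<inter> W. x = snd \<kappa> w \<and> chart_inv \<kappa> x = w"
proof -
  have "\<forall>\<^sub>F x in nhds (snd \<kappa> u). x \<in> snd \<kappa> ` (fst \<kappa> \<inter> W)"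
    using chart_image_open[OF A W] u by (intro eventually_nhds_in_open) auto
  then show ?thesis by (rule eventually_mono) (auto simp: chart_inv_snd[OF A])
qed

lemma smooth_map_on_vector_atlas:
  "smooth_map_on W A vector_atlas f \<longleftrightarrow> continuous_on W f \<and>
    (\<forall>\<kappa>\<in>A. smooth_on (snd \<kappa> ` (fst \<kappa> \<inter> W)) (f \<circ> chart_inv \<kappa>))"
  by (simp add: smooth_map_on_def vector_atlas_def Int_def)

lemma tmap_has_derivative:
  assumes A: "hilbert_manifold A" "\<kappa> \<in> A" and W: "open W" "u \<in> fst \<kappa>" "u \<in> W"
    and f: "smooth_map_on W A vector_atlas f"
  shows "(f \<circ> chart_inv \<kappa> has_derivative tmap \<kappa> f u) (at (snd \<kappa> u))"
proof -
  have "smooth_on (snd \<kappa> ` (fst \<kappa> \<inter> W)) (f \<circ> chart_inv \<kappa>)"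
    using f A(2) by (simp add: smooth_map_on_vector_atlas)
  then obtain f' where "(f \<circ> chart_inv \<kappa> has_derivative f') (at (snd \<kappa> u) within snd \<kappa> ` (fst \<kappa> \<inter> W))"
    using W by (elim smooth_on_has_derivative) auto
  then have "(f \<circ> chart_inv \<kappa> has_derivative f') (at (snd \<kappa> u))"
    using chart_image_open[OF A W(1)] W by (subst (asm) at_within_open) auto
  then show ?thesis
    unfolding tmap_def by (metis frechet_derivative_at)
qed

lemma tmap_eq:
  assumes "(f \<circ> chart_inv \<kappa> has_derivative f') (at (snd \<kappa> u))"
  shows "tmap \<kappa> f u = f'"
  using frechet_derivative_at[OF assms] by (simp add: tmap_def)

text \<open>
  By the chain rule for a change of charts, all charts give the same image.
\<close>

lemma tangent_image_eq_range:
  assumes A: "hilbert_manifold A" "\<kappa> \<in> A" "u \<in> fst \<kappa>" and f: "smooth_map_on UNIV A vector_atlas f"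
  shows "tangent_image A f u = range (tmap \<kappa> f u)"
proof -
  have "tmap \<mu> f u X \<in> range (tmap \<kappa> f u)" if m: "\<mu> \<in> A" "u \<in> fst \<mu>" for \<mu> X
  proof -
    define \<theta> where "\<theta> = snd \<kappa> \<circ> chart_inv \<mu>"
    have op: "open (snd \<mu> ` (fst \<mu> \<inter> fst \<kappa>))"
      using chart_image_open[OF A(1) m(1)] chart_domain_open[OF A(1,2)] by blast
    have "smooth_on (snd \<mu> ` (fst \<mu> \<inter> fst \<kappa>)) \<theta>"
      using A(1,2) m(1) by (auto simp: hilbert_manifold_def \<theta>_def)
    then obtain \<theta>' where "(\<theta> has_derivative \<theta>') (at (snd \<mu> u) within snd \<mu> ` (fst \<mu> \<inter> fst \<kappa>))"
      by (rule smooth_on_has_derivative) (use A m in auto)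
    then have \<theta>: "(\<theta> has_derivative \<theta>') (at (snd \<mu> u))"
      using op A m by (subst (asm) at_within_open) auto
    have eq: "\<theta> (snd \<mu> u) = snd \<kappa> u" by (simp add: \<theta>_def chart_inv_snd[OF A(1) m])
    have "((f \<circ> chart_inv \<kappa>) \<circ> \<theta> has_derivative tmap \<kappa> f u \<circ> \<theta>') (at (snd \<mu> u))"
      by (rule diff_chain_at[OF \<theta>]) (use tmap_has_derivative[OF A(1,2) open_UNIV A(3) _ f] eq in auto)
    then have "(f \<circ> chart_inv \<mu> has_derivative tmap \<kappa> f u \<circ> \<theta>') (at (snd \<mu> u))"
      by (rule has_derivative_transform_within_open[OF _ op])
        (use A m in \<open>auto simp: \<theta>_def chart_inv_snd[OF A(1,2)] chart_inv_snd[OF A(1) m(1)]\<close>)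
    then have "tmap \<mu> f u = tmap \<kappa> f u \<circ> \<theta>'" by (rule tmap_eq)
    then show ?thesis by simp
  qed
  then show ?thesis unfolding tangent_image_def using A(2,3) by blast
qed

lemma tmap_bounded_below:
  fixes A :: "('m::t2_space, 'e::{real_inner, complete_space}) chart set"
    and f :: "'m \<Rightarrow> 'v::{real_inner, complete_space}"
  assumes A: "hilbert_manifold A" "\<kappa> \<in> A" "u \<in> fst \<kappa>" and f: "immersion A f"
  obtains c where "c > 0" "\<And>X. c * norm X \<le> norm (tmap \<kappa> f u X)"
proof (rule bounded_below_if_inj_closed_range)
  show "bounded_linear (tmap \<kappa> f u)"
    using f by (intro has_derivative_bounded_linear[OF tmap_has_derivative[OF A(1,2) open_UNIV A(3)]])
      (auto simp: immersion_def)
  show "inj (tmap \<kappa> f u)" "closed (range (tmap \<kappa> f u))" using f A by (auto simp: immersion_def)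
qed (rule that)

lemma prod_chart_inv:
  assumes "inj_on (snd \<kappa>) (fst \<kappa>)" "inj_on (snd \<mu>) (fst \<mu>)" "x \<in> fst \<kappa>" "y \<in> fst \<mu>"
  shows "the_inv_into (fst \<kappa> \<times> fst \<mu>) (map_prod (snd \<kappa>) (snd \<mu>)) (snd \<kappa> x, snd \<mu> y) = (x, y)"
proof -
  have "inj_on (map_prod (snd \<kappa>) (snd \<mu>)) (fst \<kappa> \<times> fst \<mu>)" using assms by (intro map_prod_inj_on)
  from the_inv_into_f_f[OF this, of "(x, y)"] assms show ?thesis by simp
qed

text \<open>
  The second factor \<open>L\<close> is an atlas of the space acted on, or the time axis in the case of a flow.
\<close>

lemma smooth_map_prodD:
  assumes A: "hilbert_manifold A" and B: "\<kappa> \<in> A" "\<nu> \<in> L" "\<mu> \<in> M" and L: "inj_on (snd \<nu>) (fst \<nu>)"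
    and f: "smooth_map_on S (prod_atlas A L) M f"
  obtains D where "derivative_tower ((\<lambda>(x, y). (snd \<kappa> x, snd \<nu> y)) ` {p \<in> fst \<kappa> \<times> fst \<nu> \<inter> S. f p \<in> fst \<mu>}) D"
    "\<And>x y. x \<in> fst \<kappa> \<Longrightarrow> y \<in> fst \<nu> \<Longrightarrow> (x, y) \<in> S \<Longrightarrow> f (x, y) \<in> fst \<mu> \<Longrightarrow> D [] (snd \<kappa> x, snd \<nu> y) = snd \<mu> (f (x, y))"
proof -
  let ?c = "(fst \<kappa> \<times> fst \<nu>, map_prod (snd \<kappa>) (snd \<nu>))"
  have "?c \<in> prod_atlas A L" unfolding prod_atlas_def using B by blast
  then have "smooth_on (snd ?c ` {x \<in> fst ?c \<inter> S. f x \<in> fst \<mu>}) (snd \<mu> \<circ> f \<circ> chart_inv ?c)"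
    using f B(3) unfolding smooth_map_on_def by blast
  then obtain D where D: "derivative_tower (snd ?c ` {x \<in> fst ?c \<inter> S. f x \<in> fst \<mu>}) D"
     "\<And>z. z \<in> snd ?c ` {x \<in> fst ?c \<inter> S. f x \<in> fst \<mu>} \<Longrightarrow> D [] z = (snd \<mu> \<circ> f \<circ> chart_inv ?c) z"
    by (auto simp: smooth_on_iff_tower)
  show ?thesis
  proof (rule that)
    have "snd ?c = (\<lambda>(x, y). (snd \<kappa> x, snd \<nu> y))" by (auto simp: fun_eq_iff)
    then show "derivative_tower ((\<lambda>(x, y). (snd \<kappa> x, snd \<nu> y)) ` {p \<in> fst \<kappa> \<times> fst \<nu> \<inter> S. f p \<in> fst \<mu>}) D"
      using D(1) by simp
    fix x y assume xy: "x \<in> fst \<kappa>" "y \<in> fst \<nu>" "(x, y) \<in> S" "f (x, y) \<in> fst \<mu>"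
    have "inj_on (snd \<kappa>) (fst \<kappa>)" using A B(1) by (auto simp: hilbert_manifold_def)
    note inv = prod_chart_inv[OF this L xy(1,2)]
    have "(snd \<kappa> x, snd \<nu> y) \<in> snd ?c ` {x \<in> fst ?c \<inter> S. f x \<in> fst \<mu>}"
      using xy by (intro image_eqI[of _ _ "(x, y)"]) auto
    from D(2)[OF this] inv show "D [] (snd \<kappa> x, snd \<nu> y) = snd \<mu> (f (x, y))" by simp
  qed
qed

section \<open>Orbits\<close>

lemma action_one: "group_action G UNIV \<rho> \<Longrightarrow> \<rho> \<one>\<^bsub>G\<^esub> x = x"
  using group_action.id_eq_one[of G UNIV \<rho>] by (metis UNIV_I restrict_apply)

text \<open>
  The preimage of \<open>\<rho> U x\<close> in \<open>G\<close> is the union of the right translates of \<open>U\<close> by the stabilizer of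
  \<open>x\<close>, hence open; the orbit carries the quotient topology.
\<close>

lemma orbit_map_open:
  assumes G: "hilbert_lie_group G AG" and act: "group_action G UNIV \<rho>"
    and q: "quotient_map euclidean (top_of_set (orbit G \<rho> x)) (\<lambda>a. \<rho> a x)" and U: "open U"
  shows "openin (top_of_set (orbit G \<rho> x)) ((\<lambda>a. \<rho> a x) ` U)"
proof -
  have grp: "group G" and car: "carrier G = UNIV"
    and sm: "smooth_map_on UNIV (prod_atlas AG AG) AG (\<lambda>(a, b). a \<otimes>\<^bsub>G\<^esub> b)"
    using G by (auto simp: hilbert_lie_group_def)
  interpret group G by (rule grp)
  have comp: "\<rho> (a \<otimes>\<^bsub>G\<^esub> b) y = \<rho> a (\<rho> b y)" for a b y
    using group_action.composition_rule[OF act] car by simp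
  have "continuous_on UNIV (\<lambda>(a, b). a \<otimes>\<^bsub>G\<^esub> b)" using sm by (simp add: smooth_map_on_def)
  then have cont: "continuous_on UNIV (\<lambda>a. a \<otimes>\<^bsub>G\<^esub> s)" for s
    using continuous_on_compose2[of UNIV "\<lambda>(a, b). a \<otimes>\<^bsub>G\<^esub> b" UNIV "\<lambda>a. (a, s)"]
    by (simp add: continuous_on_Pair)
  have "{a. \<rho> a x \<in> (\<lambda>a. \<rho> a x) ` U} = (\<Union>s\<in>{s. \<rho> s x = x}. (\<lambda>a. a \<otimes>\<^bsub>G\<^esub> s) -` U)"
  proof (intro equalityI subsetI)
    fix a assume "a \<in> {a. \<rho> a x \<in> (\<lambda>a. \<rho> a x) ` U}"
    then obtain b where b: "b \<in> U" "\<rho> a x = \<rho> b x" by auto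
    define s where "s = inv\<^bsub>G\<^esub> a \<otimes>\<^bsub>G\<^esub> b"
    have "\<rho> s x = \<rho> (inv\<^bsub>G\<^esub> a \<otimes>\<^bsub>G\<^esub> a) x" by (simp add: s_def comp b(2))
    also have "\<dots> = x" using action_one[OF act] car by (simp add: l_inv)
    finally have "\<rho> s x = x" .
    moreover have "a \<otimes>\<^bsub>G\<^esub> s = b" unfolding s_def using car by (simp flip: m_assoc)
    ultimately show "a \<in> (\<Union>s\<in>{s. \<rho> s x = x}. (\<lambda>a. a \<otimes>\<^bsub>G\<^esub> s) -` U)" using b(1) by auto
  next
    fix a assume "a \<in> (\<Union>s\<in>{s. \<rho> s x = x}. (\<lambda>a. a \<otimes>\<^bsub>G\<^esub> s) -` U)"
    then obtain s where "\<rho> s x = x" "a \<otimes>\<^bsub>G\<^esub> s \<in> U" by auto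
    then show "a \<in> {a. \<rho> a x \<in> (\<lambda>a. \<rho> a x) ` U}" using comp[of a s x] by (auto intro!: image_eqI[of _ _ "a \<otimes>\<^bsub>G\<^esub> s"])
  qed
  with cont U have "open {a. \<rho> a x \<in> (\<lambda>a. \<rho> a x) ` U}" by (auto intro!: open_UN open_vimage)
  moreover have "(\<lambda>a. \<rho> a x) ` U \<subseteq> orbit G \<rho> x" using car by (auto simp: orbit_def)
  moreover have "openin (top_of_set (orbit G \<rho> x)) S \<longleftrightarrow> open {a. \<rho> a x \<in> S}" if "S \<subseteq> orbit G \<rho> x" for S
    using q that by (simp add: quotient_map_def)
  ultimately show ?thesis by blast
qed

lemma orbit_immersion:
  assumes "minimal_orbits G AG \<rho>"
  shows "immersion AG (\<lambda>a. \<rho> a x)" "quotient_map euclidean (top_of_set (orbit G \<rho> x)) (\<lambda>a. \<rho> a x)"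
    "\<exists>B. finite B \<and> span B = normal_space_at AG (\<lambda>a. \<rho> a x) a"
  using assms by (auto simp: minimal_orbits_def minimal_immersion_def regularizable_def)

lemma horizontal_eq:
  assumes G: "hilbert_lie_group G AG" and orb: "minimal_orbits G AG \<rho>"
    and \<nu>: "\<nu> \<in> AG" "\<one>\<^bsub>G\<^esub> \<in> fst \<nu>"
  shows "horizontal_distribution G AG \<rho> x = orthogonal_comp (range (tmap \<nu> (\<lambda>a. \<rho> a x) \<one>\<^bsub>G\<^esub>))"
  using tangent_image_eq_range[OF _ \<nu>, of "\<lambda>a. \<rho> a x"] G orbit_immersion(1)[OF orb, of x]
  by (simp add: horizontal_distribution_def vertical_distribution_def immersion_def hilbert_lie_group_def)

lemma horizontal_fin_dim:
  assumes "minimal_orbits G AG \<rho>"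
  obtains d where "fin_dim (horizontal_distribution G AG \<rho> x) d"
  using orbit_immersion(3)[OF assms, of x "\<one>\<^bsub>G\<^esub>"] fin_dim_span
  unfolding horizontal_distribution_def vertical_distribution_def normal_space_at_def by metis

text \<open>
  A curve in the orbit need not lift to \<open>G\<close> differentiably, but by openness of the orbit map its points
  near \<open>x\<close> are images of group elements near \<open>\<one>\<close>. If \<open>z\<close> are the coordinates of such an element, then
  \<open>c s - x = B (z - z0) + o(z - z0)\<close> with \<open>B\<close> bounded below, so that the error is also \<open>o(c s - x)\<close>. The
  component of \<open>c s - x\<close> normal to the orbit is contained in this error.
\<close>

lemma velocity_in_orbit:
  fixes \<rho> :: "'g::t2_space \<Rightarrow> 'v \<Rightarrow> 'v::{real_inner, complete_space}"
    and AG :: "('g, 'l::{real_inner, complete_space}) chart set"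
  assumes G: "hilbert_lie_group G AG" and act: "group_action G UNIV \<rho>" and orb: "minimal_orbits G AG \<rho>"
    and c: "(c has_vector_derivative v) (at 0)" "c 0 = x" "\<forall>\<^sub>F s in at 0. c s \<in> orbit G \<rho> x"
    and n: "n \<in> horizontal_distribution G AG \<rho> x"
  shows "v \<bullet> n = 0"
proof -
  have man: "hilbert_manifold AG" and car: "carrier G = UNIV" using G by (auto simp: hilbert_lie_group_def)
  then have "\<one>\<^bsub>G\<^esub> \<in> (\<Union>\<kappa>\<in>AG. fst \<kappa>)" by (simp add: hilbert_manifold_def)
  then obtain \<nu> where \<nu>: "\<nu> \<in> AG" "\<one>\<^bsub>G\<^esub> \<in> fst \<nu>" by blast
  define z0 where "z0 = snd \<nu> \<one>\<^bsub>G\<^esub>"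
  define B where "B = tmap \<nu> (\<lambda>a. \<rho> a x) \<one>\<^bsub>G\<^esub>"
  define f where "f = (\<lambda>a. \<rho> a x) \<circ> chart_inv \<nu>"
  have imm: "immersion AG (\<lambda>a. \<rho> a x)" and q: "quotient_map euclidean (top_of_set (orbit G \<rho> x)) (\<lambda>a. \<rho> a x)"
    using orbit_immersion[OF orb] by auto
  have f: "(f has_derivative B) (at z0)"
    unfolding f_def B_def z0_def using imm by (intro tmap_has_derivative[OF man \<nu>(1) open_UNIV \<nu>(2)]) (auto simp: immersion_def)
  have fz0: "f z0 = x" by (simp add: f_def z0_def chart_inv_snd[OF man \<nu>] action_one[OF act])
  obtain k where k: "k > 0" "\<And>z. k * norm z \<le> norm (B z)"
    using tmap_bounded_below[OF man \<nu> imm] unfolding B_def by blast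
  have nB: "B z \<bullet> n = 0" for z
    using n unfolding horizontal_eq[OF G orb \<nu>] B_def orthogonal_comp_def orthogonal_def by blast
  have c_cont: "(c \<longlongrightarrow> x) (at 0)"
    using has_vector_derivative_continuous[OF c(1)] c(2) by (simp add: continuous_within)
  have small: "\<forall>\<^sub>F s in at 0. \<bar>(c s - x) \<bullet> n\<bar> \<le> e * norm (c s - x)" if e: "e > 0" for e
  proof -
    \<comment> \<open>The bound \<open>k / 2\<close> makes \<open>norm (z - z0)\<close> comparable to \<open>norm (c s - x)\<close>; the other one yields the factor \<open>e\<close>.\<close>
    define e' where "e' = min (k / 2) (e * k / (2 * (norm n + 1)))"
    have "0 < norm n + 1" by (rule add_nonneg_pos) auto
    then have "e' > 0" using e k(1) by (simp add: e'_def)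
    have "e' \<le> k / 2" unfolding e'_def by (rule min.cobounded1)
    have e'2: "e' * (2 * (norm n + 1)) \<le> e * k"
    proof -
      have "e' \<le> e * k / (2 * (norm n + 1))" by (simp add: e'_def)
      then show "e' * (2 * (norm n + 1)) \<le> e * k" using \<open>0 < norm n + 1\<close> by (simp add: pos_le_divide_eq)
    qed
    note e' = \<open>e' > 0\<close> \<open>e' \<le> k / 2\<close> e'2
    obtain r where r: "r > 0" "\<And>z. norm (z - z0) < r \<Longrightarrow> norm (f z - f z0 - B (z - z0)) \<le> e' * norm (z - z0)"
      using f e'(1) unfolding has_derivative_at_alt by blast
    define U where "U = fst \<nu> \<inter> snd \<nu> -` ball z0 r"
    have "open U" unfolding U_def
      using man \<nu>(1) by (intro continuous_open_preimage) (auto simp: hilbert_manifold_def homeomorphism_def)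
    then have "openin (top_of_set (orbit G \<rho> x)) ((\<lambda>a. \<rho> a x) ` U)"
      by (rule orbit_map_open[OF G act q])
    then obtain W where W: "open W" "(\<lambda>a. \<rho> a x) ` U = orbit G \<rho> x \<inter> W" by (auto simp: openin_open)
    have "\<one>\<^bsub>G\<^esub> \<in> U" using \<nu> r by (simp add: U_def z0_def)
    then have "\<rho> \<one>\<^bsub>G\<^esub> x \<in> W" using W(2) by blast
    then have "x \<in> W" by (simp add: action_one[OF act])
    then have "\<forall>\<^sub>F s in at 0. c s \<in> W" using c_cont W(1) by (simp add: topological_tendstoD)
    then show ?thesis using c(3)
    proof eventually_elim
      case (elim s)
      then have "c s \<in> (\<lambda>a. \<rho> a x) ` U" using W(2) by blast
      then obtain a where a: "a \<in> U" "c s = \<rho> a x" by blast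
      define z where "z = snd \<nu> a"
      have z: "norm (z - z0) < r" "c s = f z"
        using a chart_inv_snd[OF man \<nu>(1)] by (auto simp: U_def z_def f_def dist_norm norm_minus_commute)
      have est: "norm (c s - x - B (z - z0)) \<le> e' * norm (z - z0)" using r(2)[OF z(1)] by (simp add: z(2) fz0)
      have "k * norm (z - z0) \<le> norm (B (z - z0))" by (rule k(2))
      also have "\<dots> \<le> norm (c s - x) + norm (c s - x - B (z - z0))"
        using norm_triangle_ineq4[of "c s - x" "c s - x - B (z - z0)"] by simp
      also have "\<dots> \<le> norm (c s - x) + k / 2 * norm (z - z0)"
        using est e'(2) by (meson add_left_mono mult_right_mono norm_ge_zero order_trans)
      finally have zle: "k * norm (z - z0) \<le> 2 * norm (c s - x)" by simp
      have "(c s - x) \<bullet> n = (c s - x - B (z - z0)) \<bullet> n" by (simp add: inner_diff_left nB)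
      then have "\<bar>(c s - x) \<bullet> n\<bar> \<le> norm (c s - x - B (z - z0)) * norm n"
        by (simp add: Cauchy_Schwarz_ineq2)
      also have "\<dots> \<le> (e' * norm (z - z0)) * (norm n + 1)" using est e'(1) by (intro mult_mono) auto
      also have "\<dots> = (e' * (2 * (norm n + 1))) * norm (z - z0) / 2" by simp
      also have "\<dots> \<le> (e * k) * norm (z - z0) / 2" using e'(3) by (intro divide_right_mono mult_right_mono) auto
      also have "\<dots> = e * (k * norm (z - z0)) / 2" by simp
      also have "\<dots> \<le> e * (2 * norm (c s - x)) / 2" using zle e by (intro divide_right_mono mult_left_mono) auto
      finally show ?case by simp
    qed
  qed
  have lim: "((\<lambda>s. (1 / s) *\<^sub>R (c s - x)) \<longlongrightarrow> v) (at 0)"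
  proof -
    have "((\<lambda>s. norm (c s - x - s *\<^sub>R v) / \<bar>s\<bar>) \<longlongrightarrow> 0) (at 0)"
      using c(1,2) by (simp add: has_vector_derivative_def has_derivative_iff_norm)
    then have "((\<lambda>s. norm ((1 / s) *\<^sub>R (c s - x) - v)) \<longlongrightarrow> 0) (at 0)"
    proof (rule Lim_transform_eventually)
      show "\<forall>\<^sub>F s in at 0. norm (c s - x - s *\<^sub>R v) / \<bar>s\<bar> = norm ((1 / s) *\<^sub>R (c s - x) - v)"
        unfolding eventually_at
      proof (intro exI[of _ 1] conjI ballI impI)
        fix s :: real assume "s \<noteq> 0 \<and> dist s 0 < 1"
        then have "(1 / s) *\<^sub>R (c s - x) - v = (1 / s) *\<^sub>R (c s - x - s *\<^sub>R v)" by (simp add: scaleR_diff_right)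
        then show "norm (c s - x - s *\<^sub>R v) / \<bar>s\<bar> = norm ((1 / s) *\<^sub>R (c s - x) - v)" by simp
      qed simp
    qed
    then show ?thesis by (rule LIM_zero_cancel[OF tendsto_norm_zero_cancel])
  qed
  have bnd: "\<bar>v \<bullet> n\<bar> \<le> e * norm v" if e: "e > 0" for e
  proof (rule tendsto_le)
    show "((\<lambda>s. \<bar>((1 / s) *\<^sub>R (c s - x)) \<bullet> n\<bar>) \<longlongrightarrow> \<bar>v \<bullet> n\<bar>) (at 0)" by (intro tendsto_intros lim)
    show "((\<lambda>s. e * norm ((1 / s) *\<^sub>R (c s - x))) \<longlongrightarrow> e * norm v) (at 0)" by (intro tendsto_intros lim)
    show "\<forall>\<^sub>F s in at 0. \<bar>((1 / s) *\<^sub>R (c s - x)) \<bullet> n\<bar> \<le> e * norm ((1 / s) *\<^sub>R (c s - x))"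
      using small[OF e]
    proof eventually_elim
      case (elim s)
      have "\<bar>((1 / s) *\<^sub>R (c s - x)) \<bullet> n\<bar> = \<bar>1 / s\<bar> * \<bar>(c s - x) \<bullet> n\<bar>" by (simp add: abs_mult)
      also have "\<dots> \<le> \<bar>1 / s\<bar> * (e * norm (c s - x))" by (rule mult_left_mono[OF elim]) simp
      finally show ?case by (simp add: ac_simps)
    qed
  qed simp
  have "\<bar>v \<bullet> n\<bar> \<le> d" if "d > 0" for d
  proof -
    have p: "norm v + 1 > 0" by (rule add_nonneg_pos) auto
    have "\<bar>v \<bullet> n\<bar> \<le> d / (norm v + 1) * norm v" using bnd[of "d / (norm v + 1)"] that p by simp
    also have "\<dots> = d * (norm v / (norm v + 1))" by simp
    also have "\<dots> \<le> d * 1" using that p by (intro mult_left_mono) auto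
    finally show ?thesis by simp
  qed
  then have "\<bar>v \<bullet> n\<bar> \<le> 0" by (rule field_le_epsilon) simp
  then show ?thesis by simp
qed

text \<open>
  The differentials of the orbit maps are partial differentials of the smooth action.
\<close>

lemma orbit_tangent_continuous:
  fixes \<rho> :: "'g::t2_space \<Rightarrow> 'v \<Rightarrow> 'v::{real_inner, complete_space}"
    and AG :: "('g, 'l::{real_inner, complete_space}) chart set"
  assumes man: "hilbert_manifold AG" and act: "smooth_action G AG vector_atlas \<rho>"
    and \<nu>: "\<nu> \<in> AG" "a \<in> fst \<nu>" and e: "e > 0"
  obtains r where "r > 0" "\<And>y z. norm (y - x) < r \<Longrightarrow>
    norm (tmap \<nu> (\<lambda>a. \<rho> a y) a z - tmap \<nu> (\<lambda>a. \<rho> a x) a z) \<le> e * norm z"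
proof -
  have ids: "(UNIV, id) \<in> vector_atlas" "inj_on (snd (UNIV, id)) (fst (UNIV, id))" by (auto simp: vector_atlas_def)
  obtain D where D: "derivative_tower ((\<lambda>(x, y). (snd \<nu> x, snd (UNIV, id) y)) `
        {p \<in> fst \<nu> \<times> fst (UNIV, id) \<inter> UNIV. (case p of (a, x) \<Rightarrow> \<rho> a x) \<in> fst (UNIV, id)}) D"
      "\<And>b y. b \<in> fst \<nu> \<Longrightarrow> y \<in> fst (UNIV, id) \<Longrightarrow> (b, y) \<in> UNIV \<Longrightarrow> (case (b, y) of (a, x) \<Rightarrow> \<rho> a x) \<in> fst (UNIV, id) \<Longrightarrow>
        D [] (snd \<nu> b, snd (UNIV, id) y) = snd (UNIV, id) (case (b, y) of (a, x) \<Rightarrow> \<rho> a x)"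
    by (rule smooth_map_prodD[OF man \<nu>(1) ids(1) ids(1) ids(2), of UNIV "\<lambda>(a, x). \<rho> a x"])
      (use act in \<open>auto simp: smooth_action_def\<close>)
  define S where "S = snd \<nu> ` fst \<nu> \<times> (UNIV :: 'v set)"
  have "(\<lambda>(x, y). (snd \<nu> x, snd (UNIV, id) y)) ` {p \<in> fst \<nu> \<times> fst (UNIV, id) \<inter> UNIV. (case p of (a, x) \<Rightarrow> \<rho> a x) \<in> fst (UNIV, id)} = S"
    by (auto simp: S_def image_iff)
  then have DS: "derivative_tower S D" using D(1) by simp
  have D0: "D [] (snd \<nu> b, y) = \<rho> b y" if "b \<in> fst \<nu>" for b y using D(2)[OF that] by simp
  have opn: "open (snd \<nu> ` fst \<nu>)" using man \<nu>(1) by (auto simp: hilbert_manifold_def)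
  have tm: "tmap \<nu> (\<lambda>a. \<rho> a y) a = (\<lambda>z. D [(z, 0)] (snd \<nu> a, y))" for y
  proof (rule tmap_eq)
    have "derivative_tower (snd \<nu> ` fst \<nu>) (\<lambda>vs b. D (map (\<lambda>v. (v, 0)) vs @ []) (b, y))"
      by (rule tower_slice[OF DS]) (simp add: S_def)
    from tower_has_derivative[OF this, of "snd \<nu> a" "[]"] \<nu>
    have "((\<lambda>b. D [] (b, y)) has_derivative (\<lambda>z. D [(z, 0)] (snd \<nu> a, y))) (at (snd \<nu> a) within snd \<nu> ` fst \<nu>)"
      by simp
    then have "((\<lambda>b. D [] (b, y)) has_derivative (\<lambda>z. D [(z, 0)] (snd \<nu> a, y))) (at (snd \<nu> a))"
      using opn \<nu> by (subst (asm) at_within_open) auto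
    then show "((\<lambda>a. \<rho> a y) \<circ> chart_inv \<nu> has_derivative (\<lambda>z. D [(z, 0)] (snd \<nu> a, y))) (at (snd \<nu> a))"
      by (rule has_derivative_transform_within_open[OF _ opn]) (use \<nu> in \<open>auto simp: D0 chart_inv_snd[OF man]\<close>)
  qed
  have "(snd \<nu> a, x) \<in> S" using \<nu> by (simp add: S_def)
  from tower_norm_continuous[OF DS this e] obtain r where r: "r > 0"
    "\<And>y v. y \<in> S \<Longrightarrow> norm (y - (snd \<nu> a, x)) < r \<Longrightarrow> norm (D [v] y - D [v] (snd \<nu> a, x)) \<le> e * norm v" by blast
  show ?thesis
  proof (rule that[OF r(1)])
    fix y z assume "norm (y - x) < r"
    then show "norm (tmap \<nu> (\<lambda>a. \<rho> a y) a z - tmap \<nu> (\<lambda>a. \<rho> a x) a z) \<le> e * norm z"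
      using r(2)[of "(snd \<nu> a, y)" "(z, 0)"] \<nu> by (simp add: tm S_def norm_Pair)
  qed
qed

text \<open>
  The tangent spaces of the orbits are the ranges of a norm continuous family of operators that are
  bounded below, indexed by the connected space \<open>V\<close>.
\<close>

lemma horizontal_dim_constant:
  fixes \<rho> :: "'g::t2_space \<Rightarrow> 'v \<Rightarrow> 'v::{real_inner, complete_space}"
    and AG :: "('g, 'l::{real_inner, complete_space}) chart set"
  assumes G: "hilbert_lie_group G AG" and act: "smooth_action G AG vector_atlas \<rho>"
    and orb: "minimal_orbits G AG \<rho>" and d: "fin_dim (horizontal_distribution G AG \<rho> x) d"
  shows "fin_dim (horizontal_distribution G AG \<rho> y) d"
proof -
  have man: "hilbert_manifold AG" using G by (auto simp: hilbert_lie_group_def)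
  then have "\<one>\<^bsub>G\<^esub> \<in> (\<Union>\<kappa>\<in>AG. fst \<kappa>)" by (simp add: hilbert_manifold_def)
  then obtain \<nu> where \<nu>: "\<nu> \<in> AG" "\<one>\<^bsub>G\<^esub> \<in> fst \<nu>" by blast
  have imm: "immersion AG (\<lambda>a. \<rho> a x)" for x using orbit_immersion[OF orb] by auto
  show ?thesis unfolding horizontal_eq[OF G orb \<nu>]
  proof (rule codim_range_constant[of UNIV x y])
    show "bounded_linear (tmap \<nu> (\<lambda>a. \<rho> a x) \<one>\<^bsub>G\<^esub>)" for x
      using imm[of x] by (intro has_derivative_bounded_linear[OF tmap_has_derivative[OF man \<nu>(1) open_UNIV \<nu>(2)]])
        (auto simp: immersion_def)
    show "\<exists>c>0. \<forall>z. c * norm z \<le> norm (tmap \<nu> (\<lambda>a. \<rho> a x) \<one>\<^bsub>G\<^esub> z)" for x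
      using tmap_bounded_below[OF man \<nu> imm[of x]] by blast
    show "\<exists>r>0. \<forall>s\<in>UNIV. dist s t < r \<longrightarrow> (\<forall>z. norm (tmap \<nu> (\<lambda>a. \<rho> a s) \<one>\<^bsub>G\<^esub> z - tmap \<nu> (\<lambda>a. \<rho> a t) \<one>\<^bsub>G\<^esub> z) \<le> e * norm z)"
      if "e > 0" for t e
    proof -
      from orbit_tangent_continuous[OF man act \<nu> that, of t] obtain r where "r > 0" "\<And>y z. norm (y - t) < r \<Longrightarrow>
          norm (tmap \<nu> (\<lambda>a. \<rho> a y) \<one>\<^bsub>G\<^esub> z - tmap \<nu> (\<lambda>a. \<rho> a t) \<one>\<^bsub>G\<^esub> z) \<le> e * norm z" by blast
      then show ?thesis by (auto simp: dist_norm)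
    qed
    show "fin_dim (orthogonal_comp (range (tmap \<nu> (\<lambda>a. \<rho> a x) \<one>\<^bsub>G\<^esub>))) d"
      using d by (simp add: horizontal_eq[OF G orb \<nu>])
  qed auto
qed

section \<open>Uniqueness of the regularized mean curvature vector\<close>

text \<open>
  If \<open>i\<close> were the first index with \<open>q i < p i\<close>, the value \<open>p i\<close> would be taken more often by \<open>p\<close> than
  by \<open>q\<close>. By induction, the multiplicities of its positive values determine a nonnegative decreasing sequence.
\<close>

lemma decseq_eq_by_multiplicities:
  fixes p q :: "nat \<Rightarrow> real"
  assumes p: "decseq p" "\<And>c. c > 0 \<Longrightarrow> finite {i. p i = c}" and q: "decseq q" "\<And>i. 0 \<le> q i"
    and card: "\<And>c. c > 0 \<Longrightarrow> card {i. p i = c} = card {i. q i = c}"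
    and eq: "\<And>j. j < i \<Longrightarrow> p j = q j"
  shows "p i \<le> q i"
proof (rule ccontr)
  assume "\<not> p i \<le> q i"
  then have less: "q i < p i" by simp
  then have pos: "p i > 0" using q(2)[of i] by linarith
  have "j < i" if "q j = p i" for j
    using that less decseqD[OF q(1), of i j] by (cases "j < i") auto
  then have "{j. q j = p i} \<subseteq> {j. p j = p i} - {i}" using eq by auto
  then have "card {j. q j = p i} \<le> card ({j. p j = p i} - {i})"
    using p(2)[OF pos] by (intro card_mono) auto
  also have "\<dots> < card {j. p j = p i}" using p(2)[OF pos] by (intro card_Diff1_less) auto
  finally show False using card[OF pos] by simp
qed

lemma spectral_sequences_unique:
  assumes "spectral_sequences S p m" "spectral_sequences S p' m'"
  shows "p = p'" "m = m'"
proof -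
  have eq: "p1 i = p2 i"
    if p: "decseq p1" "\<And>i. 0 \<le> p1 i" "\<And>c. c > 0 \<Longrightarrow> finite {i. p1 i = c} \<and> card {i. p1 i = c} = d c"
      "decseq p2" "\<And>i. 0 \<le> p2 i" "\<And>c. c > 0 \<Longrightarrow> finite {i. p2 i = c} \<and> card {i. p2 i = c} = d c"
    for p1 p2 :: "nat \<Rightarrow> real" and d i
  proof (induction i rule: less_induct)
    case (less i)
    have "p1 i \<le> p2 i" by (rule decseq_eq_by_multiplicities) (simp_all add: p less)
    moreover have "p2 i \<le> p1 i" by (rule decseq_eq_by_multiplicities) (simp_all add: p less)
    ultimately show ?case by simp
  qed
  note S = assms[unfolded spectral_sequences_def]
  show "p = p'"
  proof
    show "p i = p' i" for i
      by (rule eq[of _ "\<lambda>c. dim {X. S X = c *\<^sub>R X}"]) (use S in simp_all)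
  qed
  have neg: "{i. - k i = c} = {i. k i = - c}" for k :: "nat \<Rightarrow> real" and c by auto
  show "m = m'"
  proof
    fix i
    have "- m i = - m' i"
      by (rule eq[of "\<lambda>i. - m i" "\<lambda>c. dim {X. S X = (- c) *\<^sub>R X}"])
        (use S in \<open>simp_all add: neg monotone_def\<close>)
    then show "m i = m' i" by simp
  qed
qed

lemma regularized_trace_unique: "has_regularized_trace S r \<Longrightarrow> has_regularized_trace S r' \<Longrightarrow> r = r'"
  unfolding has_regularized_trace_def using spectral_sequences_unique sums_unique2 by blast

text \<open>
  Identifies the velocity of the flow with the given field \<open>H\<close>.
\<close>

lemma regularized_mean_curvature_unique:
  assumes A: "hilbert_manifold A"
    and \<eta>: "regularized_mean_curvature A f u \<eta>" "regularized_mean_curvature A f u \<eta>'"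
  shows "\<eta> = \<eta>'"
proof -
  obtain \<kappa> where \<kappa>: "\<kappa> \<in> A" "u \<in> fst \<kappa>" using A unfolding hilbert_manifold_def by blast
  have N: "\<eta> \<in> normal_space_at A f u" "\<eta>' \<in> normal_space_at A f u"
    using \<eta> by (auto simp: regularized_mean_curvature_def)
  then have "\<eta> - \<eta>' \<in> normal_space_at A f u"
    unfolding normal_space_at_def by (rule subspace_diff[OF subspace_orthogonal_comp])
  then have "\<eta> \<bullet> (\<eta> - \<eta>') = \<eta>' \<bullet> (\<eta> - \<eta>')"
    using \<eta> \<kappa> unfolding regularized_mean_curvature_def by (blast intro: regularized_trace_unique)
  then have "(\<eta> - \<eta>') \<bullet> (\<eta> - \<eta>') = 0" by (simp add: inner_diff_left)
  then show ?thesis by simp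
qed

section \<open>The horizontal part of a moving metric\<close>

text \<open>
  For \<open>C = C'\<close> this is the metric induced by \<open>C\<close>, as an element of the Banach space of bounded bilinear
  forms, in which the time derivative is taken.
\<close>

definition pullback_inner :: "'a::real_normed_vector \<Rightarrow>\<^sub>L 'v::real_inner \<Rightarrow> 'a \<Rightarrow>\<^sub>L 'v \<Rightarrow> 'a \<Rightarrow>\<^sub>L 'a \<Rightarrow>\<^sub>L real"
  where "pullback_inner C C' = Blinfun (\<lambda>X. Blinfun (\<lambda>Y. C X \<bullet> C' Y))"

lemma pullback_inner_apply: "pullback_inner C C' X Y = C X \<bullet> C' Y"
proof -
  have 1: "bounded_linear (\<lambda>Y. C X \<bullet> C' Y)" for X
    by (intro bounded_linear_intros)
  have 2: "blinfun_apply (Blinfun (\<lambda>Y. C X \<bullet> C' Y)) = (\<lambda>Y. C X \<bullet> C' Y)" for X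
    by (rule bounded_linear_Blinfun_apply[OF 1])
  have 3: "bounded_linear (\<lambda>X. Blinfun (\<lambda>Y. C X \<bullet> C' Y))"
  proof (rule bounded_linear_intro[where K = "norm C * norm C'"])
    show "Blinfun (\<lambda>Z. C (X + Y) \<bullet> C' Z) = Blinfun (\<lambda>Z. C X \<bullet> C' Z) + Blinfun (\<lambda>Z. C Y \<bullet> C' Z)" for X Y
      by (rule blinfun_eqI, unfold blinfun.add_left 2) (simp add: blinfun.add_right inner_add_left)
    show "Blinfun (\<lambda>Z. C (r *\<^sub>R X) \<bullet> C' Z) = r *\<^sub>R Blinfun (\<lambda>Z. C X \<bullet> C' Z)" for X r
      by (rule blinfun_eqI, unfold blinfun.scaleR_left 2) (simp add: blinfun.scaleR_right)
    show "norm (Blinfun (\<lambda>Y. C X \<bullet> C' Y)) \<le> norm X * (norm C * norm C')" for X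
    proof (rule norm_blinfun_bound)
      fix Y
      have "\<bar>C X \<bullet> C' Y\<bar> \<le> norm (C X) * norm (C' Y)" by (rule Cauchy_Schwarz_ineq2)
      also have "\<dots> \<le> (norm C * norm X) * (norm C' * norm Y)"
        by (intro mult_mono norm_blinfun) auto
      finally show "norm (blinfun_apply (Blinfun (\<lambda>Y. C X \<bullet> C' Y)) Y) \<le> norm X * (norm C * norm C') * norm Y"
        by (simp add: 2 ac_simps)
    qed auto
  qed
  show ?thesis unfolding pullback_inner_def bounded_linear_Blinfun_apply[OF 3] 2 by simp
qed

lemma bounded_bilinear_pullback_inner: "bounded_bilinear pullback_inner"
proof
  show "\<exists>K. \<forall>C C' :: 'a \<Rightarrow>\<^sub>L 'b. norm (pullback_inner C C') \<le> norm C * norm C' * K"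
  proof (intro exI[of _ 1] allI norm_blinfun_bound)
    fix C C' :: "'a \<Rightarrow>\<^sub>L 'b" and X Y
    have "\<bar>C X \<bullet> C' Y\<bar> \<le> norm (C X) * norm (C' Y)" by (rule Cauchy_Schwarz_ineq2)
    also have "\<dots> \<le> (norm C * norm X) * (norm C' * norm Y)"
      by (intro mult_mono norm_blinfun) auto
    finally show "norm (pullback_inner C C' X Y) \<le> norm C * norm C' * 1 * norm X * norm Y"
      by (simp add: pullback_inner_apply ac_simps)
  qed auto
qed (auto intro!: blinfun_eqI simp: pullback_inner_apply blinfun.bilinear_simps inner_add_left inner_add_right)

text \<open>
  The projections \<open>P s\<close> need not be differentiated. As all of them have the kernel \<open>W\<close>, the vector
  \<open>w s X = P t X - P s X\<close> lies in \<open>W\<close> and Pythagoras' theorem for the metric at time \<open>s\<close> gives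
  \<open>D s (P s X) \<bullet> D s (P s Y) = D s (P t X) \<bullet> D s (P t Y) - D s (w s X) \<bullet> D s (w s Y)\<close>.
  Since \<open>P t X\<close> is orthogonal to \<open>W\<close> at time \<open>t\<close>, its projection \<open>w s X\<close> to \<open>W\<close> at time \<open>s\<close> is
  \<open>O(s - t)\<close>. The last term is thus quadratic, and the derivative is that of the metric with the
  projection frozen at time \<open>t\<close>.
\<close>

lemma projected_metric_has_derivative:
  fixes D :: "real \<Rightarrow> 'a::real_normed_vector \<Rightarrow>\<^sub>L 'v::real_inner" and P :: "real \<Rightarrow> 'a \<Rightarrow>\<^sub>L 'a"
  assumes D: "(D has_vector_derivative D') (at t within I)" and t: "t \<in> I"
    and W: "subspace W" and PW: "\<And>s X. s \<in> I \<Longrightarrow> X - P s X \<in> W"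
    and orth: "\<And>s X w. s \<in> I \<Longrightarrow> w \<in> W \<Longrightarrow> D s (P s X) \<bullet> D s w = 0"
    and below: "c > 0" "\<And>X. c * norm X \<le> norm (D t X)"
  shows "((\<lambda>s. pullback_inner (D s o\<^sub>L P s) (D s o\<^sub>L P s)) has_vector_derivative
    pullback_inner (D' o\<^sub>L P t) (D t o\<^sub>L P t) + pullback_inner (D t o\<^sub>L P t) (D' o\<^sub>L P t)) (at t within I)"
proof -
  interpret pb: bounded_bilinear pullback_inner by (rule bounded_bilinear_pullback_inner)
  define w where "w s = P t - P s" for s
  have wW: "w s X \<in> W" if "s \<in> I" for s X
  proof -
    have "w s X = (X - P s X) - (X - P t X)" by (simp add: w_def blinfun.bilinear_simps)
    then show ?thesis using PW[OF that, of X] PW[OF t, of X] W subspace_diff by metis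
  qed
  have split: "D s (P s X) \<bullet> D s (P s Y) = D s (P t X) \<bullet> D s (P t Y) - D s (w s X) \<bullet> D s (w s Y)"
    if s: "s \<in> I" for s X Y
  proof -
    have Pt: "P t Z = P s Z + w s Z" for Z by (simp add: w_def blinfun.bilinear_simps)
    show ?thesis
      using orth[OF s wW[OF s]] orth[OF s wW[OF s], of Y X] unfolding Pt
      by (simp add: blinfun.bilinear_simps inner_add_left inner_add_right inner_commute)
  qed
  have D1: "((\<lambda>s. D s o\<^sub>L P t) has_vector_derivative D' o\<^sub>L P t) (at t within I)"
    by (rule bounded_linear.has_vector_derivative[OF bounded_bilinear.bounded_linear_left[OF bounded_bilinear_blinfun_compose] D])
  have main: "((\<lambda>s. pullback_inner (D s o\<^sub>L P t) (D s o\<^sub>L P t)) has_vector_derivative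
      pullback_inner (D' o\<^sub>L P t) (D t o\<^sub>L P t) + pullback_inner (D t o\<^sub>L P t) (D' o\<^sub>L P t)) (at t within I)"
    using pb.has_vector_derivative[OF D1 D1] by (simp add: add.commute)
  have err: "((\<lambda>s. pullback_inner (D s o\<^sub>L w s) (D s o\<^sub>L w s)) has_vector_derivative 0) (at t within I)"
  proof -
    have wt: "w t = 0" by (simp add: w_def)
    \<comment> \<open>\<open>L\<close> is a Lipschitz constant of \<open>D\<close> at \<open>t\<close>, and \<open>M\<close> bounds the norms of the \<open>D s\<close> near \<open>t\<close>.\<close>
    define L where "L = norm D' + 1"
    define M where "M = norm (D t) + c / 2"
    define k where "k = 2 * L * M * norm (P t) * 4 / c\<^sup>2"
    have L: "L > 0" by (simp add: L_def add_nonneg_pos)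
    have M: "M > 0" using below(1) by (simp add: M_def add_nonneg_pos)
    have k: "k \<ge> 0" using L M by (simp add: k_def)
    have lip: "\<forall>\<^sub>F s in at t within I. norm (D s - D t) \<le> L * \<bar>s - t\<bar>"
    proof -
      have "\<forall>e>0. \<exists>d>0. \<forall>s\<in>I. norm (s - t) < d \<longrightarrow> norm (D s - D t - (s - t) *\<^sub>R D') \<le> e * norm (s - t)"
        using D unfolding has_vector_derivative_def has_derivative_within_alt by blast
      then obtain d where d: "d > 0" "\<And>s. s \<in> I \<Longrightarrow> norm (s - t) < d \<Longrightarrow> norm (D s - D t - (s - t) *\<^sub>R D') \<le> 1 * norm (s - t)"
        using zero_less_one by blast
      show ?thesis unfolding eventually_at
      proof (intro exI[of _ d] conjI ballI impI d(1))
        fix s assume s: "s \<in> I" "s \<noteq> t \<and> dist s t < d"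
        have "norm (D s - D t) \<le> norm (D s - D t - (s - t) *\<^sub>R D') + norm ((s - t) *\<^sub>R D')"
          using norm_triangle_ineq[of "D s - D t - (s - t) *\<^sub>R D'" "(s - t) *\<^sub>R D'"] by simp
        also have "\<dots> \<le> \<bar>s - t\<bar> + \<bar>s - t\<bar> * norm D'"
          using d(2)[of s] s by (intro add_mono) (auto simp: dist_real_def)
        finally show "norm (D s - D t) \<le> L * \<bar>s - t\<bar>" by (simp add: L_def algebra_simps)
      qed
    qed
    have near: "\<forall>\<^sub>F s in at t within I. L * \<bar>s - t\<bar> < c / 2"
    proof -
      have "((\<lambda>s. L * \<bar>s - t\<bar>) \<longlongrightarrow> L * \<bar>t - t\<bar>) (at t within I)" by (intro tendsto_intros)
      then show ?thesis using below(1) by (intro order_tendstoD(2)) auto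
    qed
    have inI: "\<forall>\<^sub>F s in at t within I. s \<in> I" by (auto simp: eventually_at intro!: exI[of _ 1])
    have bound: "\<forall>\<^sub>F s in at t within I. norm (pullback_inner (D s o\<^sub>L w s) (D s o\<^sub>L w s)) \<le> (M * k)\<^sup>2 * \<bar>s - t\<bar>\<^sup>2"
      using lip near inI
    proof eventually_elim
      case (elim s)
      have small: "norm (D s - D t) \<le> c / 2" using elim by linarith
      have nD: "norm (D s) \<le> M" "norm (D t) \<le> M"
        using norm_triangle_ineq2[of "D s" "D t"] small below(1) by (auto simp: M_def)
      have lower: "c / 2 * norm X \<le> norm (D s X)" for X
      proof -
        have "norm (D t X) - norm (D s X) \<le> norm ((D s - D t) X)"
          using norm_triangle_ineq2[of "D t X" "D s X"] by (simp add: blinfun.bilinear_simps norm_minus_commute)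
        also have "\<dots> \<le> norm (D s - D t) * norm X" by (rule norm_blinfun)
        also have "\<dots> \<le> c / 2 * norm X" using small by (intro mult_right_mono) auto
        finally show ?thesis using below(2)[of X] by (simp add: field_simps)
      qed
      have wb: "norm (w s X) \<le> k * \<bar>s - t\<bar> * norm X" for X
      proof -
        define v where "v = w s X"
        define Y where "Y = P t X"
        have vW: "v \<in> W" using wW[OF elim(3)] by (simp add: v_def)
        have "Y = P s X + v" by (simp add: Y_def v_def w_def blinfun.bilinear_simps)
        then have "D s v \<bullet> D s v = D s Y \<bullet> D s v"
          using orth[OF elim(3) vW, of X] by (simp add: blinfun.bilinear_simps inner_add_left)
        also have "\<dots> = (D s - D t) Y \<bullet> D s v + D t Y \<bullet> (D s - D t) v"
          using orth[OF t vW, of X] by (simp add: Y_def blinfun.bilinear_simps inner_diff_left inner_diff_right)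
        also have "\<dots> \<le> norm ((D s - D t) Y) * norm (D s v) + norm (D t Y) * norm ((D s - D t) v)"
          by (intro add_mono norm_cauchy_schwarz)
        also have "\<dots> \<le> (L * \<bar>s - t\<bar> * norm Y) * (M * norm v) + (M * norm Y) * (L * \<bar>s - t\<bar> * norm v)"
        proof (intro add_mono mult_mono)
          have "norm ((D s - D t) Z) \<le> L * \<bar>s - t\<bar> * norm Z" for Z
            using norm_blinfun[of "D s - D t" Z] mult_right_mono[OF elim(1), of "norm Z"] by simp
          then show "norm ((D s - D t) Y) \<le> L * \<bar>s - t\<bar> * norm Y" "norm ((D s - D t) v) \<le> L * \<bar>s - t\<bar> * norm v" by auto
          show "norm (D s v) \<le> M * norm v" "norm (D t Y) \<le> M * norm Y"
            using norm_blinfun[of "D s" v] norm_blinfun[of "D t" Y] nD mult_right_mono[of _ M] norm_ge_zero order_trans by metis+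
        qed (use L M in auto)
        also have "\<dots> = (2 * L * M * \<bar>s - t\<bar> * norm Y) * norm v" by simp
        finally have *: "D s v \<bullet> D s v \<le> (2 * L * M * \<bar>s - t\<bar> * norm Y) * norm v" .
        have "(c / 2 * norm v)\<^sup>2 \<le> (norm (D s v))\<^sup>2" using lower below(1) by (intro power_mono) auto
        then have "(c\<^sup>2 / 4 * norm v) * norm v \<le> (2 * L * M * \<bar>s - t\<bar> * norm Y) * norm v"
          using * by (simp add: power2_norm_eq_inner power_mult_distrib power_divide) (simp add: power2_eq_square)
        then have "c\<^sup>2 / 4 * norm v \<le> 2 * L * M * \<bar>s - t\<bar> * norm Y"
        proof (cases "v = 0")
          case True then show ?thesis using L M by simp
        qed (simp add: mult_le_cancel_right)
        also have "\<dots> \<le> 2 * L * M * \<bar>s - t\<bar> * (norm (P t) * norm X)"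
          unfolding Y_def using L M by (intro mult_left_mono norm_blinfun) auto
        finally show ?thesis using below(1) by (simp add: v_def k_def field_simps)
      qed
      have Dw: "norm (D s o\<^sub>L w s) \<le> M * k * \<bar>s - t\<bar>"
      proof (rule norm_blinfun_bound)
        fix X
        have "norm (D s (w s X)) \<le> M * (k * \<bar>s - t\<bar> * norm X)"
          using norm_blinfun[of "D s" "w s X"] mult_mono[OF nD(1) wb[of X]] M by simp
        then show "norm ((D s o\<^sub>L w s) X) \<le> M * k * \<bar>s - t\<bar> * norm X" by (simp add: ac_simps)
      qed (use M k in simp)
      show ?case
      proof (intro norm_blinfun_bound)
        fix X Y
        have "\<bar>D s (w s X) \<bullet> D s (w s Y)\<bar> \<le> norm ((D s o\<^sub>L w s) X) * norm ((D s o\<^sub>L w s) Y)"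
          using Cauchy_Schwarz_ineq2 by simp
        also have "\<dots> \<le> (M * k * \<bar>s - t\<bar> * norm X) * (M * k * \<bar>s - t\<bar> * norm Y)"
          by (intro mult_mono order_trans[OF norm_blinfun] mult_right_mono Dw mult_nonneg_nonneg k)
            (use M in auto)
        also have "\<dots> = (M * k)\<^sup>2 * \<bar>s - t\<bar>\<^sup>2 * norm X * norm Y" by (simp only: power2_eq_square ac_simps)
        finally show "norm (pullback_inner (D s o\<^sub>L w s) (D s o\<^sub>L w s) X Y) \<le> (M * k)\<^sup>2 * \<bar>s - t\<bar>\<^sup>2 * norm X * norm Y"
          by (simp add: pullback_inner_apply)
      qed auto
    qed
    define K where "K = (M * k)\<^sup>2"
    have "((\<lambda>s. pullback_inner (D s o\<^sub>L w s) (D s o\<^sub>L w s) /\<^sub>R norm (s - t)) \<longlongrightarrow> 0) (at t within I)"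
    proof (rule Lim_null_comparison)
      show "\<forall>\<^sub>F s in at t within I. norm (pullback_inner (D s o\<^sub>L w s) (D s o\<^sub>L w s) /\<^sub>R norm (s - t)) \<le> K * \<bar>s - t\<bar>"
        using bound
      proof eventually_elim
        case (elim s)
        have "norm (pullback_inner (D s o\<^sub>L w s) (D s o\<^sub>L w s) /\<^sub>R norm (s - t)) \<le> inverse \<bar>s - t\<bar> * (K * \<bar>s - t\<bar>\<^sup>2)"
          using elim unfolding K_def norm_scaleR by (simp add: mult_left_mono)
        also have "\<dots> = K * \<bar>s - t\<bar>" by (cases "s = t") (auto simp: power2_eq_square field_simps)
        finally show ?case .
      qed
      have "((\<lambda>s. K * \<bar>s - t\<bar>) \<longlongrightarrow> K * \<bar>t - t\<bar>) (at t within I)" by (intro tendsto_intros)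
      then show "((\<lambda>s. K * \<bar>s - t\<bar>) \<longlongrightarrow> 0) (at t within I)" by simp
    qed
    then show ?thesis by (simp add: has_vector_derivative_def has_derivative_at_within wt pb.zero_left)
  qed
  have "((\<lambda>s. pullback_inner (D s o\<^sub>L P t) (D s o\<^sub>L P t) - pullback_inner (D s o\<^sub>L w s) (D s o\<^sub>L w s)) has_vector_derivative
      pullback_inner (D' o\<^sub>L P t) (D t o\<^sub>L P t) + pullback_inner (D t o\<^sub>L P t) (D' o\<^sub>L P t)) (at t within I)"
    using has_vector_derivative_diff[OF main err] by simp
  then show ?thesis
  proof (rule has_vector_derivative_transform[OF t, rotated])
    fix s assume s: "s \<in> I"
    show "pullback_inner (D s o\<^sub>L P s) (D s o\<^sub>L P s) =
        pullback_inner (D s o\<^sub>L P t) (D s o\<^sub>L P t) - pullback_inner (D s o\<^sub>L w s) (D s o\<^sub>L w s)"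
      by (intro blinfun_eqI) (simp add: pullback_inner_apply blinfun.bilinear_simps split[OF s])
  qed
qed

section \<open>The Weingarten formula\<close>

lemma tower_has_derivative_chart:
  assumes A: "hilbert_manifold A" "\<kappa> \<in> A" and D: "derivative_tower (snd \<kappa> ` fst \<kappa>) D" and w: "w \<in> fst \<kappa>"
  shows "(D vs has_derivative (\<lambda>v. D (v # vs) (snd \<kappa> w))) (at (snd \<kappa> w))"
proof -
  have "open (snd \<kappa> ` fst \<kappa>)" using A by (auto simp: hilbert_manifold_def)
  then show ?thesis
    using tower_has_derivative[OF D, of "snd \<kappa> w" vs] w at_within_open[of "snd \<kappa> w" "snd \<kappa> ` fst \<kappa>"] by simp
qed

lemma tmap_tower:
  assumes A: "hilbert_manifold A" "\<kappa> \<in> A"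
    and f: "derivative_tower (snd \<kappa> ` fst \<kappa>) D" "\<And>w. w \<in> fst \<kappa> \<Longrightarrow> D [] (snd \<kappa> w) = f w" and w: "w \<in> fst \<kappa>"
  shows "tmap \<kappa> f w = (\<lambda>Z. D [Z] (snd \<kappa> w))"
proof (rule tmap_eq)
  have op: "open (snd \<kappa> ` fst \<kappa>)" using A by (auto simp: hilbert_manifold_def)
  show "(f \<circ> chart_inv \<kappa> has_derivative (\<lambda>Z. D [Z] (snd \<kappa> w))) (at (snd \<kappa> w))"
    by (rule has_derivative_transform_within_open[OF tower_has_derivative_chart[OF A f(1) w] op])
      (use w in \<open>auto simp: f(2) chart_inv_snd[OF A]\<close>)
qed

text \<open>
  Differentiate \<open>\<nu> w \<bullet> D [Z] w = 0\<close> in the direction \<open>X\<close>.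
\<close>

lemma normal_field_derivative:
  fixes f :: "'m::t2_space \<Rightarrow> 'v::real_inner" and A :: "('m, 'e::{real_inner, complete_space}) chart set"
  assumes A: "hilbert_manifold A" "\<kappa> \<in> A" and W: "open W" "u \<in> fst \<kappa>" "u \<in> W"
    and f: "derivative_tower (snd \<kappa> ` fst \<kappa>) D" "\<And>w. w \<in> fst \<kappa> \<Longrightarrow> D [] (snd \<kappa> w) = f w"
    and \<nu>: "smooth_map_on W A vector_atlas \<nu>" "\<And>w. w \<in> W \<Longrightarrow> \<nu> w \<in> normal_space_at A f w"
  shows "tmap \<kappa> \<nu> u X \<bullet> D [Z] (snd \<kappa> u) = - (\<nu> u \<bullet> D [X, Z] (snd \<kappa> u))"
proof -
  note D = tower_has_derivative_chart[OF A f(1)]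
  note tm = tmap_tower[OF A f]
  have zero: "\<nu> w \<bullet> D [Z] (snd \<kappa> w) = 0" if "w \<in> fst \<kappa> \<inter> W" for w
  proof -
    have "tmap \<kappa> f w Z \<in> tangent_image A f w" unfolding tangent_image_def using that A(2) by blast
    then have "tmap \<kappa> f w Z \<bullet> \<nu> w = 0"
      using \<nu>(2)[of w] that by (simp add: normal_space_at_def orthogonal_comp_def orthogonal_def)
    then show ?thesis using tm[of w] that by (simp add: inner_commute)
  qed
  have "((\<lambda>x. (\<nu> \<circ> chart_inv \<kappa>) x \<bullet> D [Z] x) has_derivative
      (\<lambda>X. (\<nu> \<circ> chart_inv \<kappa>) (snd \<kappa> u) \<bullet> D [X, Z] (snd \<kappa> u) + tmap \<kappa> \<nu> u X \<bullet> D [Z] (snd \<kappa> u))) (at (snd \<kappa> u))"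
    by (rule has_derivative_inner[OF tmap_has_derivative[OF A W \<nu>(1)] D[OF W(2)]])
  moreover have "((\<lambda>x. (\<nu> \<circ> chart_inv \<kappa>) x \<bullet> D [Z] x) has_derivative (\<lambda>X. 0)) (at (snd \<kappa> u))"
    by (rule has_derivative_transform_within_open[OF has_derivative_const chart_image_open[OF A W(1)]])
      (use W zero in \<open>auto simp: chart_inv_snd[OF A]\<close>)
  ultimately have "(\<lambda>X. (\<nu> \<circ> chart_inv \<kappa>) (snd \<kappa> u) \<bullet> D [X, Z] (snd \<kappa> u) + tmap \<kappa> \<nu> u X \<bullet> D [Z] (snd \<kappa> u)) = (\<lambda>X. 0)"
    by (rule has_derivative_unique)
  from fun_cong[OF this, of X] show "tmap \<kappa> \<nu> u X \<bullet> D [Z] (snd \<kappa> u) = - (\<nu> u \<bullet> D [X, Z] (snd \<kappa> u))"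
    by (simp add: chart_inv_snd[OF A W(2)])
qed

text \<open>
  By the Weingarten formula the tangential part of the derivative of a normal field depends only on its
  value at \<open>u\<close>, so that the shape operator is well defined as soon as one smooth normal extension \<open>\<nu>\<close>
  exists.
\<close>

lemma second_fundamental_form_eq:
  fixes f :: "'m::t2_space \<Rightarrow> 'v::{real_inner, complete_space}"
    and A :: "('m, 'e::{real_inner, complete_space}) chart set"
  assumes A: "hilbert_manifold A" "\<kappa> \<in> A" and imm: "immersion A f" and W: "open W" "u \<in> fst \<kappa>" "u \<in> W"
    and f: "derivative_tower (snd \<kappa> ` fst \<kappa>) D" "\<And>w. w \<in> fst \<kappa> \<Longrightarrow> D [] (snd \<kappa> w) = f w"
    and \<nu>: "smooth_map_on W A vector_atlas \<nu>" "\<And>w. w \<in> W \<Longrightarrow> \<nu> w \<in> normal_space_at A f w"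
  shows "second_fundamental_form A \<kappa> f u (\<nu> u) X Y = \<nu> u \<bullet> D [X, Y] (snd \<kappa> u)"
proof -
  have sm: "smooth_map_on UNIV A vector_atlas f" using imm by (simp add: immersion_def)
  have cl: "closed (range (tmap \<kappa> f u))" and inj: "inj (tmap \<kappa> f u)"
    using imm A(2) W(2) by (auto simp: immersion_def)
  have tm: "tmap \<kappa> f u Z = D [Z] (snd \<kappa> u)" for Z by (simp add: tmap_tower[OF A f W(2)])
  have lin: "linear (tmap \<kappa> f u)"
    by (rule has_derivative_linear[OF tmap_has_derivative[OF A open_UNIV W(2) UNIV_I sm]])
  have N: "normal_space_at A f u = orthogonal_comp (range (tmap \<kappa> f u))"
    using tangent_image_eq_range[OF A W(2) sm] by (simp add: normal_space_at_def)
  have char: "tmap \<kappa> f u Y' \<bullet> tmap \<kappa> f u Z = \<nu> u \<bullet> D [X, Z] (snd \<kappa> u)"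
    if "open W'" "u \<in> W'" "smooth_map_on W' A vector_atlas \<nu>'" "\<forall>w\<in>W'. \<nu>' w \<in> normal_space_at A f w"
      "\<nu>' u = \<nu> u" "- tmap \<kappa> \<nu>' u X - tmap \<kappa> f u Y' \<in> normal_space_at A f u" for W' \<nu>' Y' Z
  proof -
    have "tmap \<kappa> f u Z \<bullet> (- tmap \<kappa> \<nu>' u X - tmap \<kappa> f u Y') = 0"
      using that(6) unfolding N orthogonal_comp_def orthogonal_def by blast
    then have "tmap \<kappa> f u Y' \<bullet> tmap \<kappa> f u Z = - (tmap \<kappa> \<nu>' u X \<bullet> tmap \<kappa> f u Z)"
      by (simp add: inner_diff_right inner_commute)
    also have "\<dots> = \<nu> u \<bullet> D [X, Z] (snd \<kappa> u)"
      using normal_field_derivative[OF A that(1) W(2) that(2) f that(3), of X Z] that(4,5) by (simp add: tm)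
    finally show ?thesis .
  qed
  let ?P = "\<lambda>Y. \<exists>W' \<nu>'. open W' \<and> u \<in> W' \<and> smooth_map_on W' A vector_atlas \<nu>' \<and>
      (\<forall>w\<in>W'. \<nu>' w \<in> normal_space_at A f w) \<and> \<nu>' u = \<nu> u \<and>
      - tmap \<kappa> \<nu>' u X - tmap \<kappa> f u Y \<in> normal_space_at A f u"
  have P: "tmap \<kappa> f u Y' \<bullet> tmap \<kappa> f u Z = \<nu> u \<bullet> D [X, Z] (snd \<kappa> u)" if "?P Y'" for Y' Z
    using that char by blast
  have "subspace (range (tmap \<kappa> f u))" using lin linear_subspace_image subspace_UNIV by blast
  from orthogonal_projection_exists[OF cl this, of "- tmap \<kappa> \<nu> u X"]
  obtain Y0 where "- tmap \<kappa> \<nu> u X - tmap \<kappa> f u Y0 \<in> normal_space_at A f u" unfolding N by blast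
  then have Y0: "?P Y0" using W(1,3) \<nu> by blast
  have "shape_operator A \<kappa> f u (\<nu> u) X = Y0"
    unfolding shape_operator_def
  proof (rule the_equality)
    show "?P Y0" by (rule Y0)
    fix Y' assume Y': "?P Y'"
    let ?d = "Y' - Y0"
    have "tmap \<kappa> f u ?d \<bullet> tmap \<kappa> f u ?d = tmap \<kappa> f u Y' \<bullet> tmap \<kappa> f u ?d - tmap \<kappa> f u Y0 \<bullet> tmap \<kappa> f u ?d"
      by (simp add: linear_diff[OF lin] inner_diff_left)
    also have "\<dots> = 0" using P[OF Y', of ?d] P[OF Y0, of ?d] by simp
    finally show "Y' = Y0" using inj by (simp add: linear_diff[OF lin] inj_eq)
  qed
  then show ?thesis using P[OF Y0, of Y] by (simp add: second_fundamental_form_def induced_metric_def)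
qed

section \<open>The horizontal projection\<close>

text \<open>
  The space \<open>W\<close> is the vertical space. The hypothesis on \<open>\<D>\<close> makes the horizontal space
  its orthogonal complement for the induced metric.
\<close>

lemma horizontal_projection_properties:
  fixes f :: "'m \<Rightarrow> 'v::{real_inner, complete_space}" and \<kappa> :: "('m, 'e::{real_inner, complete_space}) chart"
  assumes lin: "bounded_linear (tmap \<kappa> f u)" and below: "c > 0" "\<And>X. c * norm X \<le> norm (tmap \<kappa> f u X)"
    and W: "subspace W" "closed (tmap \<kappa> f u ` W)" and hor: "\<D> (f u) = orthogonal_comp (tmap \<kappa> f u ` W)"
  shows "X - horizontal_projection \<kappa> f \<D> u X \<in> W"
    "w \<in> W \<Longrightarrow> tmap \<kappa> f u (horizontal_projection \<kappa> f \<D> u X) \<bullet> tmap \<kappa> f u w = 0"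
    "bounded_linear (horizontal_projection \<kappa> f \<D> u)"
proof -
  let ?D = "tmap \<kappa> f u" and ?H = "horizontal_space \<kappa> f \<D> u" and ?P = "horizontal_projection \<kappa> f \<D> u"
  interpret D: bounded_linear ?D by (rule lin)
  have H: "Z \<in> ?H \<longleftrightarrow> (\<forall>w\<in>W. ?D Z \<bullet> ?D w = 0)" for Z
    by (auto simp: horizontal_space_def hor orthogonal_comp_def orthogonal_def inner_commute)
  have zero: "Z = 0" if "?D Z \<bullet> ?D Z = 0" for Z
  proof -
    have "c * norm Z \<le> 0" using below(2)[of Z] that by simp
    then show ?thesis using below(1) by (simp add: mult_le_0_iff)
  qed
  have uniq: "?P X = Z" if Z: "X - Z \<in> W" "Z \<in> ?H" for X Z
    unfolding horizontal_projection_def induced_metric_def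
  proof (rule the_equality)
    show "Z \<in> ?H \<and> (\<forall>Y\<in>?H. ?D (X - Z) \<bullet> ?D Y = 0)" using Z H by (auto simp: inner_commute)
    fix Z' assume Z': "Z' \<in> ?H \<and> (\<forall>Y\<in>?H. ?D (X - Z') \<bullet> ?D Y = 0)"
    have d: "Z - Z' \<in> ?H" using Z(2) Z' unfolding H by (simp add: D.diff inner_diff_left)
    have "?D (X - Z') \<bullet> ?D (Z - Z') = 0" using Z' d by blast
    moreover have "?D (X - Z) \<bullet> ?D (Z - Z') = 0" using d Z(1) unfolding H by (simp add: inner_commute)
    ultimately have "(?D (X - Z') - ?D (X - Z)) \<bullet> ?D (Z - Z') = 0" by (simp only: inner_diff_left)
    moreover have "?D (X - Z') - ?D (X - Z) = ?D (Z - Z')" by (simp add: D.diff)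
    ultimately have "Z - Z' = 0" using zero by metis
    then show "Z' = Z" by simp
  qed
  have ex: "\<exists>Z. X - Z \<in> W \<and> Z \<in> ?H" for X
  proof -
    have "subspace (?D ` W)" using D.linear_axioms W(1) linear_subspace_image by blast
    then obtain r where r: "r \<in> ?D ` W" "?D X - r \<in> orthogonal_comp (?D ` W)"
      using orthogonal_projection_exists[OF W(2), of "?D X"] by blast
    then obtain w where w: "w \<in> W" "r = ?D w" by blast
    have "X - w \<in> ?H" using r(2) w(2) by (simp add: horizontal_space_def hor D.diff)
    then show ?thesis using w(1) by (intro exI[of _ "X - w"]) simp
  qed
  have P: "X - ?P X \<in> W" "?P X \<in> ?H" for X using ex[of X] uniq by auto
  show "X - ?P X \<in> W" by (rule P)
  show "?D (?P X) \<bullet> ?D w = 0" if "w \<in> W" for w using P(2) that by (simp add: H)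
  show "bounded_linear ?P"
  proof -
    obtain K where K: "\<And>X. norm (?D X) \<le> norm X * K" using D.bounded by blast
    show ?thesis
    proof (rule bounded_linear_intro[where K = "K / c"])
      show "?P (X + Y) = ?P X + ?P Y" for X Y
      proof (rule uniq)
        have "(X - ?P X) + (Y - ?P Y) \<in> W" using P(1) W(1) by (intro subspace_add)
        then show "X + Y - (?P X + ?P Y) \<in> W" by (simp add: algebra_simps)
        show "?P X + ?P Y \<in> ?H" using P(2)[of X] P(2)[of Y] unfolding H by (simp add: D.add inner_add_left)
      qed
      show "?P (r *\<^sub>R X) = r *\<^sub>R ?P X" for r X
      proof (rule uniq)
        have "r *\<^sub>R (X - ?P X) \<in> W" using P(1) W(1) by (intro subspace_scale)
        then show "r *\<^sub>R X - r *\<^sub>R ?P X \<in> W" by (simp add: algebra_simps)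
        show "r *\<^sub>R ?P X \<in> ?H" using P(2)[of X] unfolding H by (simp add: D.scaleR)
      qed
      show "norm (?P X) \<le> norm X * (K / c)" for X
      proof -
        have orth: "?D (?P X) \<bullet> ?D (X - ?P X) = 0" using P(1)[of X] P(2)[of X] unfolding H by blast
        have "(norm (?D (?P X)))\<^sup>2 = ?D (?P X) \<bullet> ?D X"
          using orth by (simp add: D.diff inner_diff_right power2_norm_eq_inner)
        also have "\<dots> \<le> norm (?D (?P X)) * norm (?D X)" by (rule norm_cauchy_schwarz)
        finally have "norm (?D (?P X)) * norm (?D (?P X)) \<le> norm (?D (?P X)) * norm (?D X)"
          by (simp add: power2_eq_square)
        moreover have "b \<le> a" if "b * b \<le> b * a" "0 \<le> b" "0 \<le> a" for a b :: real
          using that by (cases "b = 0") auto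
        ultimately have "norm (?D (?P X)) \<le> norm (?D X)" by (meson norm_ge_zero)
        then have "c * norm (?P X) \<le> norm X * K" using below(2)[of "?P X"] K[of X] by linarith
        then show ?thesis using below(1) by (simp add: field_simps)
      qed
    qed
  qed
qed

section \<open>Derivatives in space and time\<close>

lemma flow_tower:
  fixes F :: "'m::t2_space \<Rightarrow> real \<Rightarrow> 'v::real_inner" and A :: "('m, 'e::{real_inner, complete_space}) chart set"
  assumes A: "hilbert_manifold A" "\<kappa> \<in> A"
    and F: "smooth_map_on (UNIV \<times> I) (prod_atlas A vector_atlas) vector_atlas (\<lambda>(u, t). F u t)"
  obtains D where "derivative_tower (snd \<kappa> ` fst \<kappa> \<times> I) D"
    "\<And>w t. w \<in> fst \<kappa> \<Longrightarrow> t \<in> I \<Longrightarrow> D [] (snd \<kappa> w, t) = F w t"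
proof -
  have ids: "(UNIV, id) \<in> vector_atlas" "inj_on (snd (UNIV, id)) (fst (UNIV, id))" by (auto simp: vector_atlas_def)
  show ?thesis
  proof (rule smooth_map_prodD[OF A ids(1) ids(1) ids(2) F])
    fix D
    assume D: "derivative_tower ((\<lambda>(x, y). (snd \<kappa> x, snd (UNIV, id) y)) `
        {p \<in> fst \<kappa> \<times> fst (UNIV, id) \<inter> UNIV \<times> I. (case p of (u, t) \<Rightarrow> F u t) \<in> fst (UNIV, id)}) D"
      "\<And>w t. w \<in> fst \<kappa> \<Longrightarrow> t \<in> fst (UNIV, id) \<Longrightarrow> (w, t) \<in> UNIV \<times> I \<Longrightarrow>
        (case (w, t) of (u, t) \<Rightarrow> F u t) \<in> fst (UNIV, id) \<Longrightarrow>
        D [] (snd \<kappa> w, snd (UNIV, id) t) = snd (UNIV, id) (case (w, t) of (u, t) \<Rightarrow> F u t)"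
    have eq: "(\<lambda>(x, y). (snd \<kappa> x, snd (UNIV, id) y)) `
        {p \<in> fst \<kappa> \<times> fst (UNIV, id) \<inter> UNIV \<times> I. (case p of (u, t) \<Rightarrow> F u t) \<in> fst (UNIV, id)}
        = snd \<kappa> ` fst \<kappa> \<times> I"
      by (auto simp: image_iff)
    show ?thesis
    proof (rule that)
      show "derivative_tower (snd \<kappa> ` fst \<kappa> \<times> I) D" using D(1) unfolding eq .
      show "D [] (snd \<kappa> w, t) = F w t" if "w \<in> fst \<kappa>" "t \<in> I" for w t
        using D(2)[OF that(1), of t] that(2) by simp
    qed
  qed
qed

lemma tower_time_derivative:
  fixes I :: "real set"
  assumes D: "derivative_tower (U \<times> I) D" and x: "x \<in> U" "t \<in> I"
  shows "((\<lambda>s. D vs (x, s)) has_vector_derivative D ((0, 1) # vs) (x, t)) (at t within I)"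
proof -
  have "((\<lambda>s. (x, s)) has_derivative (\<lambda>r. (0, r))) (at t within I)"
    by (auto intro!: derivative_eq_intros)
  moreover have "(D vs has_derivative (\<lambda>v. D (v # vs) (x, t))) (at (x, t) within (\<lambda>s. (x, s)) ` I)"
    by (rule has_derivative_subset[OF tower_has_derivative[OF D]]) (use x in auto)
  ultimately have "((\<lambda>s. D vs (x, s)) has_derivative (\<lambda>r. D ((0, r) # vs) (x, t))) (at t within I)"
    by (rule has_derivative_in_compose)
  moreover have eq: "(\<lambda>r. D ((0, r) # vs) (x, t)) = (\<lambda>r. r *\<^sub>R D ((0, 1) # vs) (x, t))"
  proof
    fix r
    have "D ((r *\<^sub>R (0, 1)) # vs) (x, t) = r *\<^sub>R D ((0, 1) # vs) (x, t)"
      by (rule linear_scale[OF tower_linear[OF D]]) (use x in auto)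
    then show "D ((0, r) # vs) (x, t) = r *\<^sub>R D ((0, 1) # vs) (x, t)" by simp
  qed
  ultimately show ?thesis unfolding has_vector_derivative_def by (simp only:)
qed

text \<open>
  The derivative of the differential of \<open>f\<^sub>t\<close> is taken in operator norm. By symmetry it is the
  differential of the velocity field.
\<close>

lemma tower_operator_time_derivative:
  fixes I :: "real set"
  assumes D: "derivative_tower (U \<times> I) D" and x: "x \<in> U" "t \<in> I"
    and sym: "\<And>v. D [(v, 0), (0, 1)] (x, t) = D [(0, 1), (v, 0)] (x, t)"
  shows "((\<lambda>s. Blinfun (\<lambda>v. D [(v, 0)] (x, s))) has_vector_derivative Blinfun (\<lambda>v. D [(v, 0), (0, 1)] (x, t)))
      (at t within I)"
proof -
  have bl: "bounded_linear (\<lambda>v. D ((v, 0) # vs) (x, s))" if "s \<in> I" for vs s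
    using bounded_linear_compose[OF tower_bounded_linear[OF D, of "(x, s)" vs] bounded_linear_Pair[OF bounded_linear_ident bounded_linear_zero]]
      that x by simp
  have ap: "blinfun_apply (Blinfun (\<lambda>v. D ((v, 0) # vs) (x, s))) = (\<lambda>v. D ((v, 0) # vs) (x, s))" if "s \<in> I" for vs s
    by (rule bounded_linear_Blinfun_apply[OF bl[OF that]])
  show ?thesis
    unfolding has_vector_derivative_def has_derivative_within_alt
  proof (intro conjI allI impI)
    fix e :: real assume "e > 0"
    obtain r where r: "r > 0" "\<And>y vs. y \<in> U \<times> I \<Longrightarrow> norm (y - (x, t)) < r \<Longrightarrow> length vs = 1 \<Longrightarrow>
        norm (D vs y - D vs (x, t) - D ((y - (x, t)) # vs) (x, t)) \<le> e * norm (y - (x, t)) * (\<Prod>v\<leftarrow>vs. norm v)"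
      by (rule tower_expansion[OF D _ \<open>e > 0\<close>, of "(x, t)" 1]) (use x in auto)
    show "\<exists>d>0. \<forall>s\<in>I. norm (s - t) < d \<longrightarrow>
        norm (Blinfun (\<lambda>v. D [(v, 0)] (x, s)) - Blinfun (\<lambda>v. D [(v, 0)] (x, t)) - (s - t) *\<^sub>R Blinfun (\<lambda>v. D [(v, 0), (0, 1)] (x, t)))
          \<le> e * norm (s - t)"
    proof (intro exI[of _ r] conjI ballI impI r(1))
      fix s assume s: "s \<in> I" "norm (s - t) < r"
      show "norm (Blinfun (\<lambda>v. D [(v, 0)] (x, s)) - Blinfun (\<lambda>v. D [(v, 0)] (x, t)) - (s - t) *\<^sub>R Blinfun (\<lambda>v. D [(v, 0), (0, 1)] (x, t)))
          \<le> e * norm (s - t)"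
      proof (rule norm_blinfun_bound)
        fix v
        have "D [(s - t) *\<^sub>R (0, 1), (v, 0)] (x, t) = (s - t) *\<^sub>R D [(0, 1), (v, 0)] (x, t)"
          by (rule linear_scale[OF tower_linear[OF D]]) (use x in auto)
        then show "norm ((Blinfun (\<lambda>v. D [(v, 0)] (x, s)) - Blinfun (\<lambda>v. D [(v, 0)] (x, t)) - (s - t) *\<^sub>R Blinfun (\<lambda>v. D [(v, 0), (0, 1)] (x, t))) v)
            \<le> e * norm (s - t) * norm v"
          using r(2)[of "(x, s)" "[(v, 0)]"] s x
          unfolding blinfun.diff_left blinfun.scaleR_left ap[OF s(1)] ap[OF x(2)]
          by (simp add: norm_Pair sym)
      qed (use \<open>e > 0\<close> in auto)
    qed
  qed (intro bounded_linear_intros)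
qed

text \<open>
  Both vectors \<open>i\<close> and \<open>j\<close> point weakly forward in time, so the parallelograms spanned by small
  multiples stay in the domain even at \<open>t = 0\<close>.
\<close>

lemma tower_symmetric_space_time:
  fixes I :: "real set"
  assumes D: "derivative_tower (U \<times> I) D" and U: "open U" and x: "x \<in> U" "t \<in> I"
    and I: "r > 0" "{t..t + r} \<subseteq> I" and ij: "snd i \<ge> 0" "snd i + snd j \<le> 1" "snd j \<ge> 0"
  shows "D [i, j] (x, t) = D [j, i] (x, t)"
proof -
  obtain q where q: "q > 0" "ball x q \<subseteq> U" using U x(1) open_contains_ball by blast
  define M where "M = norm (fst i) + norm (fst j) + 1"
  have M: "M > 0" by (simp add: M_def add_nonneg_pos)
  show ?thesis
  proof (rule tower_symmetric[OF D, of _ "min (r / 2) (q / (2 * M))"])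
    show "(x, t) \<in> U \<times> I" using x by simp
    show "min (r / 2) (q / (2 * M)) > 0" using q(1) I(1) M by simp
    fix a b assume ab: "0 \<le> a" "a \<le> min (r / 2) (q / (2 * M))" "0 \<le> b" "b \<le> min (r / 2) (q / (2 * M))"
    have "norm (a *\<^sub>R fst i + b *\<^sub>R fst j) \<le> a * norm (fst i) + b * norm (fst j)"
      using norm_triangle_ineq[of "a *\<^sub>R fst i" "b *\<^sub>R fst j"] ab by simp
    also have "\<dots> \<le> q / (2 * M) * norm (fst i) + q / (2 * M) * norm (fst j)"
      using ab by (intro add_mono mult_right_mono) auto
    also have "\<dots> = q / (2 * M) * (norm (fst i) + norm (fst j))" by (simp only: distrib_left)
    also have "\<dots> \<le> q / (2 * M) * M" using q(1) M by (intro mult_left_mono) (auto simp: M_def)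
    also have "\<dots> < q" using q(1) M by simp
    finally have "norm (a *\<^sub>R fst i + b *\<^sub>R fst j) < q" .
    moreover have "dist x (x + z) = norm z" for z by (simp add: dist_norm)
    ultimately have in_ball: "x + (a *\<^sub>R fst i + b *\<^sub>R fst j) \<in> ball x q" by simp
    have "a * snd i + b * snd j \<le> r / 2 * snd i + r / 2 * snd j"
      using ab ij by (intro add_mono mult_right_mono) auto
    also have "\<dots> = r / 2 * (snd i + snd j)" by (simp only: distrib_left)
    also have "\<dots> \<le> r / 2 * 1" using ij I(1) by (intro mult_left_mono) auto
    finally have "t + (a * snd i + b * snd j) \<in> {t..t + r}" using ab ij I(1) by auto
    with in_ball show "(x, t) + a *\<^sub>R i + b *\<^sub>R j \<in> U \<times> I"
      using q(2) I(2) by (cases i; cases j) (auto simp: add.assoc)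
  qed
qed

section \<open>Vertical directions of the flow\<close>

text \<open>
  The partial derivative of the action in the direction of the group, in coordinates.
\<close>

lemma orbit_directions:
  fixes \<sigma> :: "'g::t2_space \<Rightarrow> 'm::t2_space \<Rightarrow> 'm"
    and AG :: "('g, 'l::{real_inner, complete_space}) chart set"
    and A :: "('m, 'e::{real_inner, complete_space}) chart set"
  assumes G: "hilbert_manifold AG" and A: "hilbert_manifold A" and act: "smooth_action G AG A \<sigma>"
    and \<nu>: "\<nu> \<in> AG" "\<one>\<^bsub>G\<^esub> \<in> fst \<nu>" and \<kappa>: "\<kappa> \<in> A" "u \<in> fst \<kappa>"
  obtains \<tau> where "((\<lambda>z. snd \<kappa> (\<sigma> (chart_inv \<nu> z) u)) has_derivative \<tau>) (at (snd \<nu> \<one>\<^bsub>G\<^esub>))"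
    "\<forall>\<^sub>F z in nhds (snd \<nu> \<one>\<^bsub>G\<^esub>). \<sigma> (chart_inv \<nu> z) u \<in> fst \<kappa>"
proof -
  have sm: "smooth_map_on UNIV (prod_atlas AG A) A (\<lambda>(a, x). \<sigma> a x)" and ga: "group_action G UNIV \<sigma>"
    using act by (auto simp: smooth_action_def)
  have one: "\<sigma> \<one>\<^bsub>G\<^esub> u = u" by (rule action_one[OF ga])
  have inj: "inj_on (snd \<kappa>) (fst \<kappa>)" using A \<kappa> by (auto simp: hilbert_manifold_def)
  define V where "V = (\<lambda>a. \<sigma> a u) -` fst \<kappa>"
  have "continuous_on UNIV (\<lambda>(a, x). \<sigma> a x)" using sm by (simp add: smooth_map_on_def)
  then have "continuous_on UNIV (\<lambda>a. \<sigma> a u)"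
    using continuous_on_compose2[of UNIV "\<lambda>(a, x). \<sigma> a x" UNIV "\<lambda>a. (a, u)"]
    by (simp add: continuous_on_Pair)
  then have V: "open V" unfolding V_def by (rule open_vimage[OF chart_domain_open[OF A \<kappa>(1)]])
  have oneV: "\<one>\<^bsub>G\<^esub> \<in> V" using one \<kappa> by (simp add: V_def)
  show ?thesis
  proof (rule smooth_map_prodD[OF G \<nu>(1) \<kappa>(1) \<kappa>(1) inj sm])
    fix D
    assume D: "derivative_tower ((\<lambda>(x, y). (snd \<nu> x, snd \<kappa> y)) ` {p \<in> fst \<nu> \<times> fst \<kappa> \<inter> UNIV. (case p of (a, x) \<Rightarrow> \<sigma> a x) \<in> fst \<kappa>}) D"
      "\<And>x y. x \<in> fst \<nu> \<Longrightarrow> y \<in> fst \<kappa> \<Longrightarrow> (x, y) \<in> UNIV \<Longrightarrow> (case (x, y) of (a, x) \<Rightarrow> \<sigma> a x) \<in> fst \<kappa> \<Longrightarrow>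
        D [] (snd \<nu> x, snd \<kappa> y) = snd \<kappa> (case (x, y) of (a, x) \<Rightarrow> \<sigma> a x)"
    have "derivative_tower (snd \<nu> ` (fst \<nu> \<inter> V)) (\<lambda>vs z. D (map (\<lambda>v. (v, 0)) vs @ []) (z, snd \<kappa> u))"
    proof (rule tower_slice[OF D(1)])
      fix y assume "y \<in> snd \<nu> ` (fst \<nu> \<inter> V)"
      then obtain a where "a \<in> fst \<nu>" "\<sigma> a u \<in> fst \<kappa>" "y = snd \<nu> a" by (auto simp: V_def)
      then show "(y, snd \<kappa> u) \<in> (\<lambda>(x, y). (snd \<nu> x, snd \<kappa> y)) ` {p \<in> fst \<nu> \<times> fst \<kappa> \<inter> UNIV. (case p of (a, x) \<Rightarrow> \<sigma> a x) \<in> fst \<kappa>}"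
        using \<kappa> by (intro image_eqI[of _ _ "(a, u)"]) auto
    qed
    from tower_has_derivative[OF this, of "snd \<nu> \<one>\<^bsub>G\<^esub>" "[]"] \<nu> oneV
    have "((\<lambda>z. D [] (z, snd \<kappa> u)) has_derivative (\<lambda>v. D [(v, 0)] (snd \<nu> \<one>\<^bsub>G\<^esub>, snd \<kappa> u)))
        (at (snd \<nu> \<one>\<^bsub>G\<^esub>) within snd \<nu> ` (fst \<nu> \<inter> V))" by simp
    then have *: "((\<lambda>z. D [] (z, snd \<kappa> u)) has_derivative (\<lambda>v. D [(v, 0)] (snd \<nu> \<one>\<^bsub>G\<^esub>, snd \<kappa> u))) (at (snd \<nu> \<one>\<^bsub>G\<^esub>))"
      using at_within_open[OF _ chart_image_open[OF G \<nu>(1) V], of "snd \<nu> \<one>\<^bsub>G\<^esub>"] \<nu> oneV by simp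
    show ?thesis
    proof (rule that)
      show "((\<lambda>z. snd \<kappa> (\<sigma> (chart_inv \<nu> z) u)) has_derivative (\<lambda>v. D [(v, 0)] (snd \<nu> \<one>\<^bsub>G\<^esub>, snd \<kappa> u))) (at (snd \<nu> \<one>\<^bsub>G\<^esub>))"
      proof (rule has_derivative_transform_within_open[OF * chart_image_open[OF G \<nu>(1) V]])
        show "snd \<nu> \<one>\<^bsub>G\<^esub> \<in> snd \<nu> ` (fst \<nu> \<inter> V)" using \<nu> oneV by simp
        fix z assume "z \<in> snd \<nu> ` (fst \<nu> \<inter> V)"
        then obtain a where a: "a \<in> fst \<nu>" "\<sigma> a u \<in> fst \<kappa>" "z = snd \<nu> a" by (auto simp: V_def)
        then show "D [] (z, snd \<kappa> u) = snd \<kappa> (\<sigma> (chart_inv \<nu> z) u)"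
          using D(2)[OF a(1) \<kappa>(2)] by (simp add: chart_inv_snd[OF G \<nu>(1)])
      qed
      show "\<forall>\<^sub>F z in nhds (snd \<nu> \<one>\<^bsub>G\<^esub>). \<sigma> (chart_inv \<nu> z) u \<in> fst \<kappa>"
        using chart_image_nhd[OF G \<nu>(1) V \<nu>(2) oneV] by (rule eventually_mono) (auto simp: V_def)
    qed
  qed
qed

lemma orbit_translate:
  assumes "group G" "carrier G = UNIV" "group_action G UNIV \<sigma>"
  shows "orbit G \<sigma> (\<sigma> a u) = orbit G \<sigma> u"
proof -
  interpret group G by (rule assms)
  have comp: "\<sigma> (a \<otimes>\<^bsub>G\<^esub> b) y = \<sigma> a (\<sigma> b y)" for a b y
    using group_action.composition_rule[OF assms(3)] assms(2) by simp
  have eq: "\<sigma> g u = \<sigma> (g \<otimes>\<^bsub>G\<^esub> inv\<^bsub>G\<^esub> a) (\<sigma> a u)" for g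
  proof -
    have "\<sigma> (g \<otimes>\<^bsub>G\<^esub> inv\<^bsub>G\<^esub> a) (\<sigma> a u) = \<sigma> g (\<sigma> (inv\<^bsub>G\<^esub> a \<otimes>\<^bsub>G\<^esub> a) u)" by (simp only: comp)
    then show ?thesis using action_one[OF assms(3)] assms(2) by (simp add: l_inv)
  qed
  have "orbit G \<sigma> u \<subseteq> orbit G \<sigma> (\<sigma> a u)" unfolding orbit_def assms(2) using eq by blast
  moreover have "orbit G \<sigma> (\<sigma> a u) \<subseteq> orbit G \<sigma> u"
    using assms(2) by (auto simp: orbit_def comp[symmetric])
  ultimately show ?thesis by blast
qed

text \<open>
  The vertical space does not move in time: it is the tangent space \<open>W\<close> of the orbit of \<open>u\<close> under \<open>\<sigma>\<close>.
  As \<open>f\<^sub>t\<close> maps this orbit into an orbit of \<open>\<rho>\<close>, the image of \<open>W\<close> is orthogonal to the horizontal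
  distribution, and at time 0 it is exactly the tangent space of the orbit of \<open>\<rho>\<close>. For later times equality follows
  from a comparison of codimensions: that of the orbits and that of the image of \<open>W\<close> are both
  constant, and they agree at time 0.
\<close>

lemma vertical_directions_of_flow:
  fixes \<rho> :: "'g::t2_space \<Rightarrow> 'v \<Rightarrow> 'v::{real_inner, complete_space}"
    and AG :: "('g, 'l::{real_inner, complete_space}) chart set"
    and A :: "('m::t2_space, 'e::{real_inner, complete_space}) chart set"
    and F :: "'m \<Rightarrow> real \<Rightarrow> 'v"
  assumes G: "hilbert_lie_group G AG" and act: "smooth_action G AG vector_atlas \<rho>"
    and orb: "minimal_orbits G AG \<rho>" and A: "hilbert_manifold A" and actM: "smooth_action G AG A \<sigma>"
    and \<kappa>: "\<kappa> \<in> A" "u \<in> fst \<kappa>" and I: "connected I" "0 \<in> I"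
    and F: "smooth_map_on (UNIV \<times> I) (prod_atlas A vector_atlas) vector_atlas (\<lambda>(u, t). F u t)"
    and imm: "\<And>t. t \<in> I \<Longrightarrow> immersion A (\<lambda>u. F u t)"
    and equivariant: "\<And>a. F (\<sigma> a u) 0 = \<rho> a (F u 0)"
    and orbits: "\<And>a t. t \<in> I \<Longrightarrow> F (\<sigma> a u) t \<in> orbit G \<rho> (F u t)"
  obtains W where "subspace W"
    "\<And>t. t \<in> I \<Longrightarrow> closed (tmap \<kappa> (\<lambda>u. F u t) u ` W)"
    "\<And>t. t \<in> I \<Longrightarrow> horizontal_distribution G AG \<rho> (F u t) = orthogonal_comp (tmap \<kappa> (\<lambda>u. F u t) u ` W)"
proof -
  have man: "hilbert_manifold AG" and ga: "group_action G UNIV \<rho>" and gaM: "group_action G UNIV \<sigma>"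
    using G act actM by (auto simp: hilbert_lie_group_def smooth_action_def)
  then have "\<one>\<^bsub>G\<^esub> \<in> (\<Union>\<kappa>\<in>AG. fst \<kappa>)" by (simp add: hilbert_manifold_def)
  then obtain \<nu> where \<nu>: "\<nu> \<in> AG" "\<one>\<^bsub>G\<^esub> \<in> fst \<nu>" by blast
  define z0 where "z0 = snd \<nu> \<one>\<^bsub>G\<^esub>"
  have inv1: "chart_inv \<nu> z0 = \<one>\<^bsub>G\<^esub>" by (simp add: z0_def chart_inv_snd[OF man \<nu>])
  obtain \<tau> where \<tau>: "((\<lambda>z. snd \<kappa> (\<sigma> (chart_inv \<nu> z) u)) has_derivative \<tau>) (at z0)"
    "\<forall>\<^sub>F z in nhds z0. \<sigma> (chart_inv \<nu> z) u \<in> fst \<kappa>"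
    unfolding z0_def by (rule orbit_directions[OF man A actM \<nu> \<kappa>])
  obtain D where D: "derivative_tower (snd \<kappa> ` fst \<kappa> \<times> I) D"
    "\<And>w t. w \<in> fst \<kappa> \<Longrightarrow> t \<in> I \<Longrightarrow> D [] (snd \<kappa> w, t) = F w t"
    by (rule flow_tower[OF A \<kappa>(1) F]) blast
  define d where "d t = tmap \<kappa> (\<lambda>u. F u t) u" for t
  have sm: "smooth_map_on UNIV A vector_atlas (\<lambda>u. F u t)" if "t \<in> I" for t
    using imm[OF that] by (simp add: immersion_def)
  have dder: "((\<lambda>u. F u t) \<circ> chart_inv \<kappa> has_derivative d t) (at (snd \<kappa> u))" if "t \<in> I" for t
    unfolding d_def by (rule tmap_has_derivative[OF A \<kappa>(1) open_UNIV \<kappa>(2) UNIV_I sm[OF that]])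
  have dbl: "bounded_linear (d t)" if "t \<in> I" for t by (rule has_derivative_bounded_linear[OF dder[OF that]])
  have \<tau>bl: "bounded_linear \<tau>" by (rule has_derivative_bounded_linear[OF \<tau>(1)])
  have dD: "d t v = D [(v, 0)] (snd \<kappa> u, t)" if t: "t \<in> I" for t v
  proof -
    have tw: "derivative_tower (snd \<kappa> ` fst \<kappa>) (\<lambda>vs y. D (map (\<lambda>v. (v, 0)) vs @ []) (y, t))"
      by (rule tower_slice[OF D(1)]) (use t in auto)
    have "tmap \<kappa> (\<lambda>u. F u t) u = (\<lambda>v. D (map (\<lambda>v. (v, 0)) [v] @ []) (snd \<kappa> u, t))"
      by (rule tmap_tower[OF A \<kappa>(1) tw _ \<kappa>(2)]) (use D(2) t in auto)
    then show ?thesis by (simp add: d_def)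
  qed
  have chain: "((\<lambda>z. F (\<sigma> (chart_inv \<nu> z) u) t) has_derivative d t \<circ> \<tau>) (at z0)" if t: "t \<in> I" for t
  proof -
    have s0: "snd \<kappa> (\<sigma> (chart_inv \<nu> z0) u) = snd \<kappa> u" by (simp add: inv1 action_one[OF gaM])
    have "(((\<lambda>u. F u t) \<circ> chart_inv \<kappa>) \<circ> (\<lambda>z. snd \<kappa> (\<sigma> (chart_inv \<nu> z) u)) has_derivative d t \<circ> \<tau>) (at z0)"
      by (rule diff_chain_at[OF \<tau>(1)]) (use dder[OF t] s0 in simp)
    moreover obtain S where S: "open S" "z0 \<in> S" "\<And>z. z \<in> S \<Longrightarrow> \<sigma> (chart_inv \<nu> z) u \<in> fst \<kappa>"
      using \<tau>(2) unfolding eventually_nhds by blast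
    ultimately show ?thesis
      by (elim has_derivative_transform_within_open[OF _ S(1,2)]) (auto simp: chart_inv_snd[OF A \<kappa>(1)] S(3))
  qed
  have below: "\<exists>c>0. \<forall>X. c * norm X \<le> norm (d t X)" if t: "t \<in> I" for t
    using tmap_bounded_below[OF A \<kappa> imm[OF t]] unfolding d_def by blast
  define B where "B = tmap \<nu> (\<lambda>a. \<rho> a (F u 0)) \<one>\<^bsub>G\<^esub>"
  have B: "B = d 0 \<circ> \<tau>"
    unfolding B_def
  proof (rule tmap_eq)
    show "((\<lambda>a. \<rho> a (F u 0)) \<circ> chart_inv \<nu> has_derivative d 0 \<circ> \<tau>) (at (snd \<nu> \<one>\<^bsub>G\<^esub>))"
      using chain[OF I(2)] by (simp add: equivariant z0_def o_def)
  qed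
  obtain b where b: "b > 0" "\<And>z. b * norm z \<le> norm (B z)"
    using tmap_bounded_below[OF man \<nu> orbit_immersion(1)[OF orb, of "F u 0"]] unfolding B_def by blast
  obtain k where k: "k > 0" "\<And>X. norm (d 0 X) \<le> norm X * k"
    using bounded_linear.pos_bounded[OF dbl[OF I(2)]] by blast
  \<comment> \<open>The orbit map of \<open>u\<close> in \<open>M\<close> is an immersion because its composition with \<open>f\<close> is one.\<close>
  have \<tau>below: "b / k * norm z \<le> norm (\<tau> z)" for z
    using b(2)[of z] k(2)[of "\<tau> z"] k(1) by (simp add: B field_simps)
  have bk: "b / k > 0" using b(1) k(1) by simp
  define K where "K t = d t \<circ> \<tau>" for t
  have Kbl: "bounded_linear (K t)" if "t \<in> I" for t
    unfolding K_def o_def by (rule bounded_linear_compose[OF dbl[OF that] \<tau>bl])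
  have Kbelow: "\<exists>c>0. \<forall>z. c * norm z \<le> norm (K t z)" if t: "t \<in> I" for t
  proof -
    obtain c where c: "c > 0" "\<And>X. c * norm X \<le> norm (d t X)" using below[OF t] by blast
    show ?thesis
    proof (intro exI[of _ "c * (b / k)"] conjI allI)
      show "c * (b / k) > 0" using c(1) bk by (rule mult_pos_pos)
      show "c * (b / k) * norm z \<le> norm (K t z)" for z
        using mult_left_mono[OF \<tau>below[of z], of c] c(1) c(2)[of "\<tau> z"] by (simp add: K_def)
    qed
  qed
  obtain N where N: "N > 0" "\<And>z. norm (\<tau> z) \<le> norm z * N" using bounded_linear.pos_bounded[OF \<tau>bl] by blast
  have Kcont: "\<exists>r>0. \<forall>s\<in>I. dist s t < r \<longrightarrow> (\<forall>z. norm (K s z - K t z) \<le> e * norm z)" if t: "t \<in> I" and e: "e > 0" for t e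
  proof -
    have "(snd \<kappa> u, t) \<in> snd \<kappa> ` fst \<kappa> \<times> I" "e / N > 0" using \<kappa> t e N(1) by auto
    from tower_norm_continuous[OF D(1) this] obtain r where r: "r > 0"
      "\<And>y v. y \<in> snd \<kappa> ` fst \<kappa> \<times> I \<Longrightarrow> norm (y - (snd \<kappa> u, t)) < r \<Longrightarrow> norm (D [v] y - D [v] (snd \<kappa> u, t)) \<le> e / N * norm v"
      by blast
    show ?thesis
    proof (intro exI[of _ r] conjI ballI impI allI r(1))
      fix s z assume s: "s \<in> I" "dist s t < r"
      have "norm (K s z - K t z) \<le> e / N * norm (\<tau> z)"
        using r(2)[of "(snd \<kappa> u, s)" "(\<tau> z, 0)"] s \<kappa>(2) by (simp add: K_def dD s t norm_Pair dist_norm)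
      also have "\<dots> \<le> e / N * (norm z * N)" using N e by (intro mult_left_mono) auto
      finally show "norm (K s z - K t z) \<le> e * norm z" using N(1) by (simp add: ac_simps)
    qed
  qed
  have hor0: "horizontal_distribution G AG \<rho> (F u 0) = orthogonal_comp (range (K 0))"
    using horizontal_eq[OF G orb \<nu>, of "F u 0"] B by (simp add: B_def K_def)
  obtain n where n: "fin_dim (horizontal_distribution G AG \<rho> (F u 0)) n"
    by (rule horizontal_fin_dim[OF orb])
  have hor: "horizontal_distribution G AG \<rho> (F u t) = orthogonal_comp (range (K t))" if t: "t \<in> I" for t
  proof (rule fin_dim_subspace_eq)
    show "fin_dim (horizontal_distribution G AG \<rho> (F u t)) n" by (rule horizontal_dim_constant[OF G act orb n])
    show "fin_dim (orthogonal_comp (range (K t))) n"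
      by (rule codim_range_constant[OF I(1) I(2) t Kbl Kbelow Kcont]) (use n hor0 in auto)
    show "horizontal_distribution G AG \<rho> (F u t) \<subseteq> orthogonal_comp (range (K t))"
    proof
      fix m assume m: "m \<in> horizontal_distribution G AG \<rho> (F u t)"
      have "K t z \<bullet> m = 0" for z
      proof (rule velocity_in_orbit[OF G ga orb _ _ _ m])
        let ?c = "\<lambda>s. F (\<sigma> (chart_inv \<nu> (z0 + s *\<^sub>R z)) u) t"
        have "((\<lambda>s. z0 + s *\<^sub>R z) has_derivative (\<lambda>s. s *\<^sub>R z)) (at 0)" by (auto intro!: derivative_eq_intros)
        then have "((\<lambda>z. F (\<sigma> (chart_inv \<nu> z) u) t) \<circ> (\<lambda>s. z0 + s *\<^sub>R z) has_derivative (d t \<circ> \<tau>) \<circ> (\<lambda>s. s *\<^sub>R z)) (at (0::real))"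
          by (rule diff_chain_at) (use chain[OF t] in simp)
        then show "(?c has_vector_derivative K t z) (at 0)"
          using linear_scale[OF bounded_linear.linear[OF Kbl[OF t]]]
          by (simp add: has_vector_derivative_def o_def K_def)
        show "?c 0 = F u t" by (simp add: inv1 action_one[OF gaM])
        show "\<forall>\<^sub>F s in at 0. ?c s \<in> orbit G \<rho> (F u t)" using orbits[OF t] by simp
      qed
      then show "m \<in> orthogonal_comp (range (K t))" by (auto simp: orthogonal_comp_def orthogonal_def)
    qed
  qed
  have img: "d t ` range \<tau> = range (K t)" for t by (auto simp: K_def)
  show ?thesis
  proof (rule that[of "range \<tau>"])
    show "subspace (range \<tau>)" using bounded_linear.linear[OF \<tau>bl] linear_subspace_image subspace_UNIV by blast
    fix t assume t: "t \<in> I"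
    obtain c where "c > 0" "\<And>z. c * norm z \<le> norm (K t z)" using Kbelow[OF t] by blast
    then show "closed (tmap \<kappa> (\<lambda>u. F u t) u ` range \<tau>)"
      using closed_range_if_bounded_below[OF Kbl[OF t]] img[of t] by (simp add: d_def)
    show "horizontal_distribution G AG \<rho> (F u t) = orthogonal_comp (tmap \<kappa> (\<lambda>u. F u t) u ` range \<tau>)"
      using hor[OF t] img[of t] by (simp add: d_def)
  qed
qed

section \<open>The evolution equation\<close>

theorem lemma4p2:
  fixes G :: "'g::t2_space monoid"
    and AG :: "('g, 'l::{real_inner, complete_space}) chart set"
    and \<rho> :: "'g \<Rightarrow> 'v \<Rightarrow> 'v::{real_inner, complete_space, second_countable_topology}"
    and XN :: "'v set topology"
    and N :: "('n::euclidean_space, 'v set) orbichart set"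
    and gN :: "('n, 'v set) orbichart \<Rightarrow> 'n \<Rightarrow> 'n \<Rightarrow> 'n \<Rightarrow> real"
    and A :: "('m::t2_space, 'e::{real_inner, complete_space}) chart set"
    and \<sigma> :: "'g \<Rightarrow> 'm \<Rightarrow> 'm"
    and XM :: "'m set topology"
    and Mbar :: "('k::{real_inner, complete_space}, 'm set) orbichart set"
    and f :: "'m \<Rightarrow> 'v"
    and T :: ereal
    and I :: "real set"
    and Fbar :: "'m set \<Rightarrow> real \<Rightarrow> 'v set"
    and F :: "'m \<Rightarrow> real \<Rightarrow> 'v"
    and H \<xi> :: "'m \<Rightarrow> real \<Rightarrow> 'v"
  defines "hor \<equiv> horizontal_distribution G AG \<rho>"
  assumes infinite_dimensional: "\<nexists>B :: 'v set. finite B \<and> span B = UNIV"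
    and lie_group: "hilbert_lie_group G AG"
    and action: "smooth_action G AG vector_atlas \<rho>" "isometric_action \<rho>" "almost_free G \<rho>"
    and orbits: "minimal_orbits G AG \<rho>"
    and orbit_space: "quotient_map euclidean XN (orbit G \<rho>)" "orbifold XN N"
    and orbimetric: "riemannian_orbimetric N gN" "riemannian_orbisubmersion N gN (orbit G \<rho>)"
    and manifold: "hilbert_manifold A"
    and hypersurface: "hypersurface_immersion A f"
    and invariant: "smooth_action G AG A \<sigma>" "\<And>a u. f (\<sigma> a u) = \<rho> a (f u)"
    and compact_quotient: "compactin XN (range (orbit G \<rho> \<circ> f))"
    and quotient_hypersurface:
      "quotient_map euclidean XM (orbit G \<sigma>)" "orbifold XM Mbar" "orbisubmersion A Mbar (orbit G \<sigma>)"
    and time_interval: "0 < T" "I = {t. 0 \<le> t \<and> ereal t < T}"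
    and quotient_flow:
      "orbifold_mcf Mbar N gN I Fbar" "\<And>u. Fbar (orbit G \<sigma> u) 0 = orbit G \<rho> (f u)"
    and flow: "regularized_mcf A I F" "\<And>t. t \<in> I \<Longrightarrow> hypersurface_immersion A (\<lambda>u. F u t)"
    and initial: "\<And>u. F u 0 = f u"
    and lifted_flow: "\<And>u. horizontal_lift I (orbit G \<rho>) hor (Fbar (orbit G \<sigma> u)) (H u 0) (F u)"
    and mean_curvature:
      "\<And>u t. t \<in> I \<Longrightarrow> regularized_mean_curvature A (\<lambda>u. F u t) u (H u t)"
    and unit_normal:
      "\<And>u t. t \<in> I \<Longrightarrow> \<xi> u t \<in> normal_space_at A (\<lambda>u. F u t) u"
      "\<And>u t. t \<in> I \<Longrightarrow> norm (\<xi> u t) = 1"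
      "\<And>u t. t \<in> I \<Longrightarrow> H u t = norm (H u t) *\<^sub>R \<xi> u t"
  shows "\<forall>\<kappa>\<in>A. \<forall>u\<in>fst \<kappa>. \<forall>t\<in>I.
    ((\<lambda>s. horizontal_part \<kappa> (\<lambda>u. F u s) hor u (induced_metric \<kappa> (\<lambda>u. F u s) u))
      has_vector_derivative
      (- 2 * norm (H u t)) *\<^sub>R horizontal_part \<kappa> (\<lambda>u. F u t) hor u
        (second_fundamental_form A \<kappa> (\<lambda>u. F u t) u (\<xi> u t)))
    (at t within I)"
proof (intro ballI)
  fix \<kappa> u t
  assume \<kappa>: "\<kappa> \<in> A" and u: "u \<in> fst \<kappa>" and t: "t \<in> I"
  have I0: "0 \<in> I" and Icon: "connected I"
  proof -
    show "0 \<in> I" using time_interval by (simp add: zero_ereal_def)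
    show "connected I"
      unfolding connected_iff_interval time_interval(2)
      by (auto intro: le_less_trans[of "ereal _" "ereal _"])
  qed
  have Iopen: "\<exists>r>0. {t..t + r} \<subseteq> I"
  proof -
    obtain q where q: "ereal t < ereal q" "ereal q < T"
      using t time_interval(2) ereal_dense2[of "ereal t" T] by auto
    then have "{t..t + (q - t)} \<subseteq> I"
      using t time_interval(2) by (auto intro: le_less_trans[of "ereal _" "ereal _"])
    with q(1) show ?thesis by (intro exI[of _ "q - t"]) simp
  qed
  have smooth: "smooth_map_on (UNIV \<times> I) (prod_atlas A vector_atlas) vector_atlas (\<lambda>(u, t). F u t)"
    using flow(1) by (simp add: regularized_mcf_def)
  have imm: "immersion A (\<lambda>u. F u s)" if "s \<in> I" for s
    using flow(2)[OF that] by (simp add: hypersurface_immersion_def)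
  have ga: "group_action G UNIV \<rho>" and gaM: "group_action G UNIV \<sigma>"
    using action(1) invariant(1) by (auto simp: smooth_action_def)
  have grp: "group G" "carrier G = UNIV" using lie_group by (auto simp: hilbert_lie_group_def)
  have lift: "orbit G \<rho> (F w s) = Fbar (orbit G \<sigma> w) s" if "s \<in> I" for w s
    using lifted_flow[of w] that by (simp add: horizontal_lift_def)
  \<comment> \<open>Both points lie over the same point of the flow in \<open>V/G\<close>.\<close>
  have same_orbit: "F (\<sigma> a w) s \<in> orbit G \<rho> (F w s)" if "s \<in> I" for a w s
  proof -
    have "orbit G \<rho> (F (\<sigma> a w) s) = orbit G \<rho> (F w s)"
      by (simp add: lift[OF that] orbit_translate[OF grp gaM])
    then show ?thesis using group_action.orbit_refl[OF ga, of "F (\<sigma> a w) s"] by simp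
  qed
  obtain W where W: "subspace W"
    "\<And>s. s \<in> I \<Longrightarrow> closed (tmap \<kappa> (\<lambda>u. F u s) u ` W)"
    "\<And>s. s \<in> I \<Longrightarrow> horizontal_distribution G AG \<rho> (F u s) = orthogonal_comp (tmap \<kappa> (\<lambda>u. F u s) u ` W)"
  proof (rule vertical_directions_of_flow[OF lie_group action(1) orbits manifold invariant(1) \<kappa> u Icon I0 smooth imm])
    show "F (\<sigma> a u) 0 = \<rho> a (F u 0)" for a by (simp add: initial invariant(2))
  qed (use same_orbit in blast)+
  obtain D where D: "derivative_tower (snd \<kappa> ` fst \<kappa> \<times> I) D"
    "\<And>w s. w \<in> fst \<kappa> \<Longrightarrow> s \<in> I \<Longrightarrow> D [] (snd \<kappa> w, s) = F w s"
    by (rule flow_tower[OF manifold \<kappa> smooth]) blast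
  define x where "x = snd \<kappa> u"
  have x: "x \<in> snd \<kappa> ` fst \<kappa>" using u by (simp add: x_def)
  have op: "open (snd \<kappa> ` fst \<kappa>)" using manifold \<kappa> by (auto simp: hilbert_manifold_def)
  define E where "E s = (\<lambda>vs y. D (map (\<lambda>v. (v, 0)) vs) (y, s))" for s
  have E: "derivative_tower (snd \<kappa> ` fst \<kappa>) (E s)" if "s \<in> I" for s
    using tower_slice[OF D(1), of "snd \<kappa> ` fst \<kappa>" s "[]"] that by (simp add: E_def)
  have E0: "E s [] (snd \<kappa> w) = F w s" if "s \<in> I" "w \<in> fst \<kappa>" for s w
    using D(2)[OF that(2,1)] by (simp add: E_def)
  have tm: "tmap \<kappa> (\<lambda>u. F u s) u = (\<lambda>v. D [(v, 0)] (x, s))" if s: "s \<in> I" for s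
    using tmap_tower[OF manifold \<kappa> E[OF s] E0[OF s] u] by (simp add: E_def x_def)
  have tbl: "bounded_linear (tmap \<kappa> (\<lambda>u. F u s) u)" if s: "s \<in> I" for s
    using imm[OF s] by (intro has_derivative_bounded_linear[OF tmap_has_derivative[OF manifold \<kappa> open_UNIV u]])
      (auto simp: immersion_def)
  define P where "P s = Blinfun (horizontal_projection \<kappa> (\<lambda>u. F u s) hor u)" for s
  define d where "d s = Blinfun (\<lambda>v. D [(v, 0)] (x, s))" for s
  have d_ap: "blinfun_apply (d s) = tmap \<kappa> (\<lambda>u. F u s) u" if "s \<in> I" for s
    unfolding d_def tm[OF that, symmetric] by (rule bounded_linear_Blinfun_apply[OF tbl[OF that]])
  have below: "\<exists>c>0. \<forall>X. c * norm X \<le> norm (tmap \<kappa> (\<lambda>u. F u s) u X)" if "s \<in> I" for s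
    using tmap_bounded_below[OF manifold \<kappa> u imm[OF that]] by blast
  have P_ap: "blinfun_apply (P s) = horizontal_projection \<kappa> (\<lambda>u. F u s) hor u"
    and PW: "X - P s X \<in> W" and Porth: "w \<in> W \<Longrightarrow> d s (P s X) \<bullet> d s w = 0" if s: "s \<in> I" for s X w
  proof -
    obtain c where c: "c > 0" "\<And>X. c * norm X \<le> norm (tmap \<kappa> (\<lambda>u. F u s) u X)" using below[OF s] by blast
    have h: "hor (F u s) = orthogonal_comp (tmap \<kappa> (\<lambda>u. F u s) u ` W)" using W(3)[OF s] by (simp add: hor_def)
    note hp = horizontal_projection_properties[where f = "\<lambda>u. F u s" and \<D> = hor, OF tbl[OF s] c W(1) W(2)[OF s] h]
    show ap: "blinfun_apply (P s) = horizontal_projection \<kappa> (\<lambda>u. F u s) hor u"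
      unfolding P_def by (rule bounded_linear_Blinfun_apply[OF hp(3)])
    show "X - P s X \<in> W" unfolding ap by (rule hp(1))
    show "d s (P s X) \<bullet> d s w = 0" if "w \<in> W" unfolding ap d_ap[OF s] by (rule hp(2)[OF that])
  qed
  have sym_t: "D [(v, 0), (0, 1)] (x, t) = D [(0, 1), (v, 0)] (x, t)" for v
    using Iopen tower_symmetric_space_time[OF D(1) op x t] by auto
  have sym_x: "D [(v, 0), (w, 0)] (x, t) = D [(w, 0), (v, 0)] (x, t)" for v w
    using Iopen tower_symmetric_space_time[OF D(1) op x t] by auto
  define d' where "d' = Blinfun (\<lambda>v. D [(v, 0), (0, 1)] (x, t))"
  have "(d has_vector_derivative d') (at t within I)"
    unfolding d_def[abs_def] d'_def by (rule tower_operator_time_derivative[OF D(1) x t sym_t])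
  moreover obtain c where "c > 0" "\<And>X. c * norm X \<le> norm (d t X)" using below[OF t] by (auto simp: d_ap[OF t])
  ultimately have der: "((\<lambda>s. pullback_inner (d s o\<^sub>L P s) (d s o\<^sub>L P s)) has_vector_derivative
      pullback_inner (d' o\<^sub>L P t) (d t o\<^sub>L P t) + pullback_inner (d t o\<^sub>L P t) (d' o\<^sub>L P t)) (at t within I)"
    using t W(1) PW Porth by (intro projected_metric_has_derivative) auto
  have metric: "horizontal_part \<kappa> (\<lambda>u. F u s) hor u (induced_metric \<kappa> (\<lambda>u. F u s) u) = pullback_inner (d s o\<^sub>L P s) (d s o\<^sub>L P s)"
    if "s \<in> I" for s
    by (simp add: horizontal_part_def pullback_inner_def induced_metric_def d_ap[OF that] P_ap[OF that])
  have velocity: "D [(0, 1)] (snd \<kappa>' w, t) = H w t"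
    if "derivative_tower (snd \<kappa>' ` fst \<kappa>' \<times> I) D" "\<And>s. s \<in> I \<Longrightarrow> D [] (snd \<kappa>' w, s) = F w s" "w \<in> fst \<kappa>'"
    for D and \<kappa>' :: "('m, 'e) chart" and w
  proof -
    obtain \<eta> where \<eta>: "regularized_mean_curvature A (\<lambda>u. F u t) w \<eta>" "(F w has_vector_derivative \<eta>) (at t within I)"
      using flow(1) t unfolding regularized_mcf_def by blast
    have "\<eta> = H w t" by (rule regularized_mean_curvature_unique[OF manifold \<eta>(1) mean_curvature[OF t]])
    have "((\<lambda>s. D [] (snd \<kappa>' w, s)) has_vector_derivative D [(0, 1)] (snd \<kappa>' w, t)) (at t within I)"
      by (rule tower_time_derivative[OF that(1) _ t]) (use that(3) in simp)
    then have "(F w has_vector_derivative D [(0, 1)] (snd \<kappa>' w, t)) (at t within I)"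
      by (rule has_vector_derivative_transform[OF t, rotated]) (simp add: that(2))
    moreover have "at t within I \<noteq> bot"
    proof -
      obtain r where r: "r > 0" "{t..t + r} \<subseteq> I" using Iopen by blast
      then have "at t within {t..t + r} \<noteq> bot" by (simp add: at_within_Icc_at_right trivial_limit_at_right_real)
      then show ?thesis using at_le[OF r(2), of t] by (metis bot.extremum_unique)
    qed
    ultimately show ?thesis
      using vector_derivative_unique_within[of t I "F w"] \<eta>(2) \<open>\<eta> = H w t\<close> by blast
  qed
  \<comment> \<open>With \<open>k = 1 / \<parallel>H\<parallel>\<close> at \<open>u\<close> this field is the normal extension of \<open>\<xi>\<close>.\<close>
  have Hsmooth: "smooth_map_on UNIV A vector_atlas (\<lambda>w. k *\<^sub>R H w t)" for k
    unfolding smooth_map_on_vector_atlas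
  proof (intro conjI ballI)
    have sm: "smooth_on (snd \<mu> ` fst \<mu>) ((\<lambda>w. k *\<^sub>R H w t) \<circ> chart_inv \<mu>)" if \<mu>: "\<mu> \<in> A" for \<mu>
    proof -
      obtain D where D: "derivative_tower (snd \<mu> ` fst \<mu> \<times> I) D"
        "\<And>w s. w \<in> fst \<mu> \<Longrightarrow> s \<in> I \<Longrightarrow> D [] (snd \<mu> w, s) = F w s"
        by (rule flow_tower[OF manifold \<mu> smooth]) blast
      have "D [(0, k)] (snd \<mu> w, t) = k *\<^sub>R H w t" if "w \<in> fst \<mu>" for w
      proof -
        have "D [k *\<^sub>R (0, 1)] (snd \<mu> w, t) = k *\<^sub>R D [(0, 1)] (snd \<mu> w, t)"
          by (rule linear_scale[OF tower_linear[OF D(1)]]) (use that t in auto)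
        then show ?thesis using velocity[OF D(1) D(2)[OF that] that] by simp
      qed
      moreover have "derivative_tower (snd \<mu> ` fst \<mu>) (\<lambda>vs y. D (map (\<lambda>v. (v, 0)) vs @ [(0, k)]) (y, t))"
        by (rule tower_slice[OF D(1)]) (use t in auto)
      ultimately show ?thesis unfolding smooth_on_iff_tower
        by (intro exI[of _ "\<lambda>vs y. D (map (\<lambda>v. (v, 0)) vs @ [(0, k)]) (y, t)"])
          (auto simp: chart_inv_snd[OF manifold \<mu>])
    qed
    show "smooth_on (snd \<mu> ` (fst \<mu> \<inter> UNIV)) ((\<lambda>w. k *\<^sub>R H w t) \<circ> chart_inv \<mu>)" if "\<mu> \<in> A" for \<mu>
      using sm[OF that] by simp
    have "isCont (\<lambda>w. k *\<^sub>R H w t) w" for w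
    proof -
      obtain \<mu> where \<mu>: "\<mu> \<in> A" "w \<in> fst \<mu>" using manifold unfolding hilbert_manifold_def by blast
      have opm: "open (fst \<mu>)" by (rule chart_domain_open[OF manifold \<mu>(1)])
      have "continuous_on (snd \<mu> ` fst \<mu>) ((\<lambda>w. k *\<^sub>R H w t) \<circ> chart_inv \<mu>)"
        using smooth_on_has_derivative[OF sm[OF \<mu>(1)]] has_derivative_continuous
        by (metis continuous_on_eq_continuous_within)
      moreover have "continuous_on (fst \<mu>) (snd \<mu>)"
        using manifold \<mu>(1) by (auto simp: hilbert_manifold_def homeomorphism_def)
      ultimately have "continuous_on (fst \<mu>) (((\<lambda>w. k *\<^sub>R H w t) \<circ> chart_inv \<mu>) \<circ> snd \<mu>)"
        by (rule continuous_on_compose[rotated])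
      then have "continuous_on (fst \<mu>) (\<lambda>w. k *\<^sub>R H w t)"
        by (rule continuous_on_eq) (simp add: chart_inv_snd[OF manifold \<mu>(1)])
      then show ?thesis using opm \<mu>(2) by (simp add: continuous_on_eq_continuous_at)
    qed
    then show "continuous_on UNIV (\<lambda>w. k *\<^sub>R H w t)" by (simp add: continuous_at_imp_continuous_on)
  qed
  have Hnormal: "k *\<^sub>R H w t \<in> normal_space_at A (\<lambda>u. F u t) w" for k w
    using mean_curvature[OF t, of w] unfolding regularized_mean_curvature_def normal_space_at_def
    by (intro subspace_scale[OF subspace_orthogonal_comp]) blast
  have Hx: "D [(0, 1)] (snd \<kappa> w, t) = H w t" if "w \<in> fst \<kappa>" for w
    by (rule velocity[OF D(1) D(2)[OF that] that])
  have d'_ap: "d' v = D [(v, 0), (0, 1)] (x, t)" for v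
  proof -
    have "bounded_linear (\<lambda>v. D [(v, 0), (0, 1)] (x, t))"
      by (rule bounded_linear_compose[OF tower_bounded_linear[OF D(1), of "(x, t)" "[(0, 1)]"]
            bounded_linear_Pair[OF bounded_linear_ident bounded_linear_zero]]) (use x t in simp)
    then show ?thesis by (simp add: d'_def bounded_linear_Blinfun_apply)
  qed
  \<comment> \<open>By the symmetry of mixed derivatives \<open>d'\<close> is the differential of the normal field \<open>H\<close>.\<close>
  have weingarten: "d' X \<bullet> d t Y = - (H u t \<bullet> D [(X, 0), (Y, 0)] (x, t))" for X Y
  proof -
    have "tmap \<kappa> (\<lambda>w. 1 *\<^sub>R H w t) u X \<bullet> E t [Y] (snd \<kappa> u) = - (1 *\<^sub>R H u t \<bullet> E t [X, Y] (snd \<kappa> u))"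
      by (rule normal_field_derivative[OF manifold \<kappa> open_UNIV u UNIV_I E[OF t] E0[OF t] Hsmooth Hnormal])
    moreover have "tmap \<kappa> (\<lambda>w. H w t) u = (\<lambda>v. D (map (\<lambda>v. (v, 0)) [v] @ [(0, 1)]) (snd \<kappa> u, t))"
    proof (rule tmap_tower[OF manifold \<kappa> _ _ u])
      show "derivative_tower (snd \<kappa> ` fst \<kappa>) (\<lambda>vs y. D (map (\<lambda>v. (v, 0)) vs @ [(0, 1)]) (y, t))"
        by (rule tower_slice[OF D(1)]) (use t in auto)
    qed (use Hx in simp)
    ultimately show ?thesis by (simp add: E_def d'_ap d_ap[OF t] tm[OF t] x_def)
  qed
  have derivative: "pullback_inner (d' o\<^sub>L P t) (d t o\<^sub>L P t) + pullback_inner (d t o\<^sub>L P t) (d' o\<^sub>L P t) =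
      (- 2 * norm (H u t)) *\<^sub>R horizontal_part \<kappa> (\<lambda>u. F u t) hor u
        (second_fundamental_form A \<kappa> (\<lambda>u. F u t) u (\<xi> u t))" (is "?L = ?R")
  proof -
    have L: "?L X Y = - 2 * (H u t \<bullet> D [(P t X, 0), (P t Y, 0)] (x, t))" for X Y
      using weingarten[of "P t X" "P t Y"] weingarten[of "P t Y" "P t X"] sym_x[of "P t Y" "P t X"]
      by (simp add: blinfun.add_left pullback_inner_apply inner_commute)
    show ?thesis
    proof (cases "H u t = 0")
      case True
      show ?thesis by (intro blinfun_eqI) (simp add: L True)
    next
      case False
      define k where "k = 1 / norm (H u t)"
      have \<xi>: "\<xi> u t = k *\<^sub>R H u t"
        using False unfolding k_def by (subst (2) unit_normal(3)[OF t]) simp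
      have "second_fundamental_form A \<kappa> (\<lambda>u. F u t) u (k *\<^sub>R H u t) X Y = (k *\<^sub>R H u t) \<bullet> E t [X, Y] (snd \<kappa> u)" for X Y
        by (rule second_fundamental_form_eq[OF manifold \<kappa> imm[OF t] open_UNIV u UNIV_I E[OF t] E0[OF t] Hsmooth Hnormal])
      then have "second_fundamental_form A \<kappa> (\<lambda>u. F u t) u (\<xi> u t) (P t X) (P t Y) = ((- k / 2) *\<^sub>R ?L) X Y" for X Y
        by (simp only: L \<xi> blinfun.scaleR_left) (simp add: E_def x_def)
      then have "horizontal_part \<kappa> (\<lambda>u. F u t) hor u (second_fundamental_form A \<kappa> (\<lambda>u. F u t) u (\<xi> u t)) = (- k / 2) *\<^sub>R ?L"
        by (simp only: horizontal_part_def P_ap[OF t, symmetric] blinfun_apply_inverse)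
      then show ?thesis using False by (simp add: k_def)
    qed
  qed
  show "((\<lambda>s. horizontal_part \<kappa> (\<lambda>u. F u s) hor u (induced_metric \<kappa> (\<lambda>u. F u s) u))
      has_vector_derivative
      (- 2 * norm (H u t)) *\<^sub>R horizontal_part \<kappa> (\<lambda>u. F u t) hor u
        (second_fundamental_form A \<kappa> (\<lambda>u. F u t) u (\<xi> u t)))
    (at t within I)"
    using der unfolding derivative
    by (rule has_vector_derivative_transform[OF t, rotated]) (simp add: metric)
qed

end
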